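(* Let $\sigma,r,b>0$ and $\beta\in\mathbb{R}$. Consider the Lorenz 63 system with stochastic advection by Lie transport (SALT) noise on $\mathbb{R}^3$, given by the Stratonovich SDE $$dX=\sigma(Y-X)\,dt,\qquad dY=(rX-XZ-Y)\,dt-\beta Z\circ dW_t,\qquad dZ=(XY-bZ)\,dt+\beta Y\circ dW_t,$$ and let $\lambda_1,\lambda_2,\lambda_3$ be its Lyapunov exponents (as defined in the context). Then the sum of the Lyapunov exponents is equal to that of the deterministic Lorenz 63 system ($\beta=0$); namely, almost surely, $$\sum_{i=1}^3\lambda_i=-\sigma-1-b.$$
   Context: $W_t$ is a standard one-dimensional Brownian motion and $\circ\,dW_t$ denotes Stratonovich integration. Write the system as $dx_t=f_0(x_t)\,dt+f_1(x_t)\circ dW_t$ with $x=(X,Y,Z)$, $f_0(x)=(\sigma(Y-X),\,rX-XZ-Y,\,XY-bZ)$ and $f_1(x)=(0,-\beta Z,\beta Y)$. Let $x_t$ be the solution from a given initial condition $x_0 \in \mathbb{R}^3$ and let $v_t\in\mathbb{R}^{3\times3}$ solve the variational equation $$dv_t=Df_0(x_t)v_t\,dt+Df_1(x_t)v_t\circ dW_t,\qquad v_0=I.$$ The Lyapunov exponents $\lambda_1,\lambda_2,\lambda_3$ are the logarithms of the eigenvalues, counted with multiplicity, of $\Phi(\omega)=\lim_{t\to\infty}(v_t(\omega)^Tv_t(\omega))^{1/2t}$; it is a standing assumption (conclusion of Oseledets' multiplicative ergodic theorem) that this limit exists almost surely. The deterministic Lorenz 63 system is the case $\beta=0$. *)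

theory Defs
  imports
    "HOL-Probability.Probability"
    "HOL-Computational_Algebra.Polynomial"
begin

section \<open>Filtered probability spaces, Brownian motion, continuous semimartingales\<close>

text \<open>
  Time is the half line \<open>[0, \<infinity>)\<close> inside \<^typ>\<open>real\<close>; the values of processes and of the
  filtration at negative times are never constrained beyond monotonicity of the filtration.
  Path properties are only required almost surely, and the filtration is not assumed to be
  complete or right continuous.
\<close>

definition filtered_prob_space :: "'w measure \<Rightarrow> (real \<Rightarrow> 'w measure) \<Rightarrow> bool" where
  "filtered_prob_space P F \<longleftrightarrow>
     prob_space P \<and> filtration (space P) F \<and> (\<forall>t. subalgebra P (F t))"

definition adapted_process ::
  "(real \<Rightarrow> 'w measure) \<Rightarrow> (real \<Rightarrow> 'w \<Rightarrow> 'e::topological_space) \<Rightarrow> bool" where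
  "adapted_process F X \<longleftrightarrow> (\<forall>t\<ge>0. X t \<in> borel_measurable (F t))"

definition continuous_process ::
  "'w measure \<Rightarrow> (real \<Rightarrow> 'w \<Rightarrow> 'e::topological_space) \<Rightarrow> bool" where
  "continuous_process P X \<longleftrightarrow> (AE \<omega> in P. continuous_on {0..} (\<lambda>t. X t \<omega>))"

definition brownian_motion ::
  "'w measure \<Rightarrow> (real \<Rightarrow> 'w measure) \<Rightarrow> (real \<Rightarrow> 'w \<Rightarrow> real) \<Rightarrow> bool" where
  "brownian_motion P F W \<longleftrightarrow>
     adapted_process F W \<and> continuous_process P W \<and> (AE \<omega> in P. W 0 \<omega> = 0) \<and>
     (\<forall>s t. 0 \<le> s \<and> s < t \<longrightarrow>
        distributed P lborel (\<lambda>\<omega>. W t \<omega> - W s \<omega>) (normal_density 0 (sqrt (t - s))) \<and>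
        prob_space.indep_set P (sets (F s))
          {(\<lambda>\<omega>. W t \<omega> - W s \<omega>) -` A \<inter> space P | A. A \<in> sets borel})"

definition martingale ::
  "'w measure \<Rightarrow> (real \<Rightarrow> 'w measure) \<Rightarrow> (real \<Rightarrow> 'w \<Rightarrow> real) \<Rightarrow> bool" where
  "martingale P F M \<longleftrightarrow>
     adapted_process F M \<and> (\<forall>t\<ge>0. integrable P (M t)) \<and>
     (\<forall>s t. 0 \<le> s \<and> s \<le> t \<longrightarrow> (AE \<omega> in P. real_cond_exp P (F s) (M t) \<omega> = M s \<omega>))"

text \<open>
  Finite stopping times suffice for localisation: a localising sequence with values in
  \<open>[0, \<infinity>]\<close> can be replaced by its minimum with \<open>n\<close>.
\<close>

definition continuous_local_martingale ::
  "'w measure \<Rightarrow> (real \<Rightarrow> 'w measure) \<Rightarrow> (real \<Rightarrow> 'w \<Rightarrow> real) \<Rightarrow> bool" where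
  "continuous_local_martingale P F M \<longleftrightarrow>
     adapted_process F M \<and> continuous_process P M \<and>
     (\<exists>\<tau> :: nat \<Rightarrow> 'w \<Rightarrow> real.
        (\<forall>n. stopping_time F (\<tau> n) \<and> (\<forall>\<omega>\<in>space P. 0 \<le> \<tau> n \<omega>)) \<and>
        (AE \<omega> in P. incseq (\<lambda>n. \<tau> n \<omega>) \<and> filterlim (\<lambda>n. \<tau> n \<omega>) at_top sequentially) \<and>
        (\<forall>n. martingale P F (\<lambda>t \<omega>. M (min t (\<tau> n \<omega>)) \<omega> - M 0 \<omega>)))"

definition is_partition :: "real \<Rightarrow> nat \<Rightarrow> (nat \<Rightarrow> real) \<Rightarrow> bool" where
  "is_partition t n p \<longleftrightarrow> p 0 = 0 \<and> p n = t \<and> (\<forall>i<n. p i \<le> p (Suc i))"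

definition finite_variation_process ::
  "'w measure \<Rightarrow> (real \<Rightarrow> 'w measure) \<Rightarrow> (real \<Rightarrow> 'w \<Rightarrow> real) \<Rightarrow> bool" where
  "finite_variation_process P F A \<longleftrightarrow>
     adapted_process F A \<and> continuous_process P A \<and>
     (AE \<omega> in P. \<forall>t\<ge>0. \<exists>C. \<forall>n p. is_partition t n p \<longrightarrow>
        (\<Sum>i<n. \<bar>A (p (Suc i)) \<omega> - A (p i) \<omega>\<bar>) \<le> C)"

definition real_continuous_semimartingale ::
  "'w measure \<Rightarrow> (real \<Rightarrow> 'w measure) \<Rightarrow> (real \<Rightarrow> 'w \<Rightarrow> real) \<Rightarrow> bool" where
  "real_continuous_semimartingale P F X \<longleftrightarrow>
     adapted_process F X \<and> continuous_process P X \<and>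
     (\<exists>M A. continuous_local_martingale P F M \<and> finite_variation_process P F A \<and>
        (AE \<omega> in P. \<forall>t\<ge>0. X t \<omega> = X 0 \<omega> + M t \<omega> + A t \<omega>))"

definition continuous_semimartingale ::
  "'w measure \<Rightarrow> (real \<Rightarrow> 'w measure) \<Rightarrow> (real \<Rightarrow> 'w \<Rightarrow> 'e::euclidean_space) \<Rightarrow> bool" where
  "continuous_semimartingale P F X \<longleftrightarrow>
     (\<forall>e\<in>Basis. real_continuous_semimartingale P F (\<lambda>t \<omega>. X t \<omega> \<bullet> e))"


section \<open>Stratonovich integrals and equations\<close>

definition stratonovich_sum ::
  "(real \<Rightarrow> 'w \<Rightarrow> 'e::euclidean_space) \<Rightarrow> (real \<Rightarrow> 'w \<Rightarrow> real) \<Rightarrow> nat \<Rightarrow> (nat \<Rightarrow> real) \<Rightarrow> 'w \<Rightarrow> 'e" where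
  "stratonovich_sum H W n p \<omega> =
     (\<Sum>i<n. (W (p (Suc i)) \<omega> - W (p i) \<omega>) *\<^sub>R ((1/2) *\<^sub>R (H (p i) \<omega> + H (p (Suc i)) \<omega>)))"

text \<open>
  The random variable \<open>I\<close> is (a version of) the Stratonovich integral of the continuous
  semimartingale \<open>H\<close> against \<open>W\<close> over \<open>[0, t]\<close>: the limit in probability of the
  trapezoidal sums as the mesh of the partition tends to zero.
\<close>

definition has_stratonovich_integral ::
  "'w measure \<Rightarrow> (real \<Rightarrow> 'w measure) \<Rightarrow> (real \<Rightarrow> 'w \<Rightarrow> real) \<Rightarrow>
   (real \<Rightarrow> 'w \<Rightarrow> 'e::euclidean_space) \<Rightarrow> real \<Rightarrow> ('w \<Rightarrow> 'e) \<Rightarrow> bool" where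
  "has_stratonovich_integral P F W H t I \<longleftrightarrow>
     continuous_semimartingale P F H \<and> I \<in> borel_measurable P \<and>
     (\<forall>\<epsilon>>0. \<exists>\<delta>>0. \<forall>n p. is_partition t n p \<and> (\<forall>i<n. p (Suc i) - p i < \<delta>) \<longrightarrow>
        measure P {\<omega> \<in> space P. norm (stratonovich_sum H W n p \<omega> - I \<omega>) > \<epsilon>} < \<epsilon>)"

text \<open>\<open>dX = a dt + h \<circ> dW\<close> on \<open>[0, \<infinity>)\<close>.\<close>

definition stratonovich_equation ::
  "'w measure \<Rightarrow> (real \<Rightarrow> 'w measure) \<Rightarrow> (real \<Rightarrow> 'w \<Rightarrow> real) \<Rightarrow>
   (real \<Rightarrow> 'w \<Rightarrow> 'e::euclidean_space) \<Rightarrow> (real \<Rightarrow> 'w \<Rightarrow> 'e) \<Rightarrow> (real \<Rightarrow> 'w \<Rightarrow> 'e) \<Rightarrow> bool" where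
  "stratonovich_equation P F W X a h \<longleftrightarrow>
     continuous_semimartingale P F X \<and>
     (\<forall>t\<ge>0. \<exists>I. has_stratonovich_integral P F W h t I \<and>
        (AE \<omega> in P. X t \<omega> = X 0 \<omega> + integral {0..t} (\<lambda>s. a s \<omega>) + I \<omega>))"

definition stratonovich_solution ::
  "'w measure \<Rightarrow> (real \<Rightarrow> 'w measure) \<Rightarrow> (real \<Rightarrow> 'w \<Rightarrow> real) \<Rightarrow>
   (real^'n \<Rightarrow> real^'n) \<Rightarrow> (real^'n \<Rightarrow> real^'n) \<Rightarrow> real^'n \<Rightarrow> (real \<Rightarrow> 'w \<Rightarrow> real^'n) \<Rightarrow> bool" where
  "stratonovich_solution P F W f0 f1 x0 x \<longleftrightarrow>
     (AE \<omega> in P. x 0 \<omega> = x0) \<and>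
     stratonovich_equation P F W x (\<lambda>t \<omega>. f0 (x t \<omega>)) (\<lambda>t \<omega>. f1 (x t \<omega>))"

definition variational_solution ::
  "'w measure \<Rightarrow> (real \<Rightarrow> 'w measure) \<Rightarrow> (real \<Rightarrow> 'w \<Rightarrow> real) \<Rightarrow>
   (real^'n \<Rightarrow> real^'n) \<Rightarrow> (real^'n \<Rightarrow> real^'n) \<Rightarrow> (real \<Rightarrow> 'w \<Rightarrow> real^'n) \<Rightarrow>
   (real \<Rightarrow> 'w \<Rightarrow> real^'n^'n) \<Rightarrow> bool" where
  "variational_solution P F W f0 f1 x v \<longleftrightarrow>
     (AE \<omega> in P. v 0 \<omega> = mat 1) \<and>
     stratonovich_equation P F W v
       (\<lambda>t \<omega>. jacobian f0 (at (x t \<omega>)) ** v t \<omega>)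
       (\<lambda>t \<omega>. jacobian f1 (at (x t \<omega>)) ** v t \<omega>)"


section \<open>Lyapunov exponents\<close>

definition diag_matrix :: "real^'n \<Rightarrow> real^'n^'n" where
  "diag_matrix d = (\<chi> i j. if i = j then d $ i else 0)"

text \<open>
  Real power of a symmetric positive semidefinite matrix by spectral calculus; the result does
  not depend on the chosen orthogonal diagonalisation.
\<close>

definition psd_powr :: "real^'n^'n \<Rightarrow> real \<Rightarrow> real^'n^'n" where
  "psd_powr A s = (THE B. \<exists>Q d. orthogonal_matrix Q \<and> (\<forall>i. 0 \<le> d $ i) \<and>
     A = Q ** diag_matrix d ** transpose Q \<and>
     B = Q ** diag_matrix (\<chi> i. d $ i powr s) ** transpose Q)"

definition char_polynomial :: "real^'n^'n \<Rightarrow> real poly" where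
  "char_polynomial A = det (\<chi> i j. if i = j then [:- (A $ i $ j), 1:] else [:- (A $ i $ j):])"

text \<open>The real eigenvalues with algebraic multiplicity, in decreasing order.\<close>

definition eigenvalue_list :: "real^'n^'n \<Rightarrow> real list" where
  "eigenvalue_list A = rev (sorted_list_of_multiset (proots (char_polynomial A)))"

definition oseledets_family :: "(real \<Rightarrow> real^'n^'n) \<Rightarrow> real \<Rightarrow> real^'n^'n" where
  "oseledets_family V t = psd_powr (transpose (V t) ** V t) (1 / (2 * t))"

definition oseledets_convergent :: "(real \<Rightarrow> real^'n^'n) \<Rightarrow> bool" where
  "oseledets_convergent V \<longleftrightarrow> (\<exists>\<Phi>. (oseledets_family V \<longlongrightarrow> \<Phi>) at_top)"

definition oseledets_limit :: "(real \<Rightarrow> real^'n^'n) \<Rightarrow> real^'n^'n" where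
  "oseledets_limit V = Lim at_top (oseledets_family V)"

text \<open>
  The exponents are numbered from \<open>1\<close> to the dimension. Whenever the limit exists it is symmetric
  positive semidefinite, so the list of its real eigenvalues has full length.
  The value \<open>ln 0 = 0\<close> would misrepresent an exponent \<open>-\<infinity>\<close>; it does not arise when
  \<open>det (V t)\<close> is eventually bounded below by a positive exponential, as for flows of the
  Lorenz equations.
\<close>

definition lyapunov_exponent :: "(real \<Rightarrow> real^'n^'n) \<Rightarrow> nat \<Rightarrow> real" where
  "lyapunov_exponent V i = ln (eigenvalue_list (oseledets_limit V) ! (i - 1))"


section \<open>The Lorenz 63 system with SALT noise\<close>

definition lorenz_drift :: "real \<Rightarrow> real \<Rightarrow> real \<Rightarrow> real^3 \<Rightarrow> real^3" where
  "lorenz_drift \<sigma> r b x =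
     vector [\<sigma> * (x$2 - x$1), r * x$1 - x$1 * x$3 - x$2, x$1 * x$2 - b * x$3]"

definition salt_noise :: "real \<Rightarrow> real^3 \<Rightarrow> real^3" where
  "salt_noise \<beta> x = vector [0, - \<beta> * x$3, \<beta> * x$2]"

definition salt_lorenz_flow ::
  "'w measure \<Rightarrow> (real \<Rightarrow> 'w measure) \<Rightarrow> (real \<Rightarrow> 'w \<Rightarrow> real) \<Rightarrow>
   real \<Rightarrow> real \<Rightarrow> real \<Rightarrow> real \<Rightarrow> real^3 \<Rightarrow>
   (real \<Rightarrow> 'w \<Rightarrow> real^3) \<Rightarrow> (real \<Rightarrow> 'w \<Rightarrow> real^3^3) \<Rightarrow> bool" where
  "salt_lorenz_flow P F W \<sigma> r b \<beta> x0 x v \<longleftrightarrow>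
     stratonovich_solution P F W (lorenz_drift \<sigma> r b) (salt_noise \<beta>) x0 x \<and>
     variational_solution P F W (lorenz_drift \<sigma> r b) (salt_noise \<beta>) x v"

end

theory Submission
  imports Defs
begin

text \<open>
  The noise is linear: \<open>f\<^sub>1 x = B x\<close> with \<open>B\<close> antisymmetric, an infinitesimal rotation of the last
  two coordinates. Hence each column of \<open>v\<close> consists of a component without noise and a complex
  number \<open>w = v\<^sub>2 + i v\<^sub>3\<close> with \<open>dw = \<alpha> dt + i \<beta> w \<circ> dW\<close>, and this equation is solved by variation
  of constants, \<open>w = cis (\<beta> W) (w\<^sub>0 + \<integral> cis (- \<beta> W) \<alpha> dt)\<close>. Undoing the rotation does not
  change \<open>det v\<close> and leaves a linear equation without noise and with trace \<open>- \<sigma> - 1 - b\<close>, so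
  Liouville's formula gives \<open>det (v t) = exp ((- \<sigma> - 1 - b) t)\<close>. Finally \<open>det \<Phi>\<close> is the limit of
  \<open>\<bar>det (v t)\<bar> powr (1 / t)\<close>.

  Uniqueness for the Stratonovich equation is obtained without stochastic calculus. The
  errors of the trapezoidal rule on the cells of a partition have small sums over every subset of
  the cells, since the other cells can be refined away; averaging over the subsets (Khinchine)
  then shows that the sum of the squared errors is small in probability. This turns the equation into
  a recursion driven by the independent increments of \<open>W\<close>, for which a truncated second
  moment and a Gronwall argument force the difference of two solutions to vanish.
\<close>

section \<open>Powers of symmetric matrices and Lyapunov exponents\<close>

text \<open>The equation is known only through limits in probability of trapezoidal sums. Replacing
  the trapezoidal rule by the exact rotation creates products of a cell error with a Brownian
  increment. The increments are not absolutely summable, but the sums of their squares are bounded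
  in probability, so the cell errors have to be controlled in l2. Smallness of their total is too
  weak for that, since large errors may cancel; hence the detour through subset sums.

  The remaining recursion for the difference of two solutions starts without any moment bound, which
  is why it is truncated. Its second moments close because the mean of
  \<open>cis (\<beta> * D) - 1\<close>, for an increment D, is of the order of the time step and not
  of its square root.

  As the filtration need not be complete, a pathwise integral only agrees almost surely with an
  adapted random variable. The uniqueness proof therefore carries a process with continuous paths
  together with an adapted version of it.\<close>

lemma symmetric_inner_swap:
  fixes A :: "real^'n^'n"
  assumes "transpose A = A"
  shows "x \<bullet> (A *v y) = (A *v x) \<bullet> y"
  by (metis assms dot_lmul_matrix vector_transpose_matrix)

text \<open>A maximiser x of the Rayleigh quotient on the unit sphere of \<open>S\<close> is an
  eigenvector: its residual \<open>u\<close> lies in \<open>S\<close> by invariance and is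
  orthogonal to x, and a small move along \<open>u\<close> would increase the quotient to first
  order unless \<open>u = 0\<close>.\<close>

lemma symmetric_eigenvector_in_invariant_subspace:
  fixes A :: "real^'n^'n"
  assumes sym: "transpose A = A" and S: "subspace S" "S \<noteq> {0}"
    and inv: "\<And>x. x \<in> S \<Longrightarrow> A *v x \<in> S"
  obtains x l where "x \<in> S" "norm x = 1" "A *v x = l *\<^sub>R x"
proof -
  let ?C = "S \<inter> sphere 0 1"
  have "compact ?C"
    using closed_subspace[OF S(1)] compact_sphere by (metis Int_commute compact_Int_closed)
  moreover obtain z where z: "z \<in> S" "z \<noteq> 0"
    using S subspace_0 by blast
  then have "(1 / norm z) *\<^sub>R z \<in> ?C"
    using S(1) by (simp add: subspace_scale)
  then have "?C \<noteq> {}" by blast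
  moreover have "continuous_on ?C (\<lambda>x. x \<bullet> (A *v x))"
    by (intro continuous_intros matrix_vector_mult_linear_continuous_on)
  ultimately obtain x where x: "x \<in> ?C" and max: "\<And>y. y \<in> ?C \<Longrightarrow> y \<bullet> (A *v y) \<le> x \<bullet> (A *v x)"
    using continuous_attains_sup[of ?C "\<lambda>x. x \<bullet> (A *v x)"] by blast
  define l where "l = x \<bullet> (A *v x)"
  have xx: "x \<bullet> x = 1" and xS: "x \<in> S"
    using x by (simp_all add: norm_eq_1)
  have quad: "y \<bullet> (A *v y) \<le> l * (y \<bullet> y)" if "y \<in> S" for y
  proof (cases "y = 0")
    case False
    then have n: "norm y > 0" by simp
    have "((1 / norm y) *\<^sub>R y) \<in> ?C"
      using that S(1) False by (simp add: subspace_scale)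
    from max[OF this] have "(y \<bullet> (A *v y)) / (norm y)\<^sup>2 \<le> l"
      by (simp add: l_def matrix_vector_mult_scaleR power2_eq_square field_simps)
    then show ?thesis
      using n by (simp add: field_simps power2_norm_eq_inner)
  qed simp
  define u where "u = A *v x - l *\<^sub>R x"
  have uS: "u \<in> S"
    unfolding u_def using S(1) inv xS by (intro subspace_diff subspace_scale)
  define c where "c = l * (u \<bullet> u) - u \<bullet> (A *v u)"
  have var: "2 * e * (u \<bullet> u) \<le> e\<^sup>2 * c" for e
  proof -
    have "x + e *\<^sub>R u \<in> S"
      using S(1) xS uS by (intro subspace_add subspace_scale)
    from quad[OF this]
    have "l + e * (x \<bullet> (A *v u)) + e * (u \<bullet> (A *v x)) + e\<^sup>2 * (u \<bullet> (A *v u))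
        \<le> l * (1 + 2 * e * (x \<bullet> u) + e\<^sup>2 * (u \<bullet> u))"
      by (simp add: matrix_vector_right_distrib matrix_vector_mult_scaleR inner_add_left inner_add_right
          l_def[symmetric] xx power2_eq_square inner_commute algebra_simps)
    moreover have "x \<bullet> (A *v u) = u \<bullet> (A *v x)"
      by (metis inner_commute symmetric_inner_swap[OF sym])
    moreover have xu: "x \<bullet> u = 0"
      by (simp add: u_def inner_diff_right xx l_def[symmetric])
    moreover have "u \<bullet> (A *v x) = u \<bullet> (u + l *\<^sub>R x)"
      by (simp add: u_def)
    then have "u \<bullet> (A *v x) = u \<bullet> u"
      using xu by (simp add: inner_add_right inner_commute)
    ultimately show ?thesis
      by (simp add: c_def algebra_simps)
  qed
  have "u = 0"
  proof (rule ccontr)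
    assume "u \<noteq> 0"
    then have q: "u \<bullet> u > 0" by simp
    \<comment> \<open>Small enough that \<open>e * c\<close> stays below
      \<open>u \<bullet> u\<close>, so the quadratic term of \<open>var\<close> cannot outweigh the
      linear one.\<close>
    define e where "e = (u \<bullet> u) / (\<bar>c\<bar> + 1)"
    have e: "e > 0" unfolding e_def using q by (intro divide_pos_pos) auto
    have "2 * (u \<bullet> u) \<le> e * c"
      using var[of e] e by (simp add: power2_eq_square)
    also have "\<dots> \<le> e * (\<bar>c\<bar> + 1)"
      using e by (intro mult_left_mono) auto
    also have "\<dots> = u \<bullet> u" unfolding e_def by (simp add: add_nonneg_eq_0_iff)
    finally show False using q by simp
  qed
  then show ?thesis
    using that[of x l] xS x by (simp add: u_def)
qed

text \<open>By symmetry the orthogonal complement of the eigenvectors found so far is invariant, and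
  it is nonzero as long as they are fewer than the dimension; it therefore contains the next
  eigenvector.\<close>

lemma symmetric_orthonormal_eigenvectors:
  fixes A :: "real^'n^'n"
  assumes sym: "transpose A = A" and "k \<le> CARD('n)"
  shows "\<exists>B. finite B \<and> card B = k \<and> (\<forall>x\<in>B. norm x = 1 \<and> (\<exists>l. A *v x = l *\<^sub>R x)) \<and>
    pairwise orthogonal B"
  using assms(2)
proof (induction k)
  case 0
  show ?case by (intro exI[of _ "{}"]) auto
next
  case (Suc k)
  then obtain B where B: "finite B" "card B = k" "\<And>x. x \<in> B \<Longrightarrow> norm x = 1"
    "\<And>x. x \<in> B \<Longrightarrow> \<exists>l. A *v x = l *\<^sub>R x" "pairwise orthogonal B"
    by auto
  let ?S = "{x. \<forall>b\<in>B. orthogonal b x}"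
  have "dim B \<le> k" using B(1,2) dim_le_card' by blast
  then have "dim B < DIM(real^'n)" using Suc.prems by simp
  then obtain z where z: "z \<noteq> 0" "\<And>y. y \<in> span B \<Longrightarrow> orthogonal z y"
    using orthogonal_to_subspace_exists by blast
  then have "z \<in> ?S" by (auto simp: orthogonal_commute span_base)
  have sub: "subspace ?S"
    by (auto simp: subspace_def orthogonal_clauses)
  have inv: "A *v x \<in> ?S" if "x \<in> ?S" for x
  proof clarsimp
    fix b assume "b \<in> B"
    then obtain l where "A *v b = l *\<^sub>R b" using B(4) by blast
    then have "b \<bullet> (A *v x) = l * (b \<bullet> x)" by (simp add: symmetric_inner_swap[OF sym])
    then show "orthogonal b (A *v x)"
      using that \<open>b \<in> B\<close> by (auto simp: orthogonal_def)
  qed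
  obtain x l where x: "x \<in> ?S" "norm x = 1" "A *v x = l *\<^sub>R x"
    using symmetric_eigenvector_in_invariant_subspace[OF sym sub _ inv] \<open>z \<in> ?S\<close> z(1) by blast
  have "x \<notin> B"
    using x(1,2) by (auto simp: orthogonal_def)
  moreover have "pairwise orthogonal (insert x B)"
    using B(5) x(1) by (auto simp: pairwise_insert orthogonal_commute)
  ultimately show ?case
    using B x by (intro exI[of _ "insert x B"]) auto
qed

section \<open>Orthogonal diagonalisation and spectral calculus\<close>

lemma mult_diag_matrix_nth: "(A ** diag_matrix d) $ i $ j = A $ i $ j * d $ j"
proof -
  have "(A ** diag_matrix d) $ i $ j = (\<Sum>k\<in>UNIV. if k = j then A $ i $ k * d $ k else 0)"
    by (simp add: matrix_matrix_mult_def diag_matrix_def if_distrib if_distribR cong: if_cong)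
  then show ?thesis by simp
qed

lemma diag_matrix_mult_nth: "(diag_matrix d ** A) $ i $ j = d $ i * A $ i $ j"
proof -
  have "(diag_matrix d ** A) $ i $ j = (\<Sum>k\<in>UNIV. if i = k then d $ k * A $ k $ j else 0)"
    by (simp add: matrix_matrix_mult_def diag_matrix_def if_distrib if_distribR cong: if_cong)
  then show ?thesis by simp
qed

lemma transpose_diag_matrix: "transpose (diag_matrix d) = diag_matrix d"
  by (auto simp: transpose_def diag_matrix_def vec_eq_iff)

lemma det_diag_matrix: "det (diag_matrix d) = (\<Prod>i\<in>UNIV. d $ i)"
  by (subst det_diagonal) (auto simp: diag_matrix_def)

lemma symmetric_diagonalization:
  fixes A :: "real^'n^'n"
  assumes sym: "transpose A = A"
  obtains Q d where "orthogonal_matrix Q" "A = Q ** diag_matrix d ** transpose Q"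
proof -
  obtain B where B: "finite B" "card B = CARD('n)" "\<And>x. x \<in> B \<Longrightarrow> norm x = 1"
    "\<And>x. x \<in> B \<Longrightarrow> \<exists>l. A *v x = l *\<^sub>R x" "pairwise orthogonal B"
    using symmetric_orthonormal_eigenvectors[OF sym order_refl] by blast
  obtain q where q: "bij_betw q (UNIV :: 'n set) B"
    using B(1,2) finite_same_card_bij[of "UNIV :: 'n set" B] by auto
  then have qB: "q j \<in> B" for j by (auto simp: bij_betw_def)
  obtain l where l: "\<And>j. A *v q j = l j *\<^sub>R q j"
    using B(4)[OF qB] by metis
  define Q where "Q = (\<chi> i j. q j $ i)"
  define d where "d = (\<chi> j. l j)"
  have col: "column j Q = q j" for j by (simp add: Q_def column_def)
  have "orthogonal_matrix Q"
    unfolding orthogonal_matrix_orthonormal_columns col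
    using B(3)[OF qB] B(5) q qB unfolding pairwise_def bij_betw_def inj_def by blast
  have "(A ** Q) $ i $ j = (Q ** diag_matrix d) $ i $ j" for i j
  proof -
    have "(A ** Q) $ i $ j = (A *v q j) $ i"
      by (simp add: matrix_matrix_mult_def matrix_vector_mult_def Q_def)
    then show ?thesis
      by (simp add: mult_diag_matrix_nth Q_def d_def l)
  qed
  then have "A ** Q = Q ** diag_matrix d" by (simp add: vec_eq_iff)
  then have "A ** (Q ** transpose Q) = Q ** diag_matrix d ** transpose Q"
    by (metis matrix_mul_assoc)
  then have "A = Q ** diag_matrix d ** transpose Q"
    using \<open>orthogonal_matrix Q\<close> by (simp add: orthogonal_matrix_def)
  with \<open>orthogonal_matrix Q\<close> show ?thesis using that by blast
qed

lemma det_orthogonal_conj: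
  fixes Q D :: "real^'n^'n"
  assumes "orthogonal_matrix Q"
  shows "det (Q ** D ** transpose Q) = det D"
  using det_orthogonal_matrix[OF assms] by (auto simp: det_mul det_transpose)

text \<open>The quadratic form takes the value \<open>d $ i\<close> at the i-th column of
  \<open>Q\<close>.\<close>

lemma diagonalization_nonneg:
  fixes A :: "real^'n^'n"
  assumes Q: "orthogonal_matrix Q" and A: "A = Q ** diag_matrix d ** transpose Q"
    and pos: "\<And>x. x \<bullet> (A *v x) \<ge> 0"
  shows "d $ i \<ge> 0"
proof -
  have QQ: "transpose Q ** Q = mat 1" using Q by (simp add: orthogonal_matrix_def)
  define e :: "real^'n" where "e = axis i 1"
  have "diag_matrix d *v e = d $ i *\<^sub>R e"
    unfolding e_def matrix_vector_mult_basis
    by (simp add: vec_eq_iff column_def diag_matrix_def axis_def)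
  moreover have "A *v (Q *v e) = Q *v (diag_matrix d *v e)"
  proof -
    have "A *v (Q *v e) = (Q ** diag_matrix d ** (transpose Q ** Q)) *v e"
      by (simp only: A matrix_vector_mul_assoc matrix_mul_assoc)
    then show ?thesis by (simp add: QQ matrix_vector_mul_assoc)
  qed
  ultimately have "(Q *v e) \<bullet> (A *v (Q *v e)) = d $ i * ((Q *v e) \<bullet> (Q *v e))"
    by (simp add: matrix_vector_mult_scaleR)
  moreover have "(Q *v e) \<bullet> (Q *v e) = (transpose Q *v (Q *v e)) \<bullet> e"
    by (simp add: dot_lmul_matrix)
  then have "(Q *v e) \<bullet> (Q *v e) = 1"
    by (simp add: matrix_vector_mul_assoc QQ e_def inner_axis_axis)
  ultimately show ?thesis using pos[of "Q *v e"] by simp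
qed

text \<open>The matrix \<open>R = transpose Q' ** Q\<close> intertwines the two diagonal matrices,
  so a nonzero entry of \<open>R\<close> at (i, j) forces \<open>d $ j = d' $ i\<close>. Hence
  \<open>R\<close> also intertwines the images of the diagonals under any function \<open>f\<close>.
  With a power for \<open>f\<close> this makes \<open>psd_powr\<close> independent of the
  diagonalisation.\<close>

lemma diag_powr_unique:
  fixes Q Q' :: "real^'n^'n"
  assumes Q: "orthogonal_matrix Q" and Q': "orthogonal_matrix Q'"
    and eq: "Q ** diag_matrix d ** transpose Q = Q' ** diag_matrix d' ** transpose Q'"
  shows "Q ** diag_matrix (\<chi> i. f (d $ i)) ** transpose Q
    = Q' ** diag_matrix (\<chi> i. f (d' $ i)) ** transpose Q'"
proof -
  have QQ: "transpose Q ** Q = mat 1" "Q ** transpose Q = mat 1"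
    "transpose Q' ** Q' = mat 1" "Q' ** transpose Q' = mat 1"
    using Q Q' by (auto simp: orthogonal_matrix_def)
  define R where "R = transpose Q' ** Q"
  have "R ** diag_matrix d = transpose Q' ** (Q ** diag_matrix d ** transpose Q) ** Q"
    unfolding R_def by (metis QQ(1) matrix_mul_assoc matrix_mul_rid)
  also have "\<dots> = diag_matrix d' ** R"
    unfolding eq R_def by (metis QQ(3) matrix_mul_assoc matrix_mul_lid)
  finally have "R $ i $ j * d $ j = d' $ i * R $ i $ j" for i j
    by (metis mult_diag_matrix_nth diag_matrix_mult_nth)
  then have "R $ i $ j * f (d $ j) = f (d' $ i) * R $ i $ j" for i j
    by (cases "R $ i $ j = 0") (auto simp: mult.commute, metis mult.commute mult_right_cancel)
  then have R: "R ** diag_matrix (\<chi> i. f (d $ i)) = diag_matrix (\<chi> i. f (d' $ i)) ** R"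
    by (simp add: vec_eq_iff mult_diag_matrix_nth diag_matrix_mult_nth)
  have "Q ** diag_matrix (\<chi> i. f (d $ i)) ** transpose Q
      = (Q' ** transpose Q') ** Q ** diag_matrix (\<chi> i. f (d $ i)) ** transpose Q"
    by (simp add: QQ)
  also have "\<dots> = Q' ** (R ** diag_matrix (\<chi> i. f (d $ i))) ** transpose Q"
    by (simp only: R_def matrix_mul_assoc)
  also have "\<dots> = Q' ** diag_matrix (\<chi> i. f (d' $ i)) ** transpose Q' ** (Q ** transpose Q)"
    unfolding R by (simp only: R_def matrix_mul_assoc)
  also have "\<dots> = Q' ** diag_matrix (\<chi> i. f (d' $ i)) ** transpose Q'"
    by (simp add: QQ)
  finally show ?thesis .
qed

lemma psd_powr_diagonalization:
  fixes A :: "real^'n^'n"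
  assumes sym: "transpose A = A" and pos: "\<And>x. x \<bullet> (A *v x) \<ge> 0"
  obtains Q d where "orthogonal_matrix Q" "\<And>i. 0 \<le> d $ i" "A = Q ** diag_matrix d ** transpose Q"
    "psd_powr A s = Q ** diag_matrix (\<chi> i. d $ i powr s) ** transpose Q"
proof -
  obtain Q d where Q: "orthogonal_matrix Q" and A: "A = Q ** diag_matrix d ** transpose Q"
    using symmetric_diagonalization[OF sym] .
  have d: "0 \<le> d $ i" for i using diagonalization_nonneg[OF Q A pos] .
  have "psd_powr A s = Q ** diag_matrix (\<chi> i. d $ i powr s) ** transpose Q"
    unfolding psd_powr_def
  proof (rule the_equality)
    show "\<exists>Q' d'. orthogonal_matrix Q' \<and> (\<forall>i. 0 \<le> d' $ i) \<and> A = Q' ** diag_matrix d' ** transpose Q' \<and>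
       Q ** diag_matrix (\<chi> i. d $ i powr s) ** transpose Q
       = Q' ** diag_matrix (\<chi> i. d' $ i powr s) ** transpose Q'"
      using Q d A by blast
  next
    fix B
    assume "\<exists>Q' d'. orthogonal_matrix Q' \<and> (\<forall>i. 0 \<le> d' $ i) \<and> A = Q' ** diag_matrix d' ** transpose Q' \<and>
       B = Q' ** diag_matrix (\<chi> i. d' $ i powr s) ** transpose Q'"
    then show "B = Q ** diag_matrix (\<chi> i. d $ i powr s) ** transpose Q"
      using diag_powr_unique[OF Q _ , where f = "\<lambda>x. x powr s"] A by metis
  qed
  with Q d A show ?thesis using that by blast
qed

lemma transpose_orthogonal_conj_diag:
  "transpose (Q ** diag_matrix d ** transpose Q) = Q ** diag_matrix d ** transpose (Q :: real^'n^'n)"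
  by (simp add: matrix_transpose_mul transpose_diag_matrix matrix_mul_assoc)

lemma orthogonal_conj_diag_psd:
  fixes Q :: "real^'n^'n"
  assumes "\<And>i. 0 \<le> d $ i"
  shows "x \<bullet> ((Q ** diag_matrix d ** transpose Q) *v x) \<ge> 0"
proof -
  define z where "z = transpose Q *v x"
  have "x \<bullet> ((Q ** diag_matrix d ** transpose Q) *v x) = z \<bullet> (diag_matrix d *v z)"
    unfolding z_def
    by (metis dot_lmul_matrix matrix_vector_mul_assoc vector_transpose_matrix transpose_transpose)
  also have "\<dots> = (\<Sum>i\<in>UNIV. d $ i * (z $ i)\<^sup>2)"
    by (auto simp: inner_vec_def matrix_vector_mult_def diag_matrix_def if_distrib if_distribR
        power2_eq_square algebra_simps cong: if_cong intro!: sum.cong)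
  also have "\<dots> \<ge> 0" by (intro sum_nonneg mult_nonneg_nonneg) (auto simp: assms)
  finally show ?thesis .
qed

lemma psd_powr_properties:
  fixes A :: "real^'n^'n"
  assumes "transpose A = A" "\<And>x. x \<bullet> (A *v x) \<ge> 0"
  shows transpose_psd_powr: "transpose (psd_powr A s) = psd_powr A s"
    and psd_powr_psd: "x \<bullet> (psd_powr A s *v x) \<ge> 0"
    and det_psd_powr: "det (psd_powr A s) = det A powr s"
proof -
  obtain Q d where Q: "orthogonal_matrix Q" and d: "\<And>i. 0 \<le> d $ i"
    and A: "A = Q ** diag_matrix d ** transpose Q"
    and p: "psd_powr A s = Q ** diag_matrix (\<chi> i. d $ i powr s) ** transpose Q"
    using psd_powr_diagonalization[OF assms] by metis
  show "transpose (psd_powr A s) = psd_powr A s"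
    unfolding p by (rule transpose_orthogonal_conj_diag)
  show "x \<bullet> (psd_powr A s *v x) \<ge> 0"
    unfolding p by (rule orthogonal_conj_diag_psd) simp
  have "det (psd_powr A s) = (\<Prod>i\<in>UNIV. d $ i powr s)"
    unfolding p det_orthogonal_conj[OF Q] det_diag_matrix by simp
  also have "\<dots> = (\<Prod>i\<in>UNIV. d $ i) powr s"
    using d by (simp add: prod_powr_distrib)
  also have "\<dots> = det A powr s"
    unfolding A det_orthogonal_conj[OF Q] det_diag_matrix by simp
  finally show "det (psd_powr A s) = det A powr s" .
qed

section \<open>Eigenvalue lists and the sum of the exponents\<close>

lemma poly_char_polynomial: "poly (char_polynomial A) x = det (mat x - A)" for A :: "real^'n^'n"
  unfolding char_polynomial_def det_def
  by (auto simp: poly_sum poly_prod mat_def intro!: sum.cong prod.cong)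

lemma matrix_diff_ldistrib: "A ** (B - C) = A ** B - A ** C" for B C :: "real^'n^'m"
  by (simp add: vec_eq_iff matrix_matrix_mult_def right_diff_distrib sum_subtractf)

lemma matrix_diff_rdistrib: "(A - B) ** C = A ** C - B ** C" for A B :: "real^'n^'m"
  by (simp add: vec_eq_iff matrix_matrix_mult_def left_diff_distrib sum_subtractf)

text \<open>The conjugation is an identity of real matrices, whereas \<open>char_polynomial\<close>
  is a determinant over polynomials. The two sides are therefore compared at every real point, which
  determines a real polynomial.\<close>

lemma char_polynomial_diagonalizable:
  fixes Q :: "real^'n^'n"
  assumes Q: "orthogonal_matrix Q"
  shows "char_polynomial (Q ** diag_matrix d ** transpose Q) = (\<Prod>i\<in>UNIV. [:- (d $ i), 1:])"
proof -
  have "poly (char_polynomial (Q ** diag_matrix d ** transpose Q)) x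
      = poly (\<Prod>i\<in>UNIV. [:- (d $ i), 1:]) x" for x
  proof -
    have "mat x - Q ** diag_matrix d ** transpose Q = Q ** (mat x - diag_matrix d) ** transpose Q"
    proof -
      have "Q ** mat x = x *\<^sub>R Q"
        by (auto simp: vec_eq_iff matrix_matrix_mult_def mat_def if_distrib if_distribR cong: if_cong)
      then have "Q ** mat x ** transpose Q = x *\<^sub>R (Q ** transpose Q)"
        by (simp add: scalar_matrix_assoc scalar_mult_eq_scaleR)
      also have "\<dots> = mat x"
        using Q by (auto simp: orthogonal_matrix_def mat_def vec_eq_iff)
      finally show ?thesis
        using matrix_diff_ldistrib[of Q "mat x" "diag_matrix d"]
          matrix_diff_rdistrib[of "Q ** mat x" "Q ** diag_matrix d" "transpose Q"]
        by simp
    qed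
    moreover have "mat x - diag_matrix d = diag_matrix (\<chi> i. x - d $ i)"
      by (auto simp: vec_eq_iff mat_def diag_matrix_def)
    ultimately show ?thesis
      unfolding poly_char_polynomial
      by (simp add: det_orthogonal_conj[OF Q] det_diag_matrix poly_prod)
  qed
  then show ?thesis by (simp add: poly_eq_poly_eq_iff[symmetric] fun_eq_iff)
qed

lemma sum_ln_eigenvalue_list:
  fixes A :: "real^'n^'n"
  assumes sym: "transpose A = A" and pos: "\<And>x. x \<bullet> (A *v x) \<ge> 0" and det: "det A > 0"
  shows "(\<Sum>i=1..CARD('n). ln (eigenvalue_list A ! (i - 1))) = ln (det A)"
proof -
  obtain Q d where Q: "orthogonal_matrix Q" and A: "A = Q ** diag_matrix d ** transpose Q"
    using symmetric_diagonalization[OF sym] .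
  have d0: "0 \<le> d $ i" for i using diagonalization_nonneg[OF Q A pos] .
  have detA: "det A = (\<Prod>i\<in>UNIV. d $ i)"
    unfolding A det_orthogonal_conj[OF Q] det_diag_matrix ..
  \<comment> \<open>Strict positivity is what allows \<open>ln\<close> of the product to be split,
    since \<open>ln 0 = 0\<close> would break the identity.\<close>
  have dpos: "0 < d $ i" for i
    using d0[of i] det unfolding detA by (metis UNIV_I finite less_le prod_zero_iff)
  have "proots (char_polynomial A) = (\<Sum>i\<in>UNIV. {# d $ i #})"
    unfolding A char_polynomial_diagonalizable[OF Q] by (subst proots_prod) auto
  also have "\<dots> = image_mset (\<lambda>i. d $ i) (mset_set UNIV)"
    by (induction "UNIV :: 'n set" rule: infinite_finite_induct) 
       (simp_all add: sum_unfold_sum_mset)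
  finally have pr: "proots (char_polynomial A) = image_mset (\<lambda>i. d $ i) (mset_set UNIV)" .
  define L where "L = eigenvalue_list A"
  have mset: "mset L = image_mset (\<lambda>i. d $ i) (mset_set UNIV)"
    unfolding L_def eigenvalue_list_def pr by (metis mset_rev mset_sorted_list_of_multiset)
  have len: "length L = CARD('n)"
    by (metis mset size_mset size_image_mset size_mset_set)
  have "(\<Sum>i=1..CARD('n). ln (L ! (i - 1))) = (\<Sum>i<CARD('n). ln (L ! i))"
    by (rule sum.reindex_bij_witness[of _ Suc "\<lambda>i. i - 1"]) auto
  also have "\<dots> = sum_list (map ln L)"
    by (simp add: sum_list_sum_nth len atLeast0LessThan)
  also have "\<dots> = sum_mset (image_mset ln (mset L))"
    by (metis mset_map sum_mset_sum_list)
  also have "\<dots> = (\<Sum>i\<in>UNIV. ln (d $ i))"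
    unfolding mset by (simp add: sum_unfold_sum_mset image_mset.compositionality o_def)
  also have "\<dots> = ln (det A)"
    unfolding detA using dpos[THEN less_imp_neq, THEN not_sym] by (simp add: ln_prod)
  finally show ?thesis unfolding L_def .
qed

text \<open>Symmetry, positivity and the determinant pass to the limit by continuity. The
  determinant of \<open>oseledets_family V t\<close> equals \<open>exp c\<close> at every positive
  time, because the power 1 / (2 t) of \<open>exp (2 * c * t)\<close> is \<open>exp c\<close>. In
  particular the limit is invertible and none of its eigenvalues is 0.\<close>

lemma sum_lyapunov_exponents:
  fixes V :: "real \<Rightarrow> real^'n^'n"
  assumes conv: "oseledets_convergent V" and det: "\<And>t. t \<ge> 0 \<Longrightarrow> det (V t) = exp (c * t)"
  shows "(\<Sum>i=1..CARD('n). lyapunov_exponent V i) = c"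
proof -
  define \<Phi> where "\<Phi> = oseledets_limit V"
  have lim: "(oseledets_family V \<longlongrightarrow> \<Phi>) at_top"
    using conv unfolding oseledets_convergent_def \<Phi>_def oseledets_limit_def
    by (metis tendsto_Lim trivial_limit_at_top_linorder)
  have sym: "transpose (transpose (V t) ** V t) = transpose (V t) ** V t" for t
    by (simp add: matrix_transpose_mul)
  have pos: "x \<bullet> ((transpose (V t) ** V t) *v x) \<ge> 0" for t x
    by (metis dot_lmul_matrix inner_ge_zero matrix_vector_mul_assoc transpose_transpose vector_transpose_matrix)
  note props = psd_powr_properties[OF sym pos, folded oseledets_family_def]
  have "((\<lambda>t. transpose (oseledets_family V t)) \<longlongrightarrow> transpose \<Phi>) at_top"
    unfolding transpose_def by (intro tendsto_intros lim)
  then have "transpose \<Phi> = \<Phi>"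
    unfolding oseledets_family_def props(1)
    using lim[unfolded oseledets_family_def] tendsto_unique trivial_limit_at_top_linorder by blast
  moreover have "x \<bullet> (\<Phi> *v x) \<ge> 0" for x
  proof (rule tendsto_lowerbound)
    show "((\<lambda>t. x \<bullet> (oseledets_family V t *v x)) \<longlongrightarrow> x \<bullet> (\<Phi> *v x)) at_top"
      unfolding matrix_vector_mult_def by (intro tendsto_intros lim)
    show "\<forall>\<^sub>F t in at_top. 0 \<le> x \<bullet> (oseledets_family V t *v x)"
      unfolding oseledets_family_def by (simp add: props(2))
  qed simp
  moreover have "det \<Phi> = exp c"
  proof (rule tendsto_unique)
    show "((\<lambda>t. det (oseledets_family V t)) \<longlongrightarrow> det \<Phi>) at_top"
      unfolding det_def by (intro tendsto_intros lim)
    have "exp c = det (oseledets_family V t)" if "t > 0" for t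
      using that det[of t] unfolding oseledets_family_def props(3)
      by (simp add: det_mul det_transpose powr_def exp_add[symmetric] ln_mult)
    then show "((\<lambda>t. det (oseledets_family V t)) \<longlongrightarrow> exp c) at_top"
      by (intro tendsto_eventually eventually_mono[OF eventually_gt_at_top[of 0]]) simp
  qed simp
  ultimately show ?thesis
    using sum_ln_eigenvalue_list[of \<Phi>] unfolding lyapunov_exponent_def \<Phi>_def by simp
qed

section \<open>Small trapezoidal errors have small sums of squares\<close>

definition signed_sum :: "(nat \<Rightarrow> real) \<Rightarrow> nat \<Rightarrow> nat set \<Rightarrow> real" where
  "signed_sum a n S = (\<Sum>i<n. if i \<in> S then a i else - a i)"

lemma sum_Pow_lessThan_Suc:
  "(\<Sum>S\<in>Pow {..<Suc n}. f S) = (\<Sum>S\<in>Pow {..<n}. f S + f (insert n S))"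
proof -
  have "Pow {..<Suc n} = Pow {..<n} \<union> insert n ` Pow {..<n}"
    by (simp add: lessThan_Suc Pow_insert)
  moreover have "Pow {..<n} \<inter> insert n ` Pow {..<n} = {}" by auto
  moreover have "inj_on (insert n) (Pow {..<n})"
    by (auto simp: inj_on_def insert_eq_iff)
  ultimately show ?thesis
    by (simp add: sum.union_disjoint sum.reindex sum.distrib)
qed

lemma signed_sum_Suc:
  assumes "S \<in> Pow {..<n}"
  shows "signed_sum a (Suc n) S = signed_sum a n S - a n"
    and "signed_sum a (Suc n) (insert n S) = signed_sum a n S + a n"
proof -
  have "n \<notin> S" using assms by auto
  then show "signed_sum a (Suc n) S = signed_sum a n S - a n"
    by (simp add: signed_sum_def)
  show "signed_sum a (Suc n) (insert n S) = signed_sum a n S + a n"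
    unfolding signed_sum_def by (auto intro!: sum.cong)
qed

lemma signed_sum_second_moment:
  "(\<Sum>S\<in>Pow {..<n}. (signed_sum a n S)\<^sup>2) = 2 ^ n * (\<Sum>i<n. (a i)\<^sup>2)"
proof (induction n)
  case 0
  show ?case by (simp add: signed_sum_def)
next
  case (Suc n)
  have "(\<Sum>S\<in>Pow {..<Suc n}. (signed_sum a (Suc n) S)\<^sup>2)
      = (\<Sum>S\<in>Pow {..<n}. 2 * (signed_sum a n S)\<^sup>2 + 2 * (a n)\<^sup>2)"
    unfolding sum_Pow_lessThan_Suc
    by (intro sum.cong refl) (simp only: signed_sum_Suc, simp add: power2_eq_square algebra_simps)
  also have "\<dots> = 2 * (2 ^ n * (\<Sum>i<n. (a i)\<^sup>2)) + 2 ^ n * (2 * (a n)\<^sup>2)"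
    by (simp add: sum.distrib sum_distrib_left[symmetric] Suc.IH card_Pow)
  finally show ?case by (simp add: algebra_simps)
qed

text \<open>Summing over the last sign, (X - a)^4 + (X + a)^4 = 2 X^4 + 12 a^2 X^2 + 2 a^4, and the
  middle term is known from the second moment.\<close>

lemma signed_sum_fourth_moment:
  "(\<Sum>S\<in>Pow {..<n}. (signed_sum a n S) ^ 4) \<le> 2 ^ n * (3 * (\<Sum>i<n. (a i)\<^sup>2)\<^sup>2)"
proof (induction n)
  case 0
  show ?case by (simp add: signed_sum_def)
next
  case (Suc n)
  define Q where "Q = (\<Sum>i<n. (a i)\<^sup>2)"
  have "(\<Sum>S\<in>Pow {..<Suc n}. (signed_sum a (Suc n) S) ^ 4)
      = (\<Sum>S\<in>Pow {..<n}. 2 * (signed_sum a n S) ^ 4 + 12 * (a n)\<^sup>2 * (signed_sum a n S)\<^sup>2 + 2 * (a n) ^ 4)"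
    unfolding sum_Pow_lessThan_Suc
    by (intro sum.cong refl)
      (simp only: signed_sum_Suc, simp add: power2_eq_square power4_eq_xxxx algebra_simps)
  also have "\<dots> = 2 * (\<Sum>S\<in>Pow {..<n}. (signed_sum a n S) ^ 4)
      + 12 * (a n)\<^sup>2 * (2 ^ n * Q) + 2 ^ n * (2 * (a n) ^ 4)"
    by (simp add: sum.distrib sum_distrib_left[symmetric] signed_sum_second_moment Q_def card_Pow)
  \<comment> \<open>The coefficient 2 of the fourth power is raised to 6 so that the three terms
    form the square 6 (Q + a^2)^2.\<close>
  also have "\<dots> \<le> 2 * (2 ^ n * (3 * Q\<^sup>2)) + 12 * (a n)\<^sup>2 * (2 ^ n * Q) + 2 ^ n * (6 * (a n) ^ 4)"
    using Suc.IH unfolding Q_def by (intro add_mono mult_left_mono) auto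
  also have "\<dots> = 2 ^ Suc n * (3 * (Q + (a n)\<^sup>2)\<^sup>2)"
    by (simp add: power2_eq_square power4_eq_xxxx algebra_simps)
  finally show ?case by (simp add: Q_def)
qed

text \<open>An inequality of Paley-Zygmund type, for uniformly random signs. The function X^2 - X^4
  / (6 Q) has mean at least Q - Q / 2 = Q / 2. It never exceeds 3 Q / 2, and it is at most Q / 4
  where X^2 \<le> Q / 4. If p is the proportion of patterns with X^2 > Q / 4, then Q / 2 \<le> Q / 4
  + p (5 Q / 4), so p \<ge> 1 / 5.\<close>

lemma card_large_signed_sums:
  assumes "(\<Sum>i<n. (a i)\<^sup>2) > 0"
  shows "2 ^ n \<le> 5 * card {S \<in> Pow {..<n}. (signed_sum a n S)\<^sup>2 > (\<Sum>i<n. (a i)\<^sup>2) / 4}"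
proof -
  define Q where "Q = (\<Sum>i<n. (a i)\<^sup>2)"
  define X where "X = signed_sum a n"
  define N where "N = card {S \<in> Pow {..<n}. (X S)\<^sup>2 > Q / 4}"
  have Q: "Q > 0" using assms by (simp add: Q_def)
  have le: "(X S)\<^sup>2 - (X S) ^ 4 / (6 * Q) \<le> Q / 4 + (if (X S)\<^sup>2 > Q / 4 then 5 / 4 * Q else 0)" for S
  proof -
    have "(X S)\<^sup>2 - (X S) ^ 4 / (6 * Q) = 3 / 2 * Q - ((X S)\<^sup>2 - 3 * Q)\<^sup>2 / (6 * Q)"
      using Q by (simp add: field_simps power2_eq_square power4_eq_xxxx)
    also have "\<dots> \<le> 3 / 2 * Q" using Q by simp
    moreover have "(X S) ^ 4 / (6 * Q) \<ge> 0" using Q by simp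
    ultimately show ?thesis by (auto simp: not_less)
  qed
  have "2 ^ n * Q - 2 ^ n * (3 * Q\<^sup>2) / (6 * Q)
      \<le> (\<Sum>S\<in>Pow {..<n}. (X S)\<^sup>2) - (\<Sum>S\<in>Pow {..<n}. (X S) ^ 4) / (6 * Q)"
    using signed_sum_second_moment[of a n] signed_sum_fourth_moment[of a n] Q
    unfolding X_def Q_def[symmetric] by (intro diff_mono divide_right_mono) auto
  also have "\<dots> = (\<Sum>S\<in>Pow {..<n}. (X S)\<^sup>2 - (X S) ^ 4 / (6 * Q))"
    by (simp add: sum_subtractf sum_divide_distrib)
  also have "\<dots> \<le> (\<Sum>S\<in>Pow {..<n}. Q / 4 + (if (X S)\<^sup>2 > Q / 4 then 5 / 4 * Q else 0))"
    by (intro sum_mono le)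
  also have "\<dots> = 2 ^ n * (Q / 4) + N * (5 / 4 * Q)"
    by (simp add: sum.distrib card_Pow N_def flip: sum.inter_filter)
  finally have "Q * 2 ^ n \<le> Q * (5 * N)"
    using Q by (simp add: field_simps power2_eq_square)
  then have "(2::real) ^ n \<le> 5 * N" using Q by simp
  then have "real (2 ^ n) \<le> real (5 * N)" by simp
  then show ?thesis unfolding N_def X_def Q_def by (simp only: of_nat_le_iff)
qed

section \<open>Statements that hold off an event of small probability\<close>

context prob_space
begin

text \<open>
  The exceptional event is part of the definition so that \<open>Q\<close> need not be measurable.
\<close>

definition likely :: "real \<Rightarrow> ('a \<Rightarrow> bool) \<Rightarrow> bool" where
  "likely \<epsilon> Q \<longleftrightarrow> (\<exists>E\<in>events. prob E \<le> \<epsilon> \<and> (AE \<omega> in M. \<omega> \<notin> E \<longrightarrow> Q \<omega>))"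

lemma likely_mono_AE:
  assumes "likely \<epsilon> Q" "\<epsilon> \<le> \<epsilon>'" "AE \<omega> in M. Q \<omega> \<longrightarrow> R \<omega>"
  shows "likely \<epsilon>' R"
proof -
  obtain E where E: "E \<in> events" "prob E \<le> \<epsilon>" "AE \<omega> in M. \<omega> \<notin> E \<longrightarrow> Q \<omega>"
    using assms(1) unfolding likely_def by blast
  have "AE \<omega> in M. \<omega> \<notin> E \<longrightarrow> R \<omega>" using E(3) assms(3) by eventually_elim auto
  then show ?thesis unfolding likely_def using E(1,2) assms(2) by (intro bexI[of _ E]) auto
qed

lemma likely_mono: "likely \<epsilon> Q \<Longrightarrow> \<epsilon> \<le> \<epsilon>' \<Longrightarrow> (\<And>\<omega>. Q \<omega> \<Longrightarrow> R \<omega>) \<Longrightarrow> likely \<epsilon>' R"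
  by (rule likely_mono_AE) auto

lemma likely_ball:
  assumes "finite I" "\<And>i. i \<in> I \<Longrightarrow> likely (e i) (Q i)"
  shows "likely (\<Sum>i\<in>I. e i) (\<lambda>\<omega>. \<forall>i\<in>I. Q i \<omega>)"
proof -
  have "\<forall>i\<in>I. \<exists>E. E \<in> events \<and> prob E \<le> e i \<and> (AE \<omega> in M. \<omega> \<notin> E \<longrightarrow> Q i \<omega>)"
    using assms(2) unfolding likely_def by blast
  then obtain E where E: "\<And>i. i \<in> I \<Longrightarrow> E i \<in> events" "\<And>i. i \<in> I \<Longrightarrow> prob (E i) \<le> e i"
    "\<And>i. i \<in> I \<Longrightarrow> AE \<omega> in M. \<omega> \<notin> E i \<longrightarrow> Q i \<omega>"
    by metis
  have "prob (\<Union>i\<in>I. E i) \<le> (\<Sum>i\<in>I. prob (E i))"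
    using assms(1) E(1) by (intro finite_measure_subadditive_finite) auto
  also have "\<dots> \<le> (\<Sum>i\<in>I. e i)" using E(2) by (rule sum_mono)
  finally have "prob (\<Union>i\<in>I. E i) \<le> (\<Sum>i\<in>I. e i)" .
  moreover have "AE \<omega> in M. \<forall>i\<in>I. \<omega> \<notin> E i \<longrightarrow> Q i \<omega>"
    using assms(1) E(3) by (intro AE_finite_allI)
  then have "AE \<omega> in M. \<omega> \<notin> (\<Union>i\<in>I. E i) \<longrightarrow> (\<forall>i\<in>I. Q i \<omega>)"
    by eventually_elim auto
  moreover have "(\<Union>i\<in>I. E i) \<in> events"
    using assms(1) E(1) by (intro sets.finite_UN) auto
  ultimately show ?thesis unfolding likely_def by blast
qed

lemma likely_conj:
  assumes "likely \<epsilon> Q" "likely \<delta> R"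
  shows "likely (\<epsilon> + \<delta>) (\<lambda>\<omega>. Q \<omega> \<and> R \<omega>)"
proof -
  have "likely (if b then \<epsilon> else \<delta>) (if b then Q else R)" for b
    using assms by simp
  then have "likely (\<Sum>b\<in>UNIV. if b then \<epsilon> else \<delta>) (\<lambda>\<omega>. \<forall>b\<in>UNIV. (if b then Q else R) \<omega>)"
    by (intro likely_ball) auto
  then show ?thesis by (rule likely_mono) (auto simp: UNIV_bool)
qed

text \<open>Continuity from below: a constant that exists almost surely but depends on the path
  becomes one constant for all paths outside an event of probability at most \<epsilon>.\<close>

lemma likely_increasing:
  assumes "\<And>m::nat. {\<omega> \<in> space M. Q m \<omega>} \<in> events" "\<And>m n \<omega>. m \<le> n \<Longrightarrow> Q m \<omega> \<Longrightarrow> Q n \<omega>"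
    and "AE \<omega> in M. \<exists>m. Q m \<omega>" and "\<epsilon> > 0"
  shows "\<exists>m. likely \<epsilon> (Q m)"
proof -
  define G where "G m = {\<omega> \<in> space M. Q m \<omega>}" for m
  have "range G \<subseteq> events" "incseq G"
    using assms(1,2) unfolding G_def incseq_def by auto
  then have "(\<lambda>m. prob (G m)) \<longlonglongrightarrow> prob (\<Union>m. G m)"
    by (rule finite_Lim_measure_incseq)
  moreover have "prob (\<Union>m. G m) = 1"
  proof -
    have "(\<Union>m. G m) = {\<omega> \<in> space M. \<exists>m. Q m \<omega>}" unfolding G_def by auto
    moreover have "{\<omega> \<in> space M. \<exists>m. Q m \<omega>} \<in> events"
      using \<open>range G \<subseteq> events\<close> calculation by (metis sets.countable_UN)
    ultimately show ?thesis
      using assms(3) by (simp add: prob_Collect_eq_1)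
  qed
  ultimately have "\<forall>\<^sub>F m in sequentially. prob (G m) > 1 - \<epsilon>"
    using assms(4) by (intro order_tendstoD) auto
  then obtain m where "prob (G m) > 1 - \<epsilon>" by (meson eventually_happens' sequentially_bot)
  then have "prob (space M - G m) \<le> \<epsilon>"
    using \<open>range G \<subseteq> events\<close> by (subst prob_compl) auto
  moreover have "AE \<omega> in M. \<omega> \<notin> space M - G m \<longrightarrow> Q m \<omega>"
    by (rule AE_I2) (auto simp: G_def)
  moreover have "space M - G m \<in> events" using \<open>range G \<subseteq> events\<close> by auto
  ultimately show ?thesis unfolding likely_def by blast
qed

text \<open>A signed sum is a difference of two subset sums, so each sign pattern has an exceptional
  event of probability at most 2 \<epsilon> off which its signed sum is at most 2 \<eta>. If the sum
  of squares exceeds 16 \<eta>^2, a fifth of all patterns have a squared signed sum above 4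
  \<eta>^2, so the path lies in a fifth of these exceptional events. By Markov's inequality this has
  probability at most 5 * 2 \<epsilon>. The 2^n events are counted, not united, so the bound does
  not depend on n.\<close>

lemma likely_sum_squares:
  fixes X :: "nat \<Rightarrow> 'a \<Rightarrow> real"
  assumes sub: "\<And>S. S \<subseteq> {..<n} \<Longrightarrow> likely \<epsilon> (\<lambda>\<omega>. \<bar>\<Sum>i\<in>S. X i \<omega>\<bar> \<le> \<eta>)"
  shows "likely (10 * \<epsilon>) (\<lambda>\<omega>. (\<Sum>i<n. (X i \<omega>)\<^sup>2) \<le> 16 * \<eta>\<^sup>2)"
proof -
  let ?P = "Pow {..<n}"
  have "likely (2 * \<epsilon>) (\<lambda>\<omega>. \<bar>signed_sum (\<lambda>i. X i \<omega>) n S\<bar> \<le> 2 * \<eta>)" if "S \<in> ?P" for S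
  proof -
    have split: "signed_sum (\<lambda>i. X i \<omega>) n S = (\<Sum>i\<in>S. X i \<omega>) - (\<Sum>i\<in>{..<n} - S. X i \<omega>)" for \<omega>
    proof -
      have "{i. i < n \<and> i \<in> S} = S" "{i. i < n \<and> i \<notin> S} = {..<n} - S" using that by auto
      then show ?thesis unfolding signed_sum_def
        by (simp add: sum.If_cases sum_negf Int_def Collect_conj_eq[symmetric] lessThan_def)
    qed
    have "likely (\<epsilon> + \<epsilon>) (\<lambda>\<omega>. \<bar>\<Sum>i\<in>S. X i \<omega>\<bar> \<le> \<eta> \<and> \<bar>\<Sum>i\<in>{..<n} - S. X i \<omega>\<bar> \<le> \<eta>)"
      using that by (intro likely_conj sub) auto
    then show ?thesis
      by (rule likely_mono) (auto simp: split)
  qed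
  then have "\<forall>S\<in>?P. \<exists>E. E \<in> events \<and> prob E \<le> 2 * \<epsilon> \<and>
      (AE \<omega> in M. \<omega> \<notin> E \<longrightarrow> \<bar>signed_sum (\<lambda>i. X i \<omega>) n S\<bar> \<le> 2 * \<eta>)"
    unfolding likely_def by blast
  from bchoice[OF this] obtain E where E[measurable]: "\<And>S. S \<in> ?P \<Longrightarrow> E S \<in> events"
    and pE: "\<And>S. S \<in> ?P \<Longrightarrow> prob (E S) \<le> 2 * \<epsilon>"
    and small: "\<And>S. S \<in> ?P \<Longrightarrow> AE \<omega> in M. \<omega> \<notin> E S \<longrightarrow> \<bar>signed_sum (\<lambda>i. X i \<omega>) n S\<bar> \<le> 2 * \<eta>"
    by blast
  \<comment> \<open>The number of sign patterns whose exceptional event contains \<omega>.\<close>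
  define f where "f \<omega> = (\<Sum>S\<in>?P. indicat_real (E S) \<omega>)" for \<omega>
  define B where "B = {\<omega> \<in> space M. f \<omega> \<ge> 2 ^ n / 5}"
  have fint: "integrable M f"
    unfolding f_def by (intro Bochner_Integration.integrable_sum) (auto simp: integrable_indicator_iff less_top[symmetric])
  have "expectation f = (\<Sum>S\<in>?P. prob (E S))"
    unfolding f_def by (subst Bochner_Integration.integral_sum)
      (auto simp: integrable_indicator_iff less_top[symmetric])
  also have "\<dots> \<le> (\<Sum>S\<in>?P. 2 * \<epsilon>)" by (intro sum_mono pE)
  also have "\<dots> = 2 ^ n * (2 * \<epsilon>)" by (simp add: card_Pow)
  finally have ef: "expectation f \<le> 2 ^ n * (2 * \<epsilon>)" .
  have "prob B \<le> expectation f / (2 ^ n / 5)"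
    unfolding B_def
    by (rule integral_Markov_inequality_measure[OF fint, where A = "{}"]) (auto simp: f_def intro!: sum_nonneg)
  also have "\<dots> \<le> 2 ^ n * (2 * \<epsilon>) / (2 ^ n / 5)"
    using ef by (intro divide_right_mono) auto
  finally have pB: "prob B \<le> 10 * \<epsilon>" by (simp add: field_simps)
  have Bev: "B \<in> events"
    using borel_measurable_integrable[OF fint] unfolding B_def by measurable
  have "AE \<omega> in M. \<forall>S\<in>?P. \<omega> \<notin> E S \<longrightarrow> \<bar>signed_sum (\<lambda>i. X i \<omega>) n S\<bar> \<le> 2 * \<eta>"
    using small by (intro AE_finite_allI) auto
  then have "AE \<omega> in M. \<omega> \<notin> B \<longrightarrow> (\<Sum>i<n. (X i \<omega>)\<^sup>2) \<le> 16 * \<eta>\<^sup>2"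
    using AE_space
  proof eventually_elim
    case (elim \<omega>)
    show ?case
    proof (intro impI, rule ccontr)
      assume "\<omega> \<notin> B" and "\<not> (\<Sum>i<n. (X i \<omega>)\<^sup>2) \<le> 16 * \<eta>\<^sup>2"
      then have big: "(\<Sum>i<n. (X i \<omega>)\<^sup>2) > 16 * \<eta>\<^sup>2" by simp
      define L where "L = {S \<in> ?P. (signed_sum (\<lambda>i. X i \<omega>) n S)\<^sup>2 > (\<Sum>i<n. (X i \<omega>)\<^sup>2) / 4}"
      have "\<omega> \<in> E S" if "S \<in> L" for S
      proof (rule ccontr)
        assume "\<omega> \<notin> E S"
        then have "\<bar>signed_sum (\<lambda>i. X i \<omega>) n S\<bar> \<le> 2 * \<eta>" using elim that by (auto simp: L_def)
        then have "(signed_sum (\<lambda>i. X i \<omega>) n S)\<^sup>2 \<le> (2 * \<eta>)\<^sup>2" using power_mono[of "\<bar>signed_sum (\<lambda>i. X i \<omega>) n S\<bar>" "2 * \<eta>" 2] by simp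
        then show False using that big by (auto simp: L_def power2_eq_square)
      qed
      then have "real (card L) = (\<Sum>S\<in>L. indicat_real (E S) \<omega>)" by simp
      also have "\<dots> \<le> f \<omega>" unfolding f_def by (intro sum_mono2) (auto simp: L_def)
      finally have "real (card L) \<le> f \<omega>" .
      moreover have "0 \<le> 16 * \<eta>\<^sup>2" by simp
      then have "(\<Sum>i<n. (X i \<omega>)\<^sup>2) > 0" using big by linarith
      from card_large_signed_sums[OF this] have "2 ^ n \<le> 5 * card L" unfolding L_def .
      then have "real (2 ^ n) \<le> real (5 * card L)" by (simp only: of_nat_le_iff)
      ultimately have "f \<omega> \<ge> 2 ^ n / 5" by simp
      then show False using \<open>\<omega> \<notin> B\<close> elim by (simp add: B_def)
    qed
  qed
  then show ?thesis unfolding likely_def using pB Bev by blast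
qed

text \<open>Convergence to 0 in probability of the partition sums as the mesh shrinks, with one
  \<epsilon> for both the size and the exceptional probability. Partitions may repeat points, which
  later makes it possible to skip from one end of a cell to the other.\<close>

definition null_germ :: "(real \<Rightarrow> real \<Rightarrow> 'a \<Rightarrow> 'e::real_normed_vector) \<Rightarrow> bool" where
  "null_germ \<Xi> \<longleftrightarrow> (\<forall>t\<ge>0. \<forall>\<epsilon>>0. \<exists>\<delta>>0. \<forall>n p. is_partition t n p \<and> (\<forall>i<n. p (Suc i) - p i < \<delta>) \<longrightarrow>
     likely \<epsilon> (\<lambda>\<omega>. norm (\<Sum>i<n. \<Xi> (p i) (p (Suc i)) \<omega>) \<le> \<epsilon>))"

lemma null_germD:
  assumes "null_germ \<Xi>" "0 \<le> t" "\<epsilon> > 0"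
  obtains \<delta> where "\<delta> > 0"
    "\<And>n p. is_partition t n p \<Longrightarrow> (\<forall>i<n. p (Suc i) - p i < \<delta>) \<Longrightarrow>
      likely \<epsilon> (\<lambda>\<omega>. norm (\<Sum>i<n. \<Xi> (p i) (p (Suc i)) \<omega>) \<le> \<epsilon>)"
proof -
  from assms(1)[unfolded null_germ_def, THEN spec, THEN mp, OF assms(2), THEN spec, THEN mp, OF assms(3)]
  show ?thesis using that by auto
qed

end

section \<open>Uniform grids and sums over selected cells\<close>

definition grid :: "real \<Rightarrow> real \<Rightarrow> nat \<Rightarrow> nat \<Rightarrow> real" where
  "grid s t n k = s + (t - s) * real k / real n"

lemma grid_0 [simp]: "grid s t n 0 = s"
  by (simp add: grid_def)

lemma grid_n [simp]: "n > 0 \<Longrightarrow> grid s t n n = t"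
  by (simp add: grid_def)

lemma grid_Suc: "grid s t n (Suc k) = grid s t n k + (t - s) / n"
  by (simp add: grid_def add_divide_distrib distrib_left)

lemma grid_mono: "s \<le> t \<Longrightarrow> i \<le> j \<Longrightarrow> grid s t n i \<le> grid s t n j"
  by (auto simp: grid_def intro!: divide_right_mono mult_left_mono)

lemma grid_le: "s \<le> t \<Longrightarrow> i \<le> n \<Longrightarrow> grid s t n i \<le> t"
  by (cases "n = 0") (use grid_mono[of s t i n n] in auto)

lemma grid_ge: "s \<le> t \<Longrightarrow> s \<le> grid s t n i"
  using grid_mono[of s t 0 i n] by simp

lemma sum_lessThan_add: "(\<Sum>k<a + m. g k) = (\<Sum>k<a. g k) + (\<Sum>j<m. g (a + j :: nat))"
  by (induction m) (auto simp: add.assoc)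

lemma sum_lessThan_mult: "(\<Sum>k<n * m. g k) = (\<Sum>i<n. \<Sum>j<m. g (i * m + j :: nat))"
  by (induction n) (auto simp: sum_lessThan_add add.commute[of m])

context prob_space
begin

text \<open>The definition only controls partitions that start at 0. A sum over [s, t] is the sum
  over a partition of [0, t] passing through s, minus the sum over its part in [0, s].\<close>

lemma null_germ_grid:
  assumes \<Xi>: "null_germ \<Xi>" and "0 \<le> s" "s \<le> t" "\<epsilon> > 0"
  shows "\<forall>\<^sub>F m in sequentially.
    likely \<epsilon> (\<lambda>\<omega>. norm (\<Sum>j<m. \<Xi> (grid s t m j) (grid s t m (Suc j)) \<omega>) \<le> \<epsilon>)"
proof -
  have e2: "\<epsilon> / 2 > 0" and t: "0 \<le> t" using assms by auto
  obtain \<delta>1 where \<delta>1: "\<delta>1 > 0" "\<And>n p. is_partition t n p \<Longrightarrow> (\<forall>i<n. p (Suc i) - p i < \<delta>1) \<Longrightarrow>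
     likely (\<epsilon> / 2) (\<lambda>\<omega>. norm (\<Sum>i<n. \<Xi> (p i) (p (Suc i)) \<omega>) \<le> \<epsilon> / 2)"
    by (rule null_germD[OF \<Xi> t e2]) blast
  obtain \<delta>2 where \<delta>2: "\<delta>2 > 0" "\<And>n p. is_partition s n p \<Longrightarrow> (\<forall>i<n. p (Suc i) - p i < \<delta>2) \<Longrightarrow>
     likely (\<epsilon> / 2) (\<lambda>\<omega>. norm (\<Sum>i<n. \<Xi> (p i) (p (Suc i)) \<omega>) \<le> \<epsilon> / 2)"
    by (rule null_germD[OF \<Xi> assms(2) e2]) blast
  have "(\<lambda>m. t / real m) \<longlonglongrightarrow> 0" by (rule lim_const_over_n)
  then have "\<forall>\<^sub>F m in sequentially. t / real m < min \<delta>1 \<delta>2"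
    using \<delta>1(1) \<delta>2(1) by (intro order_tendstoD) auto
  with eventually_gt_at_top[of 0] show ?thesis
  proof eventually_elim
    case (elim m)
    \<comment> \<open>The first m cells cover [0, s] and the last m cells cover [s, t].\<close>
    define p where "p k = (if k \<le> m then grid 0 s m k else grid s t m (k - m))" for k
    have mesh: "s / m < \<delta>1" "(t - s) / m < \<delta>1" "s / m < \<delta>2"
      using elim assms(2,3) divide_right_mono[of s t "real m"] divide_right_mono[of "t - s" t "real m"]
      by auto
    have p1: "p k = grid 0 s m k" if "k \<le> m" for k using that by (simp add: p_def)
    have p2: "p (m + j) = grid s t m j" for j using elim by (cases "j = 0") (auto simp: p_def)
    have step: "p k \<le> p (Suc k) \<and> p (Suc k) - p k < \<delta>1" if "k < m + m" for k
    proof (cases "k < m")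
      case True
      then show ?thesis using mesh assms by (simp add: p1 grid_Suc)
    next
      case False
      then obtain j where "k = m + j" by (metis le_iff_add not_less)
      then show ?thesis using mesh assms p2[of j] p2[of "Suc j"] by (simp add: grid_Suc)
    qed
    then have "is_partition t (m + m) p"
      using elim p1[of 0] p2[of m] by (auto simp: is_partition_def)
    then have "likely (\<epsilon> / 2) (\<lambda>\<omega>. norm (\<Sum>i<m + m. \<Xi> (p i) (p (Suc i)) \<omega>) \<le> \<epsilon> / 2)"
      using step by (intro \<delta>1(2)) auto
    moreover have "is_partition s m (grid 0 s m)"
      using elim assms by (auto simp: is_partition_def grid_Suc)
    then have "likely (\<epsilon> / 2) (\<lambda>\<omega>. norm (\<Sum>i<m. \<Xi> (grid 0 s m i) (grid 0 s m (Suc i)) \<omega>) \<le> \<epsilon> / 2)"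
      using mesh by (intro \<delta>2(2)) (auto simp: grid_Suc)
    ultimately have "likely (\<epsilon> / 2 + \<epsilon> / 2) (\<lambda>\<omega>. norm (\<Sum>i<m + m. \<Xi> (p i) (p (Suc i)) \<omega>) \<le> \<epsilon> / 2 \<and>
        norm (\<Sum>i<m. \<Xi> (grid 0 s m i) (grid 0 s m (Suc i)) \<omega>) \<le> \<epsilon> / 2)"
      by (rule likely_conj)
    then show ?case
    proof (rule likely_mono)
      fix \<omega>
      define a where "a = (\<Sum>i<m. \<Xi> (grid 0 s m i) (grid 0 s m (Suc i)) \<omega>)"
      define b where "b = (\<Sum>j<m. \<Xi> (grid s t m j) (grid s t m (Suc j)) \<omega>)"
      have "(\<Sum>i<m + m. \<Xi> (p i) (p (Suc i)) \<omega>) = a + b"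
        unfolding sum_lessThan_add a_def b_def
        using p2 p2[of "Suc _"] by (intro arg_cong2[where f = "(+)"] sum.cong refl) (auto simp: p1)
      then show "norm b \<le> \<epsilon>" if "norm (\<Sum>i<m + m. \<Xi> (p i) (p (Suc i)) \<omega>) \<le> \<epsilon> / 2 \<and> norm a \<le> \<epsilon> / 2"
        using that norm_triangle_ineq4[of "a + b" a] by simp
    qed simp
  qed
qed

text \<open>
  Outside \<open>S\<close> the intervals are refined until their contribution is negligible; inside \<open>S\<close> the
  refinement consists of repeated points, which do not contribute.
\<close>

lemma null_germ_subset_sums:
  assumes \<Xi>: "null_germ \<Xi>" and diag: "\<And>s \<omega>. \<Xi> s s \<omega> = 0" and "0 \<le> t" "\<epsilon> > 0"
  shows "\<forall>\<^sub>F n in sequentially. \<forall>S\<subseteq>{..<n}.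
    likely \<epsilon> (\<lambda>\<omega>. norm (\<Sum>i\<in>S. \<Xi> (grid 0 t n i) (grid 0 t n (Suc i)) \<omega>) \<le> \<epsilon>)"
proof -
  have e2: "\<epsilon> / 2 > 0" using assms by auto
  obtain \<delta> where \<delta>: "\<delta> > 0" "\<And>n p. is_partition t n p \<Longrightarrow> (\<forall>i<n. p (Suc i) - p i < \<delta>) \<Longrightarrow>
     likely (\<epsilon> / 2) (\<lambda>\<omega>. norm (\<Sum>i<n. \<Xi> (p i) (p (Suc i)) \<omega>) \<le> \<epsilon> / 2)"
    by (rule null_germD[OF \<Xi> assms(3) e2]) blast
  have "(\<lambda>m. t / real m) \<longlonglongrightarrow> 0" by (rule lim_const_over_n)
  then have "\<forall>\<^sub>F n in sequentially. t / real n < \<delta>"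
    using \<delta>(1) by (intro order_tendstoD) auto
  with eventually_gt_at_top[of 0] show ?thesis
  proof eventually_elim
    case (elim n)
    define T where "T = grid 0 t n"
    have T0: "T i \<ge> 0" and TS: "T i \<le> T (Suc i)" "T (Suc i) - T i = t / n" for i
      using assms(3) by (auto simp: T_def grid_Suc grid_ge)
    \<comment> \<open>The refinements of at most n cells may together cost \<epsilon> / 2, both in
      size and in probability.\<close>
    define e where "e = \<epsilon> / (2 * n)"
    have e: "e > 0" using assms(4) elim by (simp add: e_def)
    let ?R = "\<lambda>m i \<omega>. \<Sum>j<m. \<Xi> (grid (T i) (T (Suc i)) m j) (grid (T i) (T (Suc i)) m (Suc j)) \<omega>"
    show ?case
    proof (intro allI impI)
      fix S assume S: "S \<subseteq> {..<n}"
      have "\<forall>\<^sub>F m in sequentially. m > 0 \<and> (\<forall>i\<in>{..<n}. likely e (\<lambda>\<omega>. norm (?R m i \<omega>) \<le> e))"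
        using null_germ_grid[OF \<Xi> T0 TS(1) e]
        by (intro eventually_conj eventually_gt_at_top eventually_ball_finite) auto
      from eventually_happens'[OF sequentially_bot this]
      obtain m where m: "m > 0" "\<And>i. i < n \<Longrightarrow> likely e (\<lambda>\<omega>. norm (?R m i \<omega>) \<le> e)"
        by auto
      \<comment> \<open>Point j of cell i. For i in \<open>S\<close> the partition jumps to the
        right end at its first step and stays there, so by \<open>diag\<close> only the unrefined
        term survives.\<close>
      define B where "B i j = (if i \<in> S then (if j = 0 then T i else T (Suc i))
          else grid (T i) (T (Suc i)) m j)" for i j
      \<comment> \<open>Concatenation of the blocks. Since \<open>B i m\<close> and
        \<open>B (Suc i) 0\<close> are the same point, the formula for \<open>p\<close> below also
        holds at j = m.\<close>
      define p where "p k = B (k div m) (k mod m)" for k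
      have p: "p (i * m + j) = B i j" if "j \<le> m" for i j
      proof (cases "j = m")
        case True
        have "p (Suc i * m) = T (Suc i)" using m(1) by (simp add: p_def B_def)
        with True m(1) show ?thesis by (simp add: B_def add.commute)
      next
        case False
        with that have "j < m" by simp
        then show ?thesis by (simp add: p_def)
      qed
      have step: "p k \<le> p (Suc k) \<and> p (Suc k) - p k < \<delta>" for k
      proof -
        define i j where "i = k div m" and "j = k mod m"
        have k: "k = i * m + j" and j: "j < m" using m(1) by (auto simp: i_def j_def)
        have "p k = B i j" "p (Suc k) = B i (Suc j)"
          unfolding k using p[of j i] p[of "Suc j" i] j by auto
        moreover have "t / n / m \<le> t / n"
          using m(1) assms(3) divide_left_mono[of 1 "real m" "t / n"] by simp
        ultimately show ?thesis
          using TS[of i] elim assms(3) \<delta>(1) by (auto simp: B_def grid_Suc)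
      qed
      have "p 0 = 0" using p[of 0 0] by (simp add: B_def T_def)
      moreover have "p (n * m) = t" using p[of 0 n] S elim by (auto simp: B_def T_def)
      ultimately have "is_partition t (n * m) p"
        using step by (simp add: is_partition_def)
      then have "likely (\<epsilon> / 2) (\<lambda>\<omega>. norm (\<Sum>k<n * m. \<Xi> (p k) (p (Suc k)) \<omega>) \<le> \<epsilon> / 2)"
        using step by (intro \<delta>(2)) auto
      moreover have "likely (\<Sum>i\<in>{..<n}. e) (\<lambda>\<omega>. \<forall>i\<in>{..<n}. norm (?R m i \<omega>) \<le> e)"
        using m(2) by (intro likely_ball) auto
      ultimately have "likely (\<epsilon> / 2 + (\<Sum>i\<in>{..<n}. e)) (\<lambda>\<omega>.
          norm (\<Sum>k<n * m. \<Xi> (p k) (p (Suc k)) \<omega>) \<le> \<epsilon> / 2 \<and> (\<forall>i\<in>{..<n}. norm (?R m i \<omega>) \<le> e))"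
        by (rule likely_conj)
      then show "likely \<epsilon> (\<lambda>\<omega>. norm (\<Sum>i\<in>S. \<Xi> (grid 0 t n i) (grid 0 t n (Suc i)) \<omega>) \<le> \<epsilon>)"
      proof (rule likely_mono)
        show "\<epsilon> / 2 + (\<Sum>i\<in>{..<n}. e) \<le> \<epsilon>" using elim by (simp add: e_def)
      next
        fix \<omega>
        assume small: "norm (\<Sum>k<n * m. \<Xi> (p k) (p (Suc k)) \<omega>) \<le> \<epsilon> / 2 \<and>
          (\<forall>i\<in>{..<n}. norm (?R m i \<omega>) \<le> e)"
        have "(\<Sum>j<m. \<Xi> (p (i * m + j)) (p (Suc (i * m + j))) \<omega>)
            = (if i \<in> S then \<Xi> (T i) (T (Suc i)) \<omega> else ?R m i \<omega>)" for i
        proof -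
          have "(\<Sum>j<m. \<Xi> (p (i * m + j)) (p (Suc (i * m + j))) \<omega>) = (\<Sum>j<m. \<Xi> (B i j) (B i (Suc j)) \<omega>)"
            using p[of _ i] p[of "Suc _" i] by (intro sum.cong) auto
          also have "\<dots> = (if i \<in> S then \<Xi> (T i) (T (Suc i)) \<omega> else ?R m i \<omega>)"
          proof (cases "i \<in> S")
            case True
            then have "(\<Sum>j<m. \<Xi> (B i j) (B i (Suc j)) \<omega>)
                = (\<Sum>j<m. if j = 0 then \<Xi> (T i) (T (Suc i)) \<omega> else 0)"
              by (intro sum.cong) (auto simp: B_def diag)
            with True m(1) show ?thesis by simp
          qed (simp add: B_def)
          finally show ?thesis .
        qed
        then have "(\<Sum>k<n * m. \<Xi> (p k) (p (Suc k)) \<omega>)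
            = (\<Sum>i<n. if i \<in> S then \<Xi> (T i) (T (Suc i)) \<omega> else ?R m i \<omega>)"
          by (simp add: sum_lessThan_mult)
        also have "\<dots> = (\<Sum>i\<in>S. \<Xi> (T i) (T (Suc i)) \<omega>) + (\<Sum>i\<in>{..<n} - S. ?R m i \<omega>)"
        proof -
          have "{..<n} \<inter> {i. i \<in> S} = S" "{..<n} \<inter> - {i. i \<in> S} = {..<n} - S" using S by auto
          then show ?thesis by (simp add: sum.If_cases)
        qed
        finally have eq: "(\<Sum>i\<in>S. \<Xi> (T i) (T (Suc i)) \<omega>)
            = (\<Sum>k<n * m. \<Xi> (p k) (p (Suc k)) \<omega>) - (\<Sum>i\<in>{..<n} - S. ?R m i \<omega>)"
          by simp
        have "norm (\<Sum>i\<in>{..<n} - S. ?R m i \<omega>) \<le> (\<Sum>i\<in>{..<n} - S. e)"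
          using small by (intro sum_norm_le) auto
        also have "\<dots> \<le> (\<Sum>i\<in>{..<n}. e)" using e by (intro sum_mono2) auto
        also have "\<dots> = \<epsilon> / 2" using elim by (simp add: e_def)
        finally show "norm (\<Sum>i\<in>S. \<Xi> (grid 0 t n i) (grid 0 t n (Suc i)) \<omega>) \<le> \<epsilon>"
          using small norm_triangle_ineq4[of "\<Sum>k<n * m. \<Xi> (p k) (p (Suc k)) \<omega>" "\<Sum>i\<in>{..<n} - S. ?R m i \<omega>"]
          unfolding eq[unfolded T_def, folded T_def] T_def[symmetric] by linarith
      qed
    qed
  qed
qed

lemma null_germ_sum_squares:
  fixes \<Xi> :: "real \<Rightarrow> real \<Rightarrow> 'a \<Rightarrow> complex"
  assumes \<Xi>: "null_germ \<Xi>" and diag: "\<And>s \<omega>. \<Xi> s s \<omega> = 0" and "0 \<le> t" "\<epsilon> > 0"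
  shows "\<forall>\<^sub>F n in sequentially.
    likely \<epsilon> (\<lambda>\<omega>. (\<Sum>i<n. (norm (\<Xi> (grid 0 t n i) (grid 0 t n (Suc i)) \<omega>))\<^sup>2) \<le> \<epsilon>)"
proof -
  \<comment> \<open>Real and imaginary part each contribute 16 \<eta>^2 to the sum and 10 \<eta> to
    the probability; \<eta> \<le> 1 turns 32 \<eta>^2 into at most 32 \<eta>.\<close>
  define \<eta> where "\<eta> = min 1 (\<epsilon> / 32)"
  have \<eta>: "\<eta> > 0" "\<eta> \<le> 1" "32 * \<eta> \<le> \<epsilon>" using assms by (auto simp: \<eta>_def)
  show ?thesis
    using null_germ_subset_sums[OF \<Xi> diag assms(3) \<eta>(1)]
  proof eventually_elim
    case (elim n)
    let ?X = "\<lambda>i. \<Xi> (grid 0 t n i) (grid 0 t n (Suc i))"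
    have "likely (10 * \<eta>) (\<lambda>\<omega>. (\<Sum>i<n. (Re (?X i \<omega>))\<^sup>2) \<le> 16 * \<eta>\<^sup>2)"
    proof (rule likely_sum_squares)
      fix S :: "nat set" assume "S \<subseteq> {..<n}"
      with elim have "likely \<eta> (\<lambda>\<omega>. norm (\<Sum>i\<in>S. ?X i \<omega>) \<le> \<eta>)" by blast
      then show "likely \<eta> (\<lambda>\<omega>. \<bar>\<Sum>i\<in>S. Re (?X i \<omega>)\<bar> \<le> \<eta>)"
        by (rule likely_mono) (auto simp flip: Re_sum intro: order_trans[OF abs_Re_le_cmod])
    qed
    moreover have "likely (10 * \<eta>) (\<lambda>\<omega>. (\<Sum>i<n. (Im (?X i \<omega>))\<^sup>2) \<le> 16 * \<eta>\<^sup>2)"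
    proof (rule likely_sum_squares)
      fix S :: "nat set" assume "S \<subseteq> {..<n}"
      with elim have "likely \<eta> (\<lambda>\<omega>. norm (\<Sum>i\<in>S. ?X i \<omega>) \<le> \<eta>)" by blast
      then show "likely \<eta> (\<lambda>\<omega>. \<bar>\<Sum>i\<in>S. Im (?X i \<omega>)\<bar> \<le> \<eta>)"
        by (rule likely_mono) (auto simp flip: Im_sum intro: order_trans[OF abs_Im_le_cmod])
    qed
    ultimately have "likely (10 * \<eta> + 10 * \<eta>) (\<lambda>\<omega>. (\<Sum>i<n. (Re (?X i \<omega>))\<^sup>2) \<le> 16 * \<eta>\<^sup>2 \<and>
        (\<Sum>i<n. (Im (?X i \<omega>))\<^sup>2) \<le> 16 * \<eta>\<^sup>2)"
      by (rule likely_conj)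
    then show ?case
    proof (rule likely_mono)
      show "10 * \<eta> + 10 * \<eta> \<le> \<epsilon>" using \<eta> by simp
      have "\<eta>\<^sup>2 \<le> \<eta>" using \<eta> by (simp add: power2_eq_square mult_left_le)
      then show "(\<Sum>i<n. (norm (?X i \<omega>))\<^sup>2) \<le> \<epsilon>"
        if "(\<Sum>i<n. (Re (?X i \<omega>))\<^sup>2) \<le> 16 * \<eta>\<^sup>2 \<and> (\<Sum>i<n. (Im (?X i \<omega>))\<^sup>2) \<le> 16 * \<eta>\<^sup>2" for \<omega>
        using that \<eta>(3) by (simp add: cmod_power2 sum.distrib)
    qed
  qed
qed

end

section \<open>Brownian increments\<close>

text \<open>Bounds are imposed at rational times, where they define measurable events, and carried
  to all times by continuity. The open set \<open>U\<close> makes the transfer local, as a modulus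
  of continuity requires.\<close>

lemma dense_bound:
  fixes f :: "real \<Rightarrow> 'e::real_normed_vector"
  assumes f: "continuous_on {0..t} f" and t: "0 < t" and U: "open U"
    and q: "\<And>q. q \<in> \<rat> \<Longrightarrow> q \<in> {0..t} \<Longrightarrow> q \<in> U \<Longrightarrow> norm (f q - c) \<le> K"
    and s: "s \<in> {0..t}" "s \<in> U"
  shows "norm (f s - c) \<le> K"
proof (rule ccontr)
  assume "\<not> norm (f s - c) \<le> K"
  then have "norm (f s - c) - K > 0" by simp
  then obtain d where d: "d > 0"
    "\<And>s'. s' \<in> {0..t} \<Longrightarrow> dist s' s < d \<Longrightarrow> dist (f s') (f s) < norm (f s - c) - K"
    using f s(1) unfolding continuous_on_iff by metis
  obtain d' where d': "d' > 0" "ball s d' \<subseteq> U"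
    using U s(2) open_contains_ball by blast
  have "max 0 (s - min d d') < min t (s + min d d')"
    using s(1) t d(1) d'(1) by auto
  then obtain r where r: "r \<in> \<rat>" "max 0 (s - min d d') < r" "r < min t (s + min d d')"
    using Rats_dense_in_real by blast
  have rt: "r \<in> {0..t}" and rs: "dist r s < d" and "r \<in> U"
    using r(2,3) d'(2) by (auto simp: dist_real_def subset_iff)
  then have "norm (f r - c) \<le> K" using q r(1) by blast
  moreover have "norm (f s - c) \<le> norm (f r - c) + dist (f r) (f s)"
    using norm_triangle_ineq4[of "f r - c" "f r - f s"] by (simp add: dist_norm)
  ultimately show False using d(2)[OF rt rs] by simp
qed

lemma sets_Collect_countable_Ball':
  assumes "countable I" "\<And>i. i \<in> I \<Longrightarrow> {x \<in> space M. Q i x} \<in> sets M"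
  shows "{x \<in> space M. \<forall>i\<in>I. Q i x} \<in> sets M"
proof -
  have "{x \<in> space M. \<not> Q i x} \<in> sets M" if "i \<in> I" for i
    using assms(2)[OF that] by (rule sets.sets_Collect_neg)
  then have "space M - (\<Union>i\<in>I. {x \<in> space M. \<not> Q i x}) \<in> sets M"
    using assms(1) by (intro sets.Diff sets.top sets.countable_UN') auto
  also have "space M - (\<Union>i\<in>I. {x \<in> space M. \<not> Q i x}) = {x \<in> space M. \<forall>i\<in>I. Q i x}"
    by auto
  finally show ?thesis .
qed

section \<open>Path bounds and moduli of continuity off a small event\<close>

context prob_space
begin

text \<open>Each continuous path is bounded on the compact interval;
  \<open>likely_increasing\<close> makes the bound uniform. Using m + 1 in place of m keeps it
  positive.\<close>

lemma likely_bounded: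
  fixes X :: "real \<Rightarrow> 'a \<Rightarrow> 'e::real_normed_vector"
  assumes meas: "\<And>s. 0 \<le> s \<Longrightarrow> X s \<in> borel_measurable M"
    and cont: "AE \<omega> in M. continuous_on {0..} (\<lambda>s. X s \<omega>)" and t: "0 < t" and \<epsilon>: "\<epsilon> > 0"
  shows "\<exists>K>0. likely \<epsilon> (\<lambda>\<omega>. \<forall>s\<in>{0..t}. norm (X s \<omega>) \<le> K)"
proof -
  let ?Q = "\<lambda>m \<omega>. \<forall>q\<in>\<rat> \<inter> {0..t}. norm (X q \<omega>) \<le> real m"
  have "\<exists>m. likely \<epsilon> (?Q m)"
  proof (rule likely_increasing[OF _ _ _ \<epsilon>])
    fix m :: nat
    have cnt: "countable (\<rat> \<inter> {0..t})" using countable_rat by blast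
    show "{\<omega> \<in> space M. ?Q m \<omega>} \<in> events"
    proof (rule sets_Collect_countable_Ball'[OF cnt])
      fix q assume "q \<in> \<rat> \<inter> {0..t}"
      then have [measurable]: "X q \<in> borel_measurable M" using meas by simp
      show "{\<omega> \<in> space M. norm (X q \<omega>) \<le> real m} \<in> events" by measurable
    qed
  next
    show "AE \<omega> in M. \<exists>m. ?Q m \<omega>"
      using cont
    proof eventually_elim
      case (elim \<omega>)
      have "compact ((\<lambda>s. X s \<omega>) ` {0..t})"
        by (intro compact_continuous_image continuous_on_subset[OF elim]) auto
      then obtain B where B: "\<forall>x\<in>(\<lambda>s. X s \<omega>) ` {0..t}. norm x \<le> B"
        using compact_imp_bounded bounded_iff by blast
      obtain m :: nat where "B \<le> real m" using real_arch_simple by blast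
      with B have "?Q m \<omega>" by force
      then show ?case by blast
    qed
  qed (meson of_nat_le_iff order_trans)
  then obtain m where m: "likely \<epsilon> (?Q m)" by blast
  have "AE \<omega> in M. ?Q m \<omega> \<longrightarrow> (\<forall>s\<in>{0..t}. norm (X s \<omega>) \<le> real m + 1)"
    using cont
  proof eventually_elim
    case (elim \<omega>)
    have c: "continuous_on {0..t} (\<lambda>s. X s \<omega>)" by (rule continuous_on_subset[OF elim]) auto
    show ?case
    proof (intro impI ballI)
      fix s assume Q: "?Q m \<omega>" and s: "s \<in> {0..t}"
      have "norm (X s \<omega> - 0) \<le> real m"
      proof (rule dense_bound[OF c t open_UNIV _ s UNIV_I])
        fix q assume "q \<in> \<rat>" "q \<in> {0..t}"
        with Q show "norm (X q \<omega> - 0) \<le> real m" by simp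
      qed
      then show "norm (X s \<omega>) \<le> real m + 1" by simp
    qed
  qed
  from likely_mono_AE[OF m order_refl this] show ?thesis
    by (intro exI[of _ "real m + 1"]) auto
qed

lemma likely_modulus:
  fixes X :: "real \<Rightarrow> 'a \<Rightarrow> real"
  assumes meas: "\<And>s. 0 \<le> s \<Longrightarrow> X s \<in> borel_measurable M"
    and cont: "AE \<omega> in M. continuous_on {0..} (\<lambda>s. X s \<omega>)" and t: "0 < t" and \<epsilon>: "\<epsilon> > 0" and \<eta>: "\<eta> > 0"
  shows "\<exists>\<delta>>0. likely \<epsilon> (\<lambda>\<omega>. \<forall>s\<in>{0..t}. \<forall>s'\<in>{0..t}. \<bar>s - s'\<bar> < \<delta> \<longrightarrow> \<bar>X s \<omega> - X s' \<omega>\<bar> \<le> \<eta>)"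
proof -
  let ?Q = "\<lambda>m \<omega>. \<forall>q\<in>\<rat> \<inter> {0..t}. \<forall>q'\<in>\<rat> \<inter> {0..t}. \<bar>q - q'\<bar> < 1 / real (Suc m) \<longrightarrow> \<bar>X q \<omega> - X q' \<omega>\<bar> \<le> \<eta>"
  have "\<exists>m. likely \<epsilon> (?Q m)"
  proof (rule likely_increasing[OF _ _ _ \<epsilon>])
    fix m :: nat
    have cnt: "countable (\<rat> \<inter> {0..t})" using countable_rat by blast
    have "{\<omega> \<in> space M. \<bar>q - q'\<bar> < 1 / real (Suc m) \<longrightarrow> \<bar>X q \<omega> - X q' \<omega>\<bar> \<le> \<eta>} \<in> events"
      if "q \<in> \<rat> \<inter> {0..t}" "q' \<in> \<rat> \<inter> {0..t}" for q q'
    proof -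
      have [measurable]: "X q \<in> borel_measurable M" "X q' \<in> borel_measurable M"
        using meas that by auto
      show ?thesis by measurable
    qed
    then show "{\<omega> \<in> space M. ?Q m \<omega>} \<in> events"
      by (intro sets_Collect_countable_Ball'[OF cnt])
  next
    fix m n \<omega> assume mn: "m \<le> n" and Q: "?Q m \<omega>"
    have "1 / real (Suc n) \<le> 1 / real (Suc m)" using mn by (intro divide_left_mono) auto
    then show "?Q n \<omega>" using Q by (meson less_le_trans)
  next
    show "AE \<omega> in M. \<exists>m. ?Q m \<omega>"
      using cont
    proof eventually_elim
      case (elim \<omega>)
      have "uniformly_continuous_on {0..t} (\<lambda>s. X s \<omega>)"
        by (intro compact_uniformly_continuous continuous_on_subset[OF elim]) auto
      then obtain d where d: "d > 0"
        "\<And>s s'. s \<in> {0..t} \<Longrightarrow> s' \<in> {0..t} \<Longrightarrow> dist s' s < d \<Longrightarrow> dist (X s' \<omega>) (X s \<omega>) < \<eta>"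
        using \<eta> unfolding uniformly_continuous_on_def by metis
      obtain m where m: "1 / real (Suc m) < d"
        using d(1) by (metis nat_approx_posE)
      have "?Q m \<omega>"
      proof (intro ballI impI)
        fix q q' assume q: "q \<in> \<rat> \<inter> {0..t}" "q' \<in> \<rat> \<inter> {0..t}" "\<bar>q - q'\<bar> < 1 / real (Suc m)"
        then have "dist (X q \<omega>) (X q' \<omega>) < \<eta>"
          using m by (intro d(2)) (auto simp: dist_real_def)
        then show "\<bar>X q \<omega> - X q' \<omega>\<bar> \<le> \<eta>" by (simp add: dist_real_def)
      qed
      then show ?case by blast
    qed
  qed
  then obtain m where m: "likely \<epsilon> (?Q m)" by blast
  let ?d = "1 / real (Suc m)"
  have "AE \<omega> in M. ?Q m \<omega> \<longrightarrow>
      (\<forall>s\<in>{0..t}. \<forall>s'\<in>{0..t}. \<bar>s - s'\<bar> < ?d \<longrightarrow> \<bar>X s \<omega> - X s' \<omega>\<bar> \<le> \<eta>)"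
    using cont
  proof eventually_elim
    case (elim \<omega>)
    have c: "continuous_on {0..t} (\<lambda>s. X s \<omega>)" by (rule continuous_on_subset[OF elim]) auto
    show ?case
    proof (intro impI ballI)
      fix s s' assume Q: "?Q m \<omega>" and s: "s \<in> {0..t}" "s' \<in> {0..t}" "\<bar>s - s'\<bar> < ?d"
      \<comment> \<open>The modulus passes to real times one variable at a time: here one time is
        still rational, and the next application of \<open>dense_bound\<close> frees it.\<close>
      have 1: "norm (X q \<omega> - X u \<omega>) \<le> \<eta>" if q: "q \<in> \<rat>" "q \<in> {0..t}" and u: "u \<in> {0..t}" "u \<in> ball q ?d" for q u
      proof -
        have "norm (X u \<omega> - X q \<omega>) \<le> \<eta>"
        proof (rule dense_bound[OF c t open_ball _ u])
          fix p assume "p \<in> \<rat>" "p \<in> {0..t}" "p \<in> ball q ?d"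
          then show "norm (X p \<omega> - X q \<omega>) \<le> \<eta>" using Q q by (auto simp: dist_real_def abs_minus_commute)
        qed
        then show ?thesis by (simp add: norm_minus_commute)
      qed
      have "norm (X s \<omega> - X s' \<omega>) \<le> \<eta>"
      proof (rule dense_bound[OF c t open_ball[of s' ?d] _ s(1)])
        fix p assume "p \<in> \<rat>" "p \<in> {0..t}" "p \<in> ball s' ?d"
        then show "norm (X p \<omega> - X s' \<omega>) \<le> \<eta>"
          using s(2) by (intro 1) (auto simp: dist_commute)
      qed (use s in \<open>auto simp: dist_real_def\<close>)
      then show "\<bar>X s \<omega> - X s' \<omega>\<bar> \<le> \<eta>" by simp
    qed
  qed
  from likely_mono_AE[OF m order_refl this] show ?thesis
    by (intro exI[of _ ?d]) auto
qed

end

section \<open>Moments and independence of Brownian increments\<close>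

lemma norm_cis_minus_1_le: "norm (cis x - 1) \<le> \<bar>x\<bar>"
  using iexp_approx1[of x 0] by (simp add: cis_conv_exp)

lemma norm_cis_minus_linear_le: "norm (cis x - 1 - \<i> * x) \<le> x\<^sup>2 / 2"
  using iexp_approx1[of x 1] by (simp add: cis_conv_exp fact_numeral power2_eq_square diff_diff_eq)

locale brownian_space =
  fixes P :: "'w measure" and F :: "real \<Rightarrow> 'w measure" and W :: "real \<Rightarrow> 'w \<Rightarrow> real"
  assumes fps: "filtered_prob_space P F" and bm: "brownian_motion P F W"
begin

sublocale prob_space P
  using fps by (simp add: filtered_prob_space_def)

lemma space_F: "space (F t) = space P"
  using fps by (auto simp: filtered_prob_space_def subalgebra_def)

lemma F_mono: "f \<in> borel_measurable (F s) \<Longrightarrow> s \<le> t \<Longrightarrow> f \<in> borel_measurable (F t)"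
proof -
  assume "f \<in> borel_measurable (F s)" "s \<le> t"
  moreover have "filtration (space P) F" using fps by (simp add: filtered_prob_space_def)
  then have "subalgebra (F t) (F s)"
    using filtration.sets_F_mono[of "space P" F s t] \<open>s \<le> t\<close> by (auto simp: subalgebra_def space_F)
  ultimately show ?thesis using measurable_from_subalg by blast
qed

lemma F_measurable: "f \<in> borel_measurable (F t) \<Longrightarrow> f \<in> borel_measurable P"
  using fps measurable_from_subalg[of P "F t" f borel] by (auto simp: filtered_prob_space_def)

lemma W_adapted: "0 \<le> t \<Longrightarrow> W t \<in> borel_measurable (F t)"
  using bm by (simp add: brownian_motion_def adapted_process_def)

lemma W_continuous: "AE \<omega> in P. continuous_on {0..} (\<lambda>t. W t \<omega>)"
  using bm by (simp add: brownian_motion_def continuous_process_def)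

lemma W_0: "AE \<omega> in P. W 0 \<omega> = 0"
  using bm by (simp add: brownian_motion_def)

lemma increment_measurable: "0 \<le> s \<Longrightarrow> 0 \<le> t \<Longrightarrow> (\<lambda>\<omega>. W t \<omega> - W s \<omega>) \<in> borel_measurable P"
  using W_adapted F_measurable by (intro borel_measurable_diff) auto

lemma increment_distributed:
  assumes "0 \<le> s" "s < t"
  shows "distributed P lborel (\<lambda>\<omega>. W t \<omega> - W s \<omega>) (normal_density 0 (sqrt (t - s)))"
  using bm assms by (simp add: brownian_motion_def)

lemma increment_moments:
  assumes "0 \<le> s" "s < t"
  shows "integrable P (\<lambda>\<omega>. W t \<omega> - W s \<omega>)" "expectation (\<lambda>\<omega>. W t \<omega> - W s \<omega>) = 0"
    "integrable P (\<lambda>\<omega>. (W t \<omega> - W s \<omega>)\<^sup>2)" "expectation (\<lambda>\<omega>. (W t \<omega> - W s \<omega>)\<^sup>2) = t - s"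
proof -
  note D = increment_distributed[OF assms]
  have p: "sqrt (t - s) > 0" using assms by simp
  show 0: "expectation (\<lambda>\<omega>. W t \<omega> - W s \<omega>) = 0"
    by (rule normal_distributed_expectation[OF p D])
  show "integrable P (\<lambda>\<omega>. W t \<omega> - W s \<omega>)"
    using distributed_integrable[OF D, of "\<lambda>x. x"] integrable_normal_moment[OF p, of 0 1] by simp
  show "integrable P (\<lambda>\<omega>. (W t \<omega> - W s \<omega>)\<^sup>2)"
    using distributed_integrable[OF D, of "\<lambda>x. x\<^sup>2"] integrable_normal_moment[OF p, of 0 2] by simp
  show "expectation (\<lambda>\<omega>. (W t \<omega> - W s \<omega>)\<^sup>2) = t - s"
    using normal_distributed_variance[OF p D] 0 assms by simp
qed

lemma increment_independent:
  fixes f :: "'w \<Rightarrow> 'b::{real_normed_field, banach, second_countable_topology}"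
  assumes st: "0 \<le> s" "s < t" and f: "f \<in> borel_measurable (F s)" "\<And>\<omega>. norm (f \<omega>) \<le> A"
    and g: "g \<in> borel_measurable borel" "\<And>x. norm (g x) \<le> B"
  shows "expectation (\<lambda>\<omega>. f \<omega> * g (W t \<omega> - W s \<omega>)) = expectation f * expectation (\<lambda>\<omega>. g (W t \<omega> - W s \<omega>))"
proof -
  let ?D = "\<lambda>\<omega>. W t \<omega> - W s \<omega>"
  have fP: "f \<in> borel_measurable P" using f(1) by (rule F_measurable)
  have D[measurable]: "?D \<in> borel_measurable P" using increment_measurable st by simp
  have ind: "indep_set (sets (F s)) {?D -` A \<inter> space P | A. A \<in> sets borel}"
    using bm st by (simp add: brownian_motion_def)
  have "indep_var borel f borel (g \<circ> ?D)"
    unfolding indep_var_eq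
  proof (intro conjI)
    show "random_variable borel f" by (rule fP)
    show "random_variable borel (g \<circ> ?D)" using g(1) by simp
    have "sigma_sets (space P) {f -` A \<inter> space P |A. A \<in> sets borel} \<subseteq> sets (F s)"
    proof -
      have "{f -` A \<inter> space P |A. A \<in> sets borel} \<subseteq> sets (F s)"
        using measurable_sets[OF f(1)] by (auto simp: space_F)
      then show ?thesis using sets.sigma_sets_subset[of _ "F s"] by (simp add: space_F)
    qed
    \<comment> \<open>The preimages under the increment already form a sigma-algebra, namely
      \<open>vimage_algebra\<close>, so what a function of the increment generates stays inside the
      family that \<open>brownian_motion\<close> declares independent of the past.\<close>
    moreover have "sigma_sets (space P) {(g \<circ> ?D) -` A \<inter> space P |A. A \<in> sets borel}
        \<subseteq> {?D -` A \<inter> space P | A. A \<in> sets borel}"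
    proof -
      have "{(g \<circ> ?D) -` A \<inter> space P |A. A \<in> sets borel} \<subseteq> sets (vimage_algebra (space P) ?D borel)"
      proof safe
        fix A :: "'b set" assume "A \<in> sets borel"
        then have "g -` A \<in> sets borel" using measurable_sets_borel[OF g(1)] by simp
        then show "(g \<circ> ?D) -` A \<inter> space P \<in> sets (vimage_algebra (space P) ?D borel)"
          unfolding vimage_comp[symmetric] by (rule in_vimage_algebra)
      qed
      then have "sigma_sets (space P) {(g \<circ> ?D) -` A \<inter> space P |A. A \<in> sets borel}
          \<subseteq> sets (vimage_algebra (space P) ?D borel)"
        using sets.sigma_sets_subset[of _ "vimage_algebra (space P) ?D borel"] by simp
      then show ?thesis by (simp add: sets_vimage_algebra2)
    qed
    ultimately show "indep_set (sigma_sets (space P) {f -` A \<inter> space P |A. A \<in> sets borel})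
        (sigma_sets (space P) {(g \<circ> ?D) -` A \<inter> space P |A. A \<in> sets borel})"
      using ind unfolding indep_set_def by (elim indep_sets_mono_sets) (auto split: bool.split)
  qed
  moreover have "integrable P f"
    using f(2) fP by (intro integrable_const_bound[of _ A]) auto
  moreover have "integrable P (g \<circ> ?D)"
    using g by (intro integrable_const_bound[of _ B]) auto
  ultimately show ?thesis
    using indep_var_lebesgue_integral[of f "g \<circ> ?D"] by (simp add: o_def)
qed

text \<open>The expected sum of squared increments is t on every grid, so Markov's inequality gives
  a bound that does not depend on n.\<close>

lemma likely_quadratic_variation:
  assumes t: "0 < t" and \<epsilon>: "\<epsilon> > 0" and n: "0 < n"
  shows "likely \<epsilon> (\<lambda>\<omega>. (\<Sum>i<n. (W (grid 0 t n (Suc i)) \<omega> - W (grid 0 t n i) \<omega>)\<^sup>2) \<le> t / \<epsilon>)"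
proof -
  let ?V = "\<lambda>\<omega>. \<Sum>i<n. (W (grid 0 t n (Suc i)) \<omega> - W (grid 0 t n i) \<omega>)\<^sup>2"
  have g: "0 \<le> grid 0 t n i" "grid 0 t n i < grid 0 t n (Suc i)" for i
    using t n by (auto simp: grid_Suc grid_ge)
  have int: "integrable P ?V"
    using increment_moments(3)[OF g] by (intro Bochner_Integration.integrable_sum)
  have "expectation ?V = (\<Sum>i<n. grid 0 t n (Suc i) - grid 0 t n i)"
    using increment_moments(3,4)[OF g] by (subst Bochner_Integration.integral_sum) auto
  also have "\<dots> = t" using n by (simp add: grid_Suc)
  finally have "prob {\<omega> \<in> space P. ?V \<omega> \<ge> t / \<epsilon>} \<le> \<epsilon>"
    using integral_Markov_inequality_measure[OF int, of "{}" "t / \<epsilon>"] t \<epsilon>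
    by (auto simp: sum_nonneg)
  moreover have "{\<omega> \<in> space P. ?V \<omega> \<ge> t / \<epsilon>} \<in> events"
    using borel_measurable_integrable[OF int] by measurable
  moreover have "AE \<omega> in P. \<omega> \<notin> {\<omega> \<in> space P. ?V \<omega> \<ge> t / \<epsilon>} \<longrightarrow> ?V \<omega> \<le> t / \<epsilon>"
    by (rule AE_I2) auto
  ultimately show ?thesis unfolding likely_def by blast
qed

end

section \<open>Uniqueness for the discretized linear equation\<close>

context brownian_space
begin

lemma F_measurable_cis_increment:
  assumes "0 \<le> s" "s \<le> t"
  shows "(\<lambda>\<omega>. cis (\<beta> * (W t \<omega> - W s \<omega>)) - 1) \<in> borel_measurable (F t)"
proof -
  have [measurable]: "W t \<in> borel_measurable (F t)" "W s \<in> borel_measurable (F t)"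
    using assms W_adapted F_mono[OF W_adapted] by auto
  show ?thesis unfolding cis_conv_exp by measurable
qed

lemma norm_cis_minus_1_le_2: "norm (cis x - 1) \<le> 2"
  using norm_triangle_ineq4[of "cis x" 1] by simp

text \<open>The term of first order in the increment has mean zero, so the mean is governed by the
  square of the increment and is of order t - s.\<close>

lemma cis_increment_moments:
  assumes "0 \<le> s" "s < t"
  shows norm_mean_cis_increment:
      "norm (expectation (\<lambda>\<omega>. cis (\<beta> * (W t \<omega> - W s \<omega>)) - 1)) \<le> \<beta>\<^sup>2 * (t - s) / 2"
    and second_moment_cis_increment:
      "expectation (\<lambda>\<omega>. (norm (cis (\<beta> * (W t \<omega> - W s \<omega>)) - 1))\<^sup>2) \<le> \<beta>\<^sup>2 * (t - s)"
proof -
  let ?D = "\<lambda>\<omega>. W t \<omega> - W s \<omega>" and ?Z = "\<lambda>\<omega>. cis (\<beta> * (W t \<omega> - W s \<omega>)) - 1"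
  note D = increment_moments[OF assms]
  have Zm[measurable]: "?Z \<in> borel_measurable P"
    by (rule F_measurable[OF F_measurable_cis_increment]) (use assms in auto)
  have Z: "integrable P ?Z"
    using norm_cis_minus_1_le_2 by (intro integrable_const_bound[of _ 2]) auto
  have lin: "integrable P (\<lambda>\<omega>. \<i> * complex_of_real (\<beta> * ?D \<omega>))"
    using D(1) by (intro integrable_mult_right integrable_of_real)
  have "expectation (\<lambda>\<omega>. \<i> * complex_of_real (\<beta> * ?D \<omega>)) = \<i> * complex_of_real (\<beta> * expectation ?D)"
    by (simp only: integral_mult_right_zero integral_complex_of_real)
  then have 0: "expectation (\<lambda>\<omega>. \<i> * complex_of_real (\<beta> * ?D \<omega>)) = 0"
    using D(2) by simp
  have "norm (expectation ?Z) = norm (expectation (\<lambda>\<omega>. ?Z \<omega> - \<i> * complex_of_real (\<beta> * ?D \<omega>)))"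
    using Z lin 0 by (subst Bochner_Integration.integral_diff) auto
  also have "\<dots> \<le> expectation (\<lambda>\<omega>. norm (?Z \<omega> - \<i> * complex_of_real (\<beta> * ?D \<omega>)))"
    by (rule integral_norm_bound)
  also have "\<dots> \<le> expectation (\<lambda>\<omega>. \<beta>\<^sup>2 / 2 * (?D \<omega>)\<^sup>2)"
  proof (rule integral_mono)
    show "integrable P (\<lambda>\<omega>. norm (?Z \<omega> - \<i> * complex_of_real (\<beta> * ?D \<omega>)))"
      by (rule integrable_norm[OF Bochner_Integration.integrable_diff[OF Z lin]])
    show "integrable P (\<lambda>\<omega>. \<beta>\<^sup>2 / 2 * (?D \<omega>)\<^sup>2)" using D(3) by simp
    show "norm (?Z \<omega> - \<i> * complex_of_real (\<beta> * ?D \<omega>)) \<le> \<beta>\<^sup>2 / 2 * (?D \<omega>)\<^sup>2" for \<omega>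
      using norm_cis_minus_linear_le[of "\<beta> * ?D \<omega>"] by (simp add: power_mult_distrib)
  qed
  also have "\<dots> = \<beta>\<^sup>2 * (t - s) / 2" using D(4) by simp
  finally show "norm (expectation ?Z) \<le> \<beta>\<^sup>2 * (t - s) / 2" .
  have "expectation (\<lambda>\<omega>. (norm (?Z \<omega>))\<^sup>2) \<le> expectation (\<lambda>\<omega>. \<beta>\<^sup>2 * (?D \<omega>)\<^sup>2)"
  proof (rule integral_mono)
    show "integrable P (\<lambda>\<omega>. (norm (?Z \<omega>))\<^sup>2)"
      using power_mono[OF norm_cis_minus_1_le_2 norm_ge_zero, where n = 2] by (intro integrable_const_bound[of _ 4]) auto
    show "integrable P (\<lambda>\<omega>. \<beta>\<^sup>2 * (?D \<omega>)\<^sup>2)" using D(3) by simp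
    show "(norm (?Z \<omega>))\<^sup>2 \<le> \<beta>\<^sup>2 * (?D \<omega>)\<^sup>2" for \<omega>
      using power_mono[OF norm_cis_minus_1_le[of "\<beta> * ?D \<omega>"] norm_ge_zero, where n = 2]
      by (simp add: power_mult_distrib flip: abs_mult)
  qed
  then show "expectation (\<lambda>\<omega>. (norm (?Z \<omega>))\<^sup>2) \<le> \<beta>\<^sup>2 * (t - s)" using D(4) by simp
qed

text \<open>Independence factors the cross term into two expectations, and the one of the increment
  is of order t - s; the Cauchy-Schwarz inequality would give only the square root of t - s, which
  does not sum over a grid. In the constant 3/2, the square of the new term accounts for 1 and the
  cross term for 1/2.\<close>

lemma second_moment_step:
  fixes S Z :: "'w \<Rightarrow> complex"
  assumes st: "0 \<le> s" "s < t"
    and S: "S \<in> borel_measurable (F s)" "\<And>\<omega>. norm (S \<omega>) \<le> A"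
    and Z: "Z \<in> borel_measurable (F s)" "\<And>\<omega>. norm (Z \<omega>) \<le> B"
  shows "expectation (\<lambda>\<omega>. (norm (S \<omega> + Z \<omega> * (cis (\<beta> * (W t \<omega> - W s \<omega>)) - 1)))\<^sup>2)
    \<le> (1 + \<beta>\<^sup>2 * (t - s) / 2) * expectation (\<lambda>\<omega>. (norm (S \<omega>))\<^sup>2)
      + 3 / 2 * \<beta>\<^sup>2 * (t - s) * expectation (\<lambda>\<omega>. (norm (Z \<omega>))\<^sup>2)"
proof -
  define g where "g x = cis (\<beta> * x) - 1" for x
  let ?D = "\<lambda>\<omega>. W t \<omega> - W s \<omega>"
  let ?h = "\<beta>\<^sup>2 * (t - s)"
  let ?a = "expectation (\<lambda>\<omega>. (norm (S \<omega>))\<^sup>2)" and ?b = "expectation (\<lambda>\<omega>. (norm (Z \<omega>))\<^sup>2)"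
  have h: "?h \<ge> 0" using st by simp
  have g2: "norm (g x) \<le> 2" for x unfolding g_def by (rule norm_cis_minus_1_le_2)
  have gm[measurable]: "g \<in> borel_measurable borel" unfolding g_def cis_conv_exp by measurable
  have [measurable]: "S \<in> borel_measurable P" "Z \<in> borel_measurable P" "?D \<in> borel_measurable P"
    using S(1) Z(1) F_measurable increment_measurable st by auto
  note [measurable] = S(1) Z(1)
  have cnjm: "(\<lambda>\<omega>. cnj (S \<omega>)) \<in> borel_measurable M'" if "S \<in> borel_measurable M'" for M'
    using borel_measurable_continuous_on[OF continuous_on_cnj[OF continuous_on_id] that] by simp
  have [measurable]: "(\<lambda>\<omega>. cnj (S \<omega>)) \<in> borel_measurable P" "(\<lambda>\<omega>. cnj (S \<omega>)) \<in> borel_measurable (F s)"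
    by (rule cnjm, measurable)+
  have A: "A \<ge> 0" and B: "B \<ge> 0" using S(2) Z(2) norm_ge_zero order_trans by blast+
  have intS: "integrable P (\<lambda>\<omega>. (norm (S \<omega>))\<^sup>2)"
    using power_mono[OF S(2) norm_ge_zero, where n = 2] by (intro integrable_const_bound[of _ "A\<^sup>2"]) auto
  have intZ: "integrable P (\<lambda>\<omega>. (norm (Z \<omega>))\<^sup>2)"
    using power_mono[OF Z(2) norm_ge_zero, where n = 2] by (intro integrable_const_bound[of _ "B\<^sup>2"]) auto
  have bZg: "norm (Z \<omega> * g (?D \<omega>)) \<le> B * 2" for \<omega>
    using Z(2) g2 B by (simp add: norm_mult mult_mono)
  have bc: "norm (cnj (S \<omega>) * Z \<omega>) \<le> A * B" for \<omega>
    using Z(2) S(2) A by (simp add: norm_mult mult_mono)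
  have intZg: "integrable P (\<lambda>\<omega>. (norm (Z \<omega>))\<^sup>2 * (norm (g (?D \<omega>)))\<^sup>2)"
    using power_mono[OF bZg norm_ge_zero, where n = 2]
    by (intro integrable_const_bound[of _ "(B * 2)\<^sup>2"]) (auto simp: norm_mult power_mult_distrib)
  define c where "c \<omega> = cnj (S \<omega>) * Z \<omega> * g (?D \<omega>)" for \<omega>
  have intc: "integrable P c"
    unfolding c_def using mult_mono[OF bc g2] A B
    by (intro integrable_const_bound[of _ "A * B * 2"]) (auto simp: norm_mult)
  have "norm (S \<omega> + Z \<omega> * g (?D \<omega>)) ^ 2 = (norm (S \<omega>))\<^sup>2 + (norm (Z \<omega>))\<^sup>2 * (norm (g (?D \<omega>)))\<^sup>2
      + 2 * Re (c \<omega>)" for \<omega>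
    unfolding c_def cmod_power2 by (simp add: power2_eq_square algebra_simps)
  then have "expectation (\<lambda>\<omega>. (norm (S \<omega> + Z \<omega> * g (?D \<omega>)))\<^sup>2) =
      expectation (\<lambda>\<omega>. (norm (S \<omega>))\<^sup>2) + expectation (\<lambda>\<omega>. (norm (Z \<omega>))\<^sup>2 * (norm (g (?D \<omega>)))\<^sup>2)
      + 2 * Re (expectation c)"
    using intS intZg intc integrable_Re[OF intc] integral_Re[OF intc] by simp
  also have "expectation (\<lambda>\<omega>. (norm (Z \<omega>))\<^sup>2 * (norm (g (?D \<omega>)))\<^sup>2) =
      expectation (\<lambda>\<omega>. (norm (Z \<omega>))\<^sup>2) * expectation (\<lambda>\<omega>. (norm (g (?D \<omega>)))\<^sup>2)"
    using power_mono[OF Z(2) norm_ge_zero, where n = 2] power_mono[OF g2 norm_ge_zero, where n = 2]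
    by (intro increment_independent[OF st, where A = "B\<^sup>2" and B = "2\<^sup>2"]) auto
  also have "\<dots> \<le> expectation (\<lambda>\<omega>. (norm (Z \<omega>))\<^sup>2) * ?h"
    unfolding g_def by (intro mult_left_mono second_moment_cis_increment[OF st]) auto
  also have "expectation c =
      expectation (\<lambda>\<omega>. cnj (S \<omega>) * Z \<omega>) * expectation (\<lambda>\<omega>. g (?D \<omega>))"
    unfolding c_def by (intro increment_independent[OF st _ bc _ g2]) auto
  also have "2 * Re (expectation (\<lambda>\<omega>. cnj (S \<omega>) * Z \<omega>) * expectation (\<lambda>\<omega>. g (?D \<omega>)))
      \<le> (expectation (\<lambda>\<omega>. (norm (S \<omega>))\<^sup>2) + expectation (\<lambda>\<omega>. (norm (Z \<omega>))\<^sup>2)) * (?h / 2)"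
  proof -
    have "norm (expectation (\<lambda>\<omega>. cnj (S \<omega>) * Z \<omega>)) \<le> expectation (\<lambda>\<omega>. norm (cnj (S \<omega>) * Z \<omega>))"
      by (rule integral_norm_bound)
    also have "\<dots> \<le> expectation (\<lambda>\<omega>. ((norm (S \<omega>))\<^sup>2 + (norm (Z \<omega>))\<^sup>2) / 2)"
    proof (rule integral_mono)
      show "integrable P (\<lambda>\<omega>. norm (cnj (S \<omega>) * Z \<omega>))"
        using bc by (intro integrable_const_bound[of _ "A * B"])
          auto
      show "integrable P (\<lambda>\<omega>. ((norm (S \<omega>))\<^sup>2 + (norm (Z \<omega>))\<^sup>2) / 2)"
        using intS intZ by simp
      show "norm (cnj (S \<omega>) * Z \<omega>) \<le> ((norm (S \<omega>))\<^sup>2 + (norm (Z \<omega>))\<^sup>2) / 2" for \<omega>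
        using sum_squares_bound[of "norm (S \<omega>)" "norm (Z \<omega>)"] by (simp add: norm_mult)
    qed
    also have "\<dots> = (expectation (\<lambda>\<omega>. (norm (S \<omega>))\<^sup>2) + expectation (\<lambda>\<omega>. (norm (Z \<omega>))\<^sup>2)) / 2"
      using intS intZ by simp
    finally have cb: "norm (expectation (\<lambda>\<omega>. cnj (S \<omega>) * Z \<omega>))
      \<le> (expectation (\<lambda>\<omega>. (norm (S \<omega>))\<^sup>2) + expectation (\<lambda>\<omega>. (norm (Z \<omega>))\<^sup>2)) / 2" .
    have "Re (expectation (\<lambda>\<omega>. cnj (S \<omega>) * Z \<omega>) * expectation (\<lambda>\<omega>. g (?D \<omega>)))
      \<le> norm (expectation (\<lambda>\<omega>. cnj (S \<omega>) * Z \<omega>)) * norm (expectation (\<lambda>\<omega>. g (?D \<omega>)))"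
      by (metis complex_Re_le_cmod norm_mult)
    also have "\<dots> \<le> (expectation (\<lambda>\<omega>. (norm (S \<omega>))\<^sup>2) + expectation (\<lambda>\<omega>. (norm (Z \<omega>))\<^sup>2)) / 2 * (?h / 2)"
      using cb norm_mean_cis_increment[OF st, of \<beta>] unfolding g_def by (intro mult_mono) auto
    finally show ?thesis by simp
  qed
  finally have "expectation (\<lambda>\<omega>. (norm (S \<omega> + Z \<omega> * g (?D \<omega>)))\<^sup>2) \<le> ?a + ?b * ?h + (?a + ?b) * (?h / 2)"
    by simp
  moreover have "?a + ?b * ?h + (?a + ?b) * (?h / 2) = (1 + ?h / 2) * ?a + 3 / 2 * \<beta>\<^sup>2 * (t - s) * ?b"
    by (simp add: field_simps)
  ultimately show ?thesis by (simp only: g_def)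
qed

text \<open>A discrete Gronwall iteration of \<open>second_moment_step\<close>: the factors 1 +
  \<beta>^2 h / 2 are at most exp (\<beta>^2 h / 2), so their product over the n cells stays below
  exp (\<beta>^2 t / 2) whatever n is.\<close>

lemma second_moment_sum:
  fixes Z :: "real \<Rightarrow> 'w \<Rightarrow> complex"
  assumes t: "0 < t" and n: "0 < n"
    and Z: "\<And>s. 0 \<le> s \<Longrightarrow> Z s \<in> borel_measurable (F s)" "\<And>s \<omega>. norm (Z s \<omega>) \<le> K"
  shows "expectation (\<lambda>\<omega>. (norm (\<Sum>i<n. Z (grid 0 t n i) \<omega> *
        (cis (\<beta> * (W (grid 0 t n (Suc i)) \<omega> - W (grid 0 t n i) \<omega>)) - 1)))\<^sup>2)
    \<le> exp (\<beta>\<^sup>2 * t / 2) * (3 / 2 * \<beta>\<^sup>2) * (t / n * (\<Sum>i<n. expectation (\<lambda>\<omega>. (norm (Z (grid 0 t n i) \<omega>))\<^sup>2)))"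
proof -
  define T where "T = grid 0 t n"
  define h where "h = t / n"
  define S where "S k \<omega> = (\<Sum>i<k. Z (T i) \<omega> * (cis (\<beta> * (W (T (Suc i)) \<omega> - W (T i) \<omega>)) - 1))" for k \<omega>
  define g where "g i = expectation (\<lambda>\<omega>. (norm (Z (T i) \<omega>))\<^sup>2)" for i
  have h: "h > 0" using t n by (simp add: h_def)
  have T: "0 \<le> T i" "T i < T (Suc i)" "T (Suc i) - T i = h" for i
    using h t by (auto simp: T_def h_def grid_Suc grid_ge)
  have Tmono: "i \<le> j \<Longrightarrow> T i \<le> T j" for i j using t by (simp add: T_def grid_mono)
  have K: "K \<ge> 0" using Z(2) norm_ge_zero order_trans by blast
  have g0: "g i \<ge> 0" for i by (simp add: g_def)
  have Sm: "S k \<in> borel_measurable (F (T k))" for k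
    unfolding S_def
  proof (intro borel_measurable_sum borel_measurable_times)
    fix i assume "i \<in> {..<k}"
    then have i: "T i \<le> T k" "T (Suc i) \<le> T k" using Tmono by auto
    show "Z (T i) \<in> borel_measurable (F (T k))" using F_mono[OF Z(1)[OF T(1)] i(1)] .
    show "(\<lambda>\<omega>. cis (\<beta> * (W (T (Suc i)) \<omega> - W (T i) \<omega>)) - 1) \<in> borel_measurable (F (T k))"
      using F_mono[OF F_measurable_cis_increment i(2)] T by (simp add: less_imp_le)
  qed
  have Sb: "norm (S k \<omega>) \<le> (\<Sum>i<k. K * 2)" for k \<omega>
    unfolding S_def using Z(2) norm_cis_minus_1_le_2 K
    by (intro sum_norm_le) (simp add: norm_mult mult_mono)
  have "expectation (\<lambda>\<omega>. (norm (S k \<omega>))\<^sup>2) \<le> exp (\<beta>\<^sup>2 * h / 2 * k) * (3 / 2 * \<beta>\<^sup>2 * h * (\<Sum>i<k. g i))" for k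
  proof (induction k)
    case 0
    show ?case by (simp add: S_def)
  next
    case (Suc k)
    let ?c = "3 / 2 * \<beta>\<^sup>2 * h" and ?e = "exp (\<beta>\<^sup>2 * h / 2)"
    have c: "?c \<ge> 0" using h by simp
    have "expectation (\<lambda>\<omega>. (norm (S (Suc k) \<omega>))\<^sup>2)
        \<le> (1 + \<beta>\<^sup>2 * h / 2) * expectation (\<lambda>\<omega>. (norm (S k \<omega>))\<^sup>2) + ?c * g k"
      using second_moment_step[OF T(1,2)[of k] Sm[of k] Sb[of k] Z(1)[OF T(1)[of k]] Z(2)[of "T k"], of \<beta>]
      by (simp add: S_def g_def T(3) mult.assoc)
    also have "\<dots> \<le> ?e * (exp (\<beta>\<^sup>2 * h / 2 * k) * (?c * (\<Sum>i<k. g i))) + exp (\<beta>\<^sup>2 * h / 2 * Suc k) * (?c * g k)"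
    proof (rule add_mono, rule mult_mono)
      show "1 + \<beta>\<^sup>2 * h / 2 \<le> ?e" by (rule exp_ge_add_one_self)
      have "1 \<le> exp (\<beta>\<^sup>2 * h / 2 * Suc k)" using h by simp
      then have "1 * (?c * g k) \<le> exp (\<beta>\<^sup>2 * h / 2 * Suc k) * (?c * g k)"
        by (intro mult_right_mono mult_nonneg_nonneg[OF c g0])
      then show "?c * g k \<le> exp (\<beta>\<^sup>2 * h / 2 * Suc k) * (?c * g k)" by simp
    qed (use Suc.IH in auto)
    also have "?e * (exp (\<beta>\<^sup>2 * h / 2 * k) * (?c * (\<Sum>i<k. g i)))
        = exp (\<beta>\<^sup>2 * h / 2 * Suc k) * (?c * (\<Sum>i<k. g i))"
      by (simp add: mult.assoc[symmetric] exp_add[symmetric] distrib_left add.commute)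
    finally show ?case by (simp add: distrib_left)
  qed
  from this[of n] show ?thesis
    using n by (simp add: S_def T_def g_def h_def mult.assoc)
qed

text \<open>
  Truncation at a level \<open>K\<close> makes \<open>Y\<close> square integrable while keeping it adapted; restricting the
  truncation condition to rational times keeps it measurable.
\<close>

definition truncation :: "(real \<Rightarrow> 'w \<Rightarrow> complex) \<Rightarrow> real \<Rightarrow> real \<Rightarrow> 'w \<Rightarrow> complex" where
  "truncation Y K s \<omega> =
     (if (\<forall>q\<in>\<rat> \<inter> {0..s}. norm (Y q \<omega>) \<le> K) \<and> norm (Y s \<omega>) \<le> K then Y s \<omega> else 0)"

lemma norm_truncation_le: "0 \<le> K \<Longrightarrow> norm (truncation Y K s \<omega>) \<le> K"
  by (simp add: truncation_def)

lemma truncation_adapted: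
  assumes Y: "\<And>t. 0 \<le> t \<Longrightarrow> Y t \<in> borel_measurable (F t)" and s: "0 \<le> s"
  shows "truncation Y K s \<in> borel_measurable (F s)"
proof -
  note [measurable] = Y[OF s]
  have "{\<omega> \<in> space (F s). \<forall>q\<in>\<rat> \<inter> {0..s}. norm (Y q \<omega>) \<le> K} \<in> sets (F s)"
  proof (rule sets_Collect_countable_Ball')
    show "countable (\<rat> \<inter> {0..s})" using countable_rat by blast
    fix q assume "q \<in> \<rat> \<inter> {0..s}"
    then have [measurable]: "Y q \<in> borel_measurable (F s)" by (intro F_mono[OF Y]) auto
    show "{\<omega> \<in> space (F s). norm (Y q \<omega>) \<le> K} \<in> sets (F s)" by measurable
  qed
  then have [measurable]: "Measurable.pred (F s) (\<lambda>\<omega>. \<forall>q\<in>\<rat> \<inter> {0..s}. norm (Y q \<omega>) \<le> K)"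
    by (simp add: pred_def)
  show ?thesis unfolding truncation_def[abs_def] by measurable
qed

text \<open>A left Riemann sum of an increasing function lies below its integral. Cell by cell this
  is 1 + x \<le> exp x.\<close>

lemma sum_exp_grid_le:
  assumes "0 < t" "0 < n" "0 < L"
  shows "t / n * (\<Sum>i<n. exp (L * grid 0 t n i)) \<le> exp (L * t) / L"
proof -
  have "t / n * exp (L * grid 0 t n i) \<le> (exp (L * grid 0 t n (Suc i)) - exp (L * grid 0 t n i)) / L" for i
  proof -
    have "L * (t / n) \<le> exp (L * (t / n)) - 1"
      using exp_ge_add_one_self[of "L * (t / n)"] by linarith
    then have "exp (L * grid 0 t n i) * (L * (t / n)) \<le> exp (L * grid 0 t n i) * (exp (L * (t / n)) - 1)"
      by (rule mult_left_mono) simp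
    also have "\<dots> = exp (L * grid 0 t n (Suc i)) - exp (L * grid 0 t n i)"
      by (simp add: grid_Suc distrib_left exp_add algebra_simps)
    finally show ?thesis using assms(3) by (simp add: field_simps)
  qed
  then have "t / n * (\<Sum>i<n. exp (L * grid 0 t n i))
      \<le> (\<Sum>i<n. (exp (L * grid 0 t n (Suc i)) - exp (L * grid 0 t n i)) / L)"
    unfolding sum_distrib_left by (intro sum_mono)
  also have "\<dots> = (exp (L * t) - 1) / L"
    using assms by (subst sum_divide_distrib[symmetric], subst sum_lessThan_telescope) simp
  also have "\<dots> \<le> exp (L * t) / L" using assms by (intro divide_right_mono) auto
  finally show ?thesis .
qed

text \<open>A bound at the rational times up to t extends to the whole continuous path on [0, t], so
  the truncation is inactive at every s in [0, t].\<close>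

lemma truncation_eq:
  assumes c: "continuous_on {0..t} (\<lambda>s. y s)" and t: "0 < t"
    and eq: "\<forall>q\<in>\<rat> \<inter> {0..t}. y q = Y q \<omega>" "y s = Y s \<omega>" and s: "s \<in> {0..t}"
    and Q: "\<forall>q\<in>\<rat> \<inter> {0..t}. norm (Y q \<omega>) \<le> K"
  shows "truncation Y K s \<omega> = y s"
proof -
  have "norm (y s - 0) \<le> K"
  proof (rule dense_bound[OF c t open_UNIV _ s UNIV_I])
    fix q assume q: "q \<in> \<rat>" "q \<in> {0..t}"
    with eq(1) have "y q = Y q \<omega>" by blast
    moreover have "norm (Y q \<omega>) \<le> K" using Q q by blast
    ultimately show "norm (y q - 0) \<le> K" by simp
  qed
  moreover have "\<rat> \<inter> {0..s} \<subseteq> \<rat> \<inter> {0..t}" using s by auto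
  ultimately show ?thesis using Q eq(2) by (auto simp: truncation_def)
qed

text \<open>Here \<open>y\<close> carries path continuity and \<open>Y\<close> adaptedness. The
  second moment of the truncated process is bounded by a multiple of its own Riemann sums up to
  arbitrarily small errors, and an exponentially weighted supremum turns this into a contraction.
  Letting the truncation level grow then gives the claim.\<close>

lemma linear_equation_unique:
  fixes y Y :: "real \<Rightarrow> 'w \<Rightarrow> complex"
  assumes Y: "\<And>t. 0 \<le> t \<Longrightarrow> Y t \<in> borel_measurable (F t)"
    and yY: "\<And>t. 0 \<le> t \<Longrightarrow> AE \<omega> in P. y t \<omega> = Y t \<omega>"
    and cont: "AE \<omega> in P. continuous_on {0..} (\<lambda>t. y t \<omega>)"
    and y0: "AE \<omega> in P. y 0 \<omega> = 0"
    and step: "\<And>t \<epsilon>. 0 < t \<Longrightarrow> 0 < \<epsilon> \<Longrightarrow> \<exists>n>0. likely \<epsilon> (\<lambda>\<omega>. norm (y t \<omega> -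
      (\<Sum>i<n. y (grid 0 t n i) \<omega> * (cis (\<beta> * (W (grid 0 t n (Suc i)) \<omega> - W (grid 0 t n i) \<omega>)) - 1))) \<le> \<epsilon>)"
    and T: "0 < T"
  shows "AE \<omega> in P. y T \<omega> = 0"
proof -
  have good: "AE \<omega> in P. continuous_on {0..} (\<lambda>t. y t \<omega>) \<and> (\<forall>q\<in>\<rat> \<inter> {0..}. y q \<omega> = Y q \<omega>)"
  proof -
    have "countable (\<rat> \<inter> {0::real..})" using countable_rat by blast
    then have "AE \<omega> in P. \<forall>q\<in>\<rat> \<inter> {0..}. y q \<omega> = Y q \<omega>"
      using yY by (subst AE_ball_countable) auto
    with cont show ?thesis by eventually_elim auto
  qed
  have Z0: "AE \<omega> in P. truncation Y K T \<omega> = 0" if K: "K > 0" for K :: real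
  proof -
    define Z where "Z = truncation Y K"
    define g where "g s = expectation (\<lambda>\<omega>. (norm (Z s \<omega>))\<^sup>2)" for s
    define C where "C = exp (\<beta>\<^sup>2 * T / 2) * (3 / 2 * \<beta>\<^sup>2)"
    \<comment> \<open>Makes the contraction factor 2 C / L at most 1/2.\<close>
    define L where "L = 4 * C + 1"
    have Zb: "norm (Z s \<omega>) \<le> K" for s \<omega> using K by (simp add: Z_def norm_truncation_le)
    have Zm: "Z s \<in> borel_measurable (F s)" if "0 \<le> s" for s
      unfolding Z_def by (rule truncation_adapted[OF Y that])
    have ZP[measurable]: "Z s \<in> borel_measurable P" if "0 \<le> s" for s using Zm[OF that] by (rule F_measurable)
    have Z2: "(norm (Z s \<omega>))\<^sup>2 \<le> K\<^sup>2" for s \<omega> using power_mono[OF Zb norm_ge_zero, where n = 2] by simp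
    have intZ: "integrable P (\<lambda>\<omega>. (norm (Z s \<omega>))\<^sup>2)" if "0 \<le> s" for s
      using Z2 ZP[OF that] by (intro integrable_const_bound[of _ "K\<^sup>2"]) auto
    have g0: "g s \<ge> 0" for s by (simp add: g_def)
    have gK: "g s \<le> K\<^sup>2" if "0 \<le> s" for s
      unfolding g_def using Z2 by (intro integral_le_const intZ that) auto
    have C: "C \<ge> 0" by (simp add: C_def)
    have L: "L > 0" using C by (simp add: L_def)
    have bound: "\<exists>n>0. g t \<le> 2 * C * (t / n * (\<Sum>i<n. g (grid 0 t n i))) + 2 * \<epsilon>\<^sup>2 + K\<^sup>2 * \<epsilon>"
      if t: "0 < t" "t \<le> T" and \<epsilon>: "\<epsilon> > 0" for t \<epsilon>
    proof -
      obtain n E where n: "n > 0" and E[measurable]: "E \<in> events" and pE: "prob E \<le> \<epsilon>"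
        and small: "AE \<omega> in P. \<omega> \<notin> E \<longrightarrow> norm (y t \<omega> - (\<Sum>i<n. y (grid 0 t n i) \<omega> *
          (cis (\<beta> * (W (grid 0 t n (Suc i)) \<omega> - W (grid 0 t n i) \<omega>)) - 1))) \<le> \<epsilon>"
        using step[OF t(1) \<epsilon>] unfolding likely_def by blast
      let ?z = "\<lambda>i \<omega>. cis (\<beta> * (W (grid 0 t n (Suc i)) \<omega> - W (grid 0 t n i) \<omega>)) - 1"
      define S where "S \<omega> = (\<Sum>i<n. Z (grid 0 t n i) \<omega> * ?z i \<omega>)" for \<omega>
      have grid0: "0 \<le> grid 0 t n i" for i using t by (simp add: grid_ge)
      have "AE \<omega> in P. \<forall>i\<in>{..<n}. y (grid 0 t n i) \<omega> = Y (grid 0 t n i) \<omega>"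
        using yY[OF grid0] by (intro AE_finite_allI) auto
      moreover have "AE \<omega> in P. y t \<omega> = Y t \<omega>" using yY t by simp
      ultimately have "AE \<omega> in P. (norm (Z t \<omega>))\<^sup>2 \<le> 2 * (norm (S \<omega>))\<^sup>2 + 2 * \<epsilon>\<^sup>2 + K\<^sup>2 * indicator E \<omega>"
        using good small
      proof eventually_elim
        case (elim \<omega>)
        show ?case
        proof (cases "Z t \<omega> = 0 \<or> \<omega> \<in> E")
          case True
          have "0 \<le> 2 * (norm (S \<omega>))\<^sup>2 + 2 * \<epsilon>\<^sup>2" by simp
          then show ?thesis using Z2[of t \<omega>] True
            by (cases "\<omega> \<in> E") (simp_all add: add_increasing)
        next
          case False
          \<comment> \<open>A nonzero truncated value at t certifies the bound at all earlier
            rational times, so no grid point is truncated and the recursion for \<open>y\<close> is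
            one for \<open>Z\<close>. When \<open>Z\<close> vanishes at t nothing is to be shown,
            and on \<open>E\<close> only the level K is available, whence the term K^2 \<epsilon> in
            \<open>bound\<close>.\<close>
          then have Q: "\<forall>q\<in>\<rat> \<inter> {0..t}. norm (Y q \<omega>) \<le> K"
            unfolding Z_def truncation_def by presburger
          have c: "continuous_on {0..t} (\<lambda>s. y s \<omega>)"
            using elim by (auto intro: continuous_on_subset)
          have eq: "\<forall>q\<in>\<rat> \<inter> {0..t}. y q \<omega> = Y q \<omega>" using elim by auto
          have "Z t \<omega> = y t \<omega>"
            unfolding Z_def using elim t by (intro truncation_eq[where y = "\<lambda>s. y s \<omega>" and Y = Y and \<omega> = \<omega>, OF c t(1) eq _ _ Q]) auto
          moreover have "Z (grid 0 t n i) \<omega> = y (grid 0 t n i) \<omega>" if "i < n" for i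
            unfolding Z_def using elim t that grid0 grid_le[of 0 t i n]
            by (intro truncation_eq[where y = "\<lambda>s. y s \<omega>" and Y = Y and \<omega> = \<omega>, OF c t(1) eq _ _ Q]) auto
          ultimately have "norm (Z t \<omega> - S \<omega>) \<le> \<epsilon>"
            using elim False unfolding S_def by simp
          then have "norm (Z t \<omega>) \<le> norm (S \<omega>) + \<epsilon>"
            using norm_triangle_sub[of "Z t \<omega>" "S \<omega>"] by simp
          then have "(norm (Z t \<omega>))\<^sup>2 \<le> (norm (S \<omega>) + \<epsilon>)\<^sup>2" by (intro power_mono) auto
          also have "\<dots> \<le> 2 * (norm (S \<omega>))\<^sup>2 + 2 * \<epsilon>\<^sup>2"
            using sum_squares_bound[of "norm (S \<omega>)" \<epsilon>] by (simp add: power2_sum)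
          finally show ?thesis using False by simp
        qed
      qed
      moreover have intS: "integrable P (\<lambda>\<omega>. (norm (S \<omega>))\<^sup>2)"
      proof (rule integrable_const_bound[of _ "(\<Sum>i<n. K * 2)\<^sup>2"])
        have "norm (S \<omega>) \<le> (\<Sum>i<n. K * 2)" for \<omega>
          unfolding S_def using Zb norm_cis_minus_1_le_2 K
          by (intro sum_norm_le) (simp add: norm_mult mult_mono)
        from power_mono[OF this norm_ge_zero, where n = 2] show "AE \<omega> in P. norm ((norm (S \<omega>))\<^sup>2) \<le> (\<Sum>i<n. K * 2)\<^sup>2"
          by simp
        have "S \<in> borel_measurable P"
          unfolding S_def[abs_def]
        proof (intro borel_measurable_sum borel_measurable_times ZP grid0)
          fix i
          show "?z i \<in> borel_measurable P"
            using grid0 grid_mono[of 0 t i "Suc i" n] t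
            by (intro F_measurable[OF F_measurable_cis_increment]) auto
        qed
        then show "(\<lambda>\<omega>. (norm (S \<omega>))\<^sup>2) \<in> borel_measurable P" by measurable
      qed
      moreover have intE: "integrable P (indicat_real E)" by (simp add: integrable_indicator_iff less_top[symmetric])
      ultimately have "g t \<le> expectation (\<lambda>\<omega>. 2 * (norm (S \<omega>))\<^sup>2 + 2 * \<epsilon>\<^sup>2 + K\<^sup>2 * indicator E \<omega>)"
        unfolding g_def using intZ t
        by (intro integral_mono_AE Bochner_Integration.integrable_add integrable_mult_right) auto
      also have "\<dots> = 2 * expectation (\<lambda>\<omega>. (norm (S \<omega>))\<^sup>2) + 2 * \<epsilon>\<^sup>2 + K\<^sup>2 * prob E"
        using intS intE by (simp add: prob_space)
      also have "\<dots> \<le> 2 * (C * (t / n * (\<Sum>i<n. g (grid 0 t n i)))) + 2 * \<epsilon>\<^sup>2 + K\<^sup>2 * \<epsilon>"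
      proof (intro add_mono mult_left_mono order_refl pE)
        have "expectation (\<lambda>\<omega>. (norm (S \<omega>))\<^sup>2)
            \<le> exp (\<beta>\<^sup>2 * t / 2) * (3 / 2 * \<beta>\<^sup>2) * (t / n * (\<Sum>i<n. g (grid 0 t n i)))"
          unfolding S_def g_def by (rule second_moment_sum[OF t(1) n Zm Zb])
        also have "\<dots> \<le> C * (t / n * (\<Sum>i<n. g (grid 0 t n i)))"
          unfolding C_def using t g0
          by (intro mult_right_mono mult_nonneg_nonneg sum_nonneg) (auto intro!: mult_left_mono)
        finally show "expectation (\<lambda>\<omega>. (norm (S \<omega>))\<^sup>2) \<le> C * (t / n * (\<Sum>i<n. g (grid 0 t n i)))" .
      qed auto
      finally show ?thesis using n by (auto simp: mult.assoc)
    qed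
    \<comment> \<open>The n in \<open>bound\<close> depends on t and \<epsilon>. The weighted
      supremum absorbs this by comparing every Riemann sum of \<open>g\<close> with the same
      exponential.\<close>
    define G where "G = (SUP s\<in>{0..T}. g s * exp (- L * s))"
    have bdd: "bdd_above ((\<lambda>s. g s * exp (- L * s)) ` {0..T})"
    proof (rule bdd_aboveI2)
      fix s assume "s \<in> {0..T}"
      then have "g s * exp (- L * s) \<le> K\<^sup>2 * 1" using gK g0 L by (intro mult_mono) auto
      then show "g s * exp (- L * s) \<le> K\<^sup>2" by simp
    qed
    have gG: "g s \<le> G * exp (L * s)" if "s \<in> {0..T}" for s
    proof -
      have "g s * exp (- L * s) \<le> G" unfolding G_def by (rule cSUP_upper[OF that bdd])
      then show ?thesis by (simp add: exp_minus field_simps)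
    qed
    have G0: "G \<ge> 0"
      using gG[of 0] g0[of 0] T by simp
    have half: "g t * exp (- L * t) \<le> G / 2" if t: "t \<in> {0..T}" for t
    proof (cases "t = 0")
      case True
      have "AE \<omega> in P. (norm (Z 0 \<omega>))\<^sup>2 = 0"
        using y0 yY[of 0] by (auto simp: Z_def truncation_def)
      then have "g 0 = 0" unfolding g_def by (subst integral_cong_AE[of _ _ "\<lambda>_. 0"]) auto
      then show ?thesis using True G0 by simp
    next
      case False
      with t have t0: "0 < t" "t \<le> T" by auto
      have "g t \<le> 2 * C * (G * exp (L * t) / L)"
      proof (rule field_le_epsilon)
        fix e :: real assume e: "e > 0"
        \<comment> \<open>With \<epsilon> \<le> 1 both error terms together are at most (2 + K^2)
          \<epsilon>, hence at most e.\<close>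
        define \<epsilon> where "\<epsilon> = min 1 (e / (2 + K\<^sup>2))"
        have K2: "2 + K\<^sup>2 > 0" by (simp add: add_pos_nonneg)
        have \<epsilon>: "\<epsilon> > 0" "\<epsilon> \<le> 1" "\<epsilon> \<le> e / (2 + K\<^sup>2)"
          using e K2 by (auto simp: \<epsilon>_def)
        obtain n where n: "n > 0"
          "g t \<le> 2 * C * (t / n * (\<Sum>i<n. g (grid 0 t n i))) + 2 * \<epsilon>\<^sup>2 + K\<^sup>2 * \<epsilon>"
          using bound[OF t0 \<epsilon>(1)] by blast
        have "t / n * (\<Sum>i<n. g (grid 0 t n i)) \<le> t / n * (\<Sum>i<n. G * exp (L * grid 0 t n i))"
        proof (intro mult_left_mono sum_mono gG)
          fix i assume "i \<in> {..<n}"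
          then show "grid 0 t n i \<in> {0..T}"
            using t0 grid_le[of 0 t i n] by (auto simp: grid_ge)
        qed (use t0 in auto)
        also have "\<dots> = G * (t / n * (\<Sum>i<n. exp (L * grid 0 t n i)))"
          by (simp add: sum_distrib_left mult_ac)
        also have "\<dots> \<le> G * (exp (L * t) / L)"
          by (intro mult_left_mono sum_exp_grid_le G0 t0 n L)
        finally have "2 * C * (t / n * (\<Sum>i<n. g (grid 0 t n i))) \<le> 2 * C * (G * exp (L * t) / L)"
          using C by (intro mult_left_mono) auto
        moreover have "2 * \<epsilon>\<^sup>2 + K\<^sup>2 * \<epsilon> \<le> e"
        proof -
          have "\<epsilon>\<^sup>2 \<le> \<epsilon>" using \<epsilon> by (simp add: power2_eq_square mult_left_le)
          moreover have "\<epsilon> * (2 + K\<^sup>2) \<le> e" using \<epsilon>(3) K2 by (simp only: pos_le_divide_eq)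
          ultimately show ?thesis by (simp add: algebra_simps)
        qed
        ultimately show "g t \<le> 2 * C * (G * exp (L * t) / L) + e" using n(2) by simp
      qed
      then have "g t * exp (- L * t) \<le> 2 * C * (G * exp (L * t) / L) * exp (- L * t)"
        by (intro mult_right_mono) auto
      also have "\<dots> = 2 * C / L * G" by (simp add: exp_minus)
      also have "\<dots> \<le> 1 / 2 * G"
        using L G0 by (intro mult_right_mono) (auto simp: L_def field_simps)
      finally show ?thesis by simp
    qed
    have "G \<le> G / 2" unfolding G_def using half[unfolded G_def] T by (intro cSUP_least) auto
    then have "g T \<le> 0" using gG[of T] G0 T by auto
    then have "expectation (\<lambda>\<omega>. (norm (Z T \<omega>))\<^sup>2) = 0" using g0[of T] unfolding g_def by linarith
    then have "AE \<omega> in P. (norm (Z T \<omega>))\<^sup>2 = 0"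
      using intZ[of T] T by (subst (asm) integral_nonneg_eq_0_iff_AE) auto
    then show ?thesis by (simp add: Z_def)
  qed
  \<comment> \<open>Countably many levels suffice: every path is bounded on [0, T], so some level
    leaves it untouched.\<close>
  have "AE \<omega> in P. \<forall>m. truncation Y (real (Suc m)) T \<omega> = 0"
    unfolding AE_all_countable using Z0 by simp
  moreover have "AE \<omega> in P. y T \<omega> = Y T \<omega>" using yY T by simp
  ultimately show ?thesis using good
  proof eventually_elim
    case (elim \<omega>)
    have c: "continuous_on {0..T} (\<lambda>s. y s \<omega>)"
      using elim by (auto intro: continuous_on_subset)
    have eq: "\<forall>q\<in>\<rat> \<inter> {0..T}. y q \<omega> = Y q \<omega>" using elim by auto
    have "compact ((\<lambda>s. y s \<omega>) ` {0..T})"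
      by (intro compact_continuous_image c) auto
    then obtain B where B: "\<forall>x\<in>(\<lambda>s. y s \<omega>) ` {0..T}. norm x \<le> B"
      using compact_imp_bounded bounded_iff by blast
    obtain m :: nat where m: "B \<le> real m" using real_arch_simple by blast
    have "truncation Y (real (Suc m)) T \<omega> = y T \<omega>"
    proof (rule truncation_eq[where y = "\<lambda>s. y s \<omega>" and Y = Y and \<omega> = \<omega>, OF c T eq])
      show "\<forall>q\<in>\<rat> \<inter> {0..T}. norm (Y q \<omega>) \<le> real (Suc m)"
      proof
        fix q assume q: "q \<in> \<rat> \<inter> {0..T}"
        then have "norm (y q \<omega>) \<le> B" using B by auto
        then show "norm (Y q \<omega>) \<le> real (Suc m)" using eq q m by auto
      qed
    qed (use elim T in auto)
    then show ?case using elim by simp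
  qed
qed

end

section \<open>Variation of constants\<close>

lemma continuous_on_ray:
  fixes f :: "real \<Rightarrow> 'e::metric_space"
  assumes "\<And>T. continuous_on {0..T} f"
  shows "continuous_on {0..} f"
  unfolding continuous_on_iff
proof (intro ballI allI impI)
  fix x e :: real assume x: "x \<in> {0..}" and e: "0 < e"
  have "x \<in> {0..x + 1}" using x by simp
  then obtain d where d: "d > 0" "\<And>x'. x' \<in> {0..x + 1} \<Longrightarrow> dist x' x < d \<Longrightarrow> dist (f x') (f x) < e"
    using assms[of "x + 1"] e unfolding continuous_on_iff by blast
  show "\<exists>d>0. \<forall>x'\<in>{0..}. dist x' x < d \<longrightarrow> dist (f x') (f x) < e"
    by (rule exI[of _ "min d 1"]) (use d in \<open>auto simp: dist_real_def\<close>)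
qed

lemma sum_integral_partition:
  fixes f :: "real \<Rightarrow> 'e::banach"
  assumes f: "continuous_on {0..t} f" and p: "is_partition t n p"
  shows "(\<Sum>i<n. integral {p i..p (Suc i)} f) = integral {0..t} f"
proof -
  have mono: "p i \<le> p j" if "i \<le> j" "j \<le> n" for i j
    using that
  proof (induction j rule: dec_induct)
    case (step k)
    then have "p i \<le> p k" "p k \<le> p (Suc k)" using p by (auto simp: is_partition_def)
    then show ?case by simp
  qed simp
  have "(\<Sum>i<k. integral {p i..p (Suc i)} f) = integral {0..p k} f" if "k \<le> n" for k
    using that
  proof (induction k)
    case 0
    then show ?case using p by (simp add: is_partition_def)
  next
    case (Suc k)
    have le: "0 \<le> p k" "p k \<le> p (Suc k)" "p (Suc k) \<le> t"
      using Suc.prems mono[of 0 k] mono[of k "Suc k"] mono[of "Suc k" n] p by (auto simp: is_partition_def)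
    have "f integrable_on {0..p (Suc k)}"
      using le by (intro integrable_continuous_real continuous_on_subset[OF f]) auto
    with Henstock_Kurzweil_Integration.integral_combine[OF le(1,2)] Suc show ?case by simp
  qed
  from this[of n] p show ?thesis by (simp add: is_partition_def)
qed

lemma is_partition_grid: "0 \<le> t \<Longrightarrow> 0 < n \<Longrightarrow> is_partition t n (grid 0 t n)"
  by (auto simp: is_partition_def grid_mono)

lemma riemann_sum_tendsto:
  fixes f :: "real \<Rightarrow> 'e::banach"
  assumes f: "continuous_on {0..t} f" and t: "0 \<le> t"
  shows "(\<lambda>n. \<Sum>i<n. (t / n) *\<^sub>R f (grid 0 t n i)) \<longlonglongrightarrow> integral {0..t} f"
proof (rule LIMSEQ_I)
  fix r :: real assume r: "0 < r"
  define \<eta> where "\<eta> = r / (2 * (t + 1))"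
  have \<eta>: "\<eta> > 0" using r t by (simp add: \<eta>_def)
  have "uniformly_continuous_on {0..t} f" using f by (intro compact_uniformly_continuous) auto
  then obtain d where d: "d > 0"
    "\<And>s s'. s \<in> {0..t} \<Longrightarrow> s' \<in> {0..t} \<Longrightarrow> dist s' s < d \<Longrightarrow> dist (f s') (f s) < \<eta>"
    using \<eta> unfolding uniformly_continuous_on_def by metis
  have "(\<lambda>n. t / real n) \<longlonglongrightarrow> 0" by (rule lim_const_over_n)
  then have "\<forall>\<^sub>F n in sequentially. t / real n < d"
    using d(1) by (intro order_tendstoD) auto
  with eventually_gt_at_top[of 0]
  have "\<forall>\<^sub>F n in sequentially. norm ((\<Sum>i<n. (t / n) *\<^sub>R f (grid 0 t n i)) - integral {0..t} f) < r"
  proof eventually_elim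
    case (elim n)
    define T where "T = grid 0 t n"
    have cell: "norm ((t / n) *\<^sub>R f (T i) - integral {T i..T (Suc i)} f) \<le> \<eta> * (t / n)" if "i < n" for i
    proof -
      have T: "0 \<le> T i" "T i \<le> T (Suc i)" "T (Suc i) \<le> t" "T (Suc i) - T i = t / n"
        using t that grid_le[of 0 t "Suc i" n] by (auto simp: T_def grid_ge grid_mono grid_le grid_Suc)
      have c: "continuous_on {T i..T (Suc i)} f"
        using T by (intro continuous_on_subset[OF f]) auto
      have "(t / n) *\<^sub>R f (T i) - integral {T i..T (Suc i)} f = integral {T i..T (Suc i)} (\<lambda>s. f (T i) - f s)"
        using T c by (subst Henstock_Kurzweil_Integration.integral_diff) (auto intro: integrable_continuous_real)
      also have "norm \<dots> \<le> \<eta> * (T (Suc i) - T i)"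
      proof (rule integral_bound[OF T(2)])
        show "continuous_on {T i..T (Suc i)} (\<lambda>s. f (T i) - f s)" by (intro continuous_intros c)
        fix s assume "s \<in> {T i..T (Suc i)}"
        then show "norm (f (T i) - f s) \<le> \<eta>"
          using d(2)[of s "T i"] T elim by (auto simp: dist_norm)
      qed
      finally show ?thesis by (simp add: T(4))
    qed
    have "(\<Sum>i<n. (t / n) *\<^sub>R f (T i)) - integral {0..t} f
        = (\<Sum>i<n. (t / n) *\<^sub>R f (T i) - integral {T i..T (Suc i)} f)"
      using sum_integral_partition[OF f is_partition_grid[OF t, of n]] elim by (simp add: sum_subtractf T_def)
    also have "norm \<dots> \<le> (\<Sum>i<n. \<eta> * (t / n))"
      using cell by (intro sum_norm_le) auto
    also have "\<dots> = \<eta> * t" using elim by simp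
    also have "\<dots> < r" using r t by (simp add: \<eta>_def field_simps add_nonneg_pos)
    finally show ?case by (simp add: T_def)
  qed
  then show "\<exists>no. \<forall>n\<ge>no. norm ((\<Sum>i<n. (t / n) *\<^sub>R f (grid 0 t n i)) - integral {0..t} f) < r"
    by (simp add: eventually_sequentially)
qed

text \<open>
  The trapezoidal rule solves \<open>dw = i w d\<theta>\<close> by the Cayley transform
  \<open>(1 + i \<delta> / 2) / (1 - i \<delta> / 2)\<close>, which agrees with \<open>cis \<delta>\<close> to third order.
\<close>

lemma trapezoidal_step_error:
  fixes w0 w1 \<alpha> \<xi> :: complex and \<delta> :: real
  assumes \<xi>: "\<xi> = w1 - w0 - \<alpha> - (w0 + w1) / 2 * (\<i> * \<delta>)" and \<delta>: "\<bar>\<delta>\<bar> \<le> 1"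
  shows "norm (w1 - cis \<delta> * w0 - \<alpha> - \<xi>) \<le> norm w0 * \<bar>\<delta>\<bar> ^ 3 + norm \<alpha> * \<bar>\<delta>\<bar> / 2 + norm \<xi> * \<bar>\<delta>\<bar> / 2"
proof -
  \<comment> \<open>The denominator of the Cayley transform. Its modulus is at least 1, so the error
    may be multiplied by \<open>q\<close>, which makes it explicit.\<close>
  define q where "q = 1 - \<i> * \<delta> / 2"
  define R where "R = cis \<delta> - (1 + \<i> * \<delta> - \<delta>\<^sup>2 / 2)"
  have q1: "1 \<le> norm q"
    using complex_Re_le_cmod[of q] by (simp add: q_def)
  have q2: "norm q \<le> 3 / 2"
    using norm_triangle_ineq4[of 1 "\<i> * \<delta> / 2"] \<delta> by (simp add: q_def norm_mult norm_divide)
  have "norm R \<le> \<bar>\<delta>\<bar> ^ 3 / 6"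
    using iexp_approx1[of \<delta> 2]
    by (simp add: R_def cis_conv_exp eval_nat_numeral power_mult_distrib diff_diff_eq algebra_simps)
  \<comment> \<open>Multiplying \<open>q\<close> by the quadratic Taylor polynomial of
    \<open>cis \<delta>\<close> gives the numerator up to the single cubic term.\<close>
  moreover have "(1 + \<i> * \<delta> / 2) - q * cis \<delta> = - (\<i> * \<delta> ^ 3 / 4) - q * R"
    unfolding R_def q_def by (simp add: field_simps power2_eq_square power3_eq_cube)
  then have "norm ((1 + \<i> * \<delta> / 2) - q * cis \<delta>) \<le> \<bar>\<delta>\<bar> ^ 3 / 4 + norm q * norm R"
    using norm_triangle_ineq4[of "- (\<i> * \<delta> ^ 3 / 4)" "q * R"]
    by (simp add: norm_mult norm_divide norm_power)
  moreover have "norm q * norm R \<le> 3 / 2 * (\<bar>\<delta>\<bar> ^ 3 / 6)"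
    using q2 \<open>norm R \<le> \<bar>\<delta>\<bar> ^ 3 / 6\<close> by (intro mult_mono) auto
  ultimately have c: "norm ((1 + \<i> * \<delta> / 2) - q * cis \<delta>) \<le> \<bar>\<delta>\<bar> ^ 3"
    using zero_le_power_abs[of \<delta> 3] by linarith
  have "q * (w1 - cis \<delta> * w0 - \<alpha> - \<xi>)
      = w0 * ((1 + \<i> * \<delta> / 2) - q * cis \<delta>) + \<alpha> * (\<i> * \<delta> / 2) + \<xi> * (\<i> * \<delta> / 2)"
    unfolding q_def \<xi> by (simp add: field_simps)
  then have "norm q * norm (w1 - cis \<delta> * w0 - \<alpha> - \<xi>)
      = norm (w0 * ((1 + \<i> * \<delta> / 2) - q * cis \<delta>) + \<alpha> * (\<i> * \<delta> / 2) + \<xi> * (\<i> * \<delta> / 2))"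
    by (metis norm_mult)
  also have "\<dots> \<le> norm (w0 * ((1 + \<i> * \<delta> / 2) - q * cis \<delta>)) + norm (\<alpha> * (\<i> * \<delta> / 2)) + norm (\<xi> * (\<i> * \<delta> / 2))"
    by (intro order_trans[OF norm_triangle_ineq] add_mono norm_triangle_ineq) auto
  also have "\<dots> \<le> norm w0 * \<bar>\<delta>\<bar> ^ 3 + norm \<alpha> * \<bar>\<delta>\<bar> / 2 + norm \<xi> * \<bar>\<delta>\<bar> / 2"
    using mult_left_mono[OF c, of "norm w0"] by (simp add: norm_mult norm_divide)
  finally have "norm q * norm (w1 - cis \<delta> * w0 - \<alpha> - \<xi>)
      \<le> norm w0 * \<bar>\<delta>\<bar> ^ 3 + norm \<alpha> * \<bar>\<delta>\<bar> / 2 + norm \<xi> * \<bar>\<delta>\<bar> / 2" .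
  moreover have "1 * norm (w1 - cis \<delta> * w0 - \<alpha> - \<xi>) \<le> norm q * norm (w1 - cis \<delta> * w0 - \<alpha> - \<xi>)"
    using q1 by (intro mult_right_mono) auto
  ultimately show ?thesis by simp
qed

text \<open>The residual of one trapezoidal step for dw = a dt + i w d\<theta>.\<close>

definition trapezoidal_germ ::
  "(real \<Rightarrow> complex) \<Rightarrow> (real \<Rightarrow> complex) \<Rightarrow> (real \<Rightarrow> real) \<Rightarrow> real \<Rightarrow> real \<Rightarrow> complex" where
  "trapezoidal_germ w a \<theta> s t =
     w t - w s - integral {s..t} a - (w s + w t) / 2 * (\<i> * complex_of_real (\<theta> t - \<theta> s))"

text \<open>The difference \<open>y\<close> between \<open>w\<close> and the variation of constants
  formula almost satisfies the drift-free recursion: on each cell it is rotated exactly, up to the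
  residual and smaller terms. The residuals enter once through their plain sum, bounded by \<kappa>,
  and once multiplied by increments of \<theta>, where their sum of squares is required.\<close>

lemma discretization_error:
  fixes w a :: "real \<Rightarrow> complex" and \<theta> :: "real \<Rightarrow> real"
  assumes t: "0 < t" and n: "0 < n"
    and a: "continuous_on {0..t} a" and \<theta>: "continuous_on {0..t} \<theta>"
    and wK: "\<And>s. s \<in> {0..t} \<Longrightarrow> norm (w s) \<le> K" and aK: "\<And>s. s \<in> {0..t} \<Longrightarrow> norm (a s) \<le> K"
    and mod: "\<And>s s'. s \<in> {0..t} \<Longrightarrow> s' \<in> {0..t} \<Longrightarrow> \<bar>s - s'\<bar> \<le> t / n \<Longrightarrow> \<bar>\<theta> s - \<theta> s'\<bar> \<le> \<eta>"
    and \<eta>: "\<eta> \<le> 1" and \<kappa>: "\<kappa> > 0"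
    and V: "(\<Sum>i<n. (\<theta> (grid 0 t n (Suc i)) - \<theta> (grid 0 t n i))\<^sup>2) \<le> V"
    and sum: "norm (\<Sum>i<n. trapezoidal_germ w a \<theta> (grid 0 t n i) (grid 0 t n (Suc i))) \<le> \<kappa>"
    and sq: "(\<Sum>i<n. (norm (trapezoidal_germ w a \<theta> (grid 0 t n i) (grid 0 t n (Suc i))))\<^sup>2) \<le> \<kappa>\<^sup>2"
    and y: "\<And>s. y s = w s - cis (\<theta> s) * (c + integral {0..s} (\<lambda>u. cis (- \<theta> u) * a u))"
    and y0: "y 0 = 0"
  shows "norm (y t - (\<Sum>i<n. y (grid 0 t n i) * (cis (\<theta> (grid 0 t n (Suc i)) - \<theta> (grid 0 t n i)) - 1)))
    \<le> \<kappa> * (1 + (V + 1) / 4) + \<eta> * (K * V + 2 * K * t)"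
proof -
  define T where "T = grid 0 t n"
  define \<delta> where "\<delta> i = \<theta> (T (Suc i)) - \<theta> (T i)" for i
  define \<xi> where "\<xi> i = trapezoidal_germ w a \<theta> (T i) (T (Suc i))" for i
  define \<alpha> where "\<alpha> i = integral {T i..T (Suc i)} a" for i
  define h where "h = t / n"
  have K: "K \<ge> 0" using order_trans[OF norm_ge_zero wK[of 0]] t by simp
  have h: "h > 0" using t n by (simp add: h_def)
  have T: "T i \<in> {0..t}" "T (Suc i) \<in> {0..t}" "T i \<le> T (Suc i)" "T (Suc i) - T i = h" if "i < n" for i
  proof -
    show "T i \<in> {0..t}" "T (Suc i) \<in> {0..t}"
      using t that unfolding T_def by (simp_all add: grid_ge grid_le)
    show "T i \<le> T (Suc i)" using t unfolding T_def by (intro grid_mono) auto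
    show "T (Suc i) - T i = h" by (simp add: T_def h_def grid_Suc)
  qed
  have eta0: "\<eta> \<ge> 0" using mod[of 0 0] t by simp
  have ci: "continuous_on {0..t} (\<lambda>u. cis (- \<theta> u) * a u)"
    by (intro continuous_intros a \<theta>)
  have \<delta>\<eta>: "\<bar>\<delta> i\<bar> \<le> \<eta>" if "i < n" for i
    unfolding \<delta>_def using T[OF that] h by (intro mod) (auto simp: h_def)
  \<comment> \<open>Apart from the residual, the terms come from the Cayley transform against the
    rotation (K \<eta> times the squared increment), from the half step of the drift (K h \<eta> /
    2) and from freezing the rotation within the cell (\<eta> K h).\<close>
  have cell: "norm (y (T (Suc i)) - cis (\<delta> i) * y (T i) - \<xi> i)
      \<le> K * \<eta> * (\<delta> i)\<^sup>2 + K * h * \<eta> / 2 + norm (\<xi> i) * \<bar>\<delta> i\<bar> / 2 + \<eta> * K * h" if i: "i < n" for i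
  proof -
    note Ti = T[OF i]
    define I where "I = integral {T i..T (Suc i)} (\<lambda>u. cis (- \<theta> u) * a u)"
    have sub: "{T i..T (Suc i)} \<subseteq> {0..t}" using Ti by auto
    note asub = continuous_on_subset[OF a sub] and csub = continuous_on_subset[OF ci sub]
    have "integral {0..T (Suc i)} (\<lambda>u. cis (- \<theta> u) * a u) = integral {0..T i} (\<lambda>u. cis (- \<theta> u) * a u) + I"
      unfolding I_def using Ti
      by (intro Henstock_Kurzweil_Integration.integral_combine[symmetric] integrable_continuous_real
          continuous_on_subset[OF ci]) auto
    moreover have "cis (\<theta> (T (Suc i))) = cis (\<delta> i) * cis (\<theta> (T i))"
      by (simp add: \<delta>_def cis_mult)
    ultimately have "y (T (Suc i)) - cis (\<delta> i) * y (T i) = w (T (Suc i)) - cis (\<delta> i) * w (T i) - cis (\<theta> (T (Suc i))) * I"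
      unfolding y by (simp add: algebra_simps)
    then have split: "y (T (Suc i)) - cis (\<delta> i) * y (T i) - \<xi> i
        = (w (T (Suc i)) - cis (\<delta> i) * w (T i) - \<alpha> i - \<xi> i) + (\<alpha> i - cis (\<theta> (T (Suc i))) * I)"
      by simp
    have "norm (w (T (Suc i)) - cis (\<delta> i) * w (T i) - \<alpha> i - \<xi> i)
        \<le> norm (w (T i)) * \<bar>\<delta> i\<bar> ^ 3 + norm (\<alpha> i) * \<bar>\<delta> i\<bar> / 2 + norm (\<xi> i) * \<bar>\<delta> i\<bar> / 2"
      using \<delta>\<eta>[OF i] \<eta>
      by (intro trapezoidal_step_error) (auto simp: \<xi>_def \<alpha>_def \<delta>_def trapezoidal_germ_def)
    also have "\<dots> \<le> K * (\<eta> * (\<delta> i)\<^sup>2) + (K * h) * \<eta> / 2 + norm (\<xi> i) * \<bar>\<delta> i\<bar> / 2"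
    proof (intro add_mono mult_mono divide_right_mono order_refl)
      show "norm (w (T i)) \<le> K" using wK Ti by auto
      show "\<bar>\<delta> i\<bar> ^ 3 \<le> \<eta> * (\<delta> i)\<^sup>2"
        using mult_right_mono[OF \<delta>\<eta>[OF i], of "(\<delta> i)\<^sup>2"] by (simp add: power3_eq_cube power2_eq_square)
      have "norm (\<alpha> i) \<le> K * (T (Suc i) - T i)"
        unfolding \<alpha>_def using sub aK by (intro integral_bound continuous_on_subset[OF a] Ti) auto
      then show "norm (\<alpha> i) \<le> K * h" by (simp add: Ti)
      show "\<bar>\<delta> i\<bar> \<le> \<eta>" by (rule \<delta>\<eta>[OF i])
    qed (use K h in auto)
    finally have 1: "norm (w (T (Suc i)) - cis (\<delta> i) * w (T i) - \<alpha> i - \<xi> i)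
        \<le> K * (\<eta> * (\<delta> i)\<^sup>2) + (K * h) * \<eta> / 2 + norm (\<xi> i) * \<bar>\<delta> i\<bar> / 2" .
    have "\<alpha> i - cis (\<theta> (T (Suc i))) * I
        = integral {T i..T (Suc i)} (\<lambda>u. a u - cis (\<theta> (T (Suc i))) * (cis (- \<theta> u) * a u))"
      unfolding \<alpha>_def I_def
      by (simp add: Henstock_Kurzweil_Integration.integral_diff integrable_continuous_real asub csub
          integrable_on_mult_right)
    also have "norm \<dots> \<le> (\<eta> * K) * (T (Suc i) - T i)"
    proof (rule integral_bound[OF Ti(3)])
      show "continuous_on {T i..T (Suc i)} (\<lambda>u. a u - cis (\<theta> (T (Suc i))) * (cis (- \<theta> u) * a u))"
        by (intro continuous_intros asub csub)
      fix u assume u: "u \<in> {T i..T (Suc i)}"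
      have "a u - cis (\<theta> (T (Suc i))) * (cis (- \<theta> u) * a u) = - ((cis (\<theta> (T (Suc i)) - \<theta> u) - 1) * a u)"
        by (simp add: mult.assoc[symmetric] cis_mult) (simp add: left_diff_distrib)
      then have "norm (a u - cis (\<theta> (T (Suc i))) * (cis (- \<theta> u) * a u))
          = norm (cis (\<theta> (T (Suc i)) - \<theta> u) - 1) * norm (a u)"
        by (simp add: norm_mult)
      also have "\<dots> \<le> \<eta> * K"
      proof (intro mult_mono order_trans[OF norm_cis_minus_1_le])
        show "\<bar>\<theta> (T (Suc i)) - \<theta> u\<bar> \<le> \<eta>"
          using u Ti sub by (intro mod) (auto simp: h_def)
        show "norm (a u) \<le> K" using aK u sub by auto
      qed (use eta0 in auto)
      finally show "norm (a u - cis (\<theta> (T (Suc i))) * (cis (- \<theta> u) * a u)) \<le> \<eta> * K" .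
    qed
    finally have 2: "norm (\<alpha> i - cis (\<theta> (T (Suc i))) * I) \<le> \<eta> * K * h" by (simp add: Ti)
    have "norm (y (T (Suc i)) - cis (\<delta> i) * y (T i) - \<xi> i)
        \<le> norm (w (T (Suc i)) - cis (\<delta> i) * w (T i) - \<alpha> i - \<xi> i)
          + norm (\<alpha> i - cis (\<theta> (T (Suc i))) * I)"
      unfolding split by (rule norm_triangle_ineq)
    from order_trans[OF this add_mono[OF 1 2]] show ?thesis by (simp add: mult.assoc)
  qed
  have "y (T n) - y (T 0) = (\<Sum>i<n. y (T (Suc i)) - y (T i))"
    by (rule sum_lessThan_telescope[symmetric])
  then have "y t = (\<Sum>i<n. y (T (Suc i)) - y (T i))"
    using n y0 by (simp add: T_def)
  then have "y t - (\<Sum>i<n. y (T i) * (cis (\<delta> i) - 1)) = (\<Sum>i<n. y (T (Suc i)) - cis (\<delta> i) * y (T i))"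
    by (simp add: sum_subtractf[symmetric] algebra_simps)
  also have "\<dots> = (\<Sum>i<n. \<xi> i) + (\<Sum>i<n. y (T (Suc i)) - cis (\<delta> i) * y (T i) - \<xi> i)"
    by (simp add: sum_subtractf)
  also have "norm \<dots> \<le> norm (\<Sum>i<n. \<xi> i) + norm (\<Sum>i<n. y (T (Suc i)) - cis (\<delta> i) * y (T i) - \<xi> i)"
    by (rule norm_triangle_ineq)
  also have "\<dots> \<le> \<kappa> + (\<Sum>i<n. K * \<eta> * (\<delta> i)\<^sup>2 + K * h * \<eta> / 2 + norm (\<xi> i) * \<bar>\<delta> i\<bar> / 2 + \<eta> * K * h)"
    using sum cell unfolding \<xi>_def T_def[symmetric] by (intro add_mono sum_norm_le) auto
  also have "\<dots> \<le> \<kappa> + (\<Sum>i<n. K * \<eta> * (\<delta> i)\<^sup>2 + K * h * \<eta> / 2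
      + (\<kappa> * (\<delta> i)\<^sup>2 + (norm (\<xi> i))\<^sup>2 / \<kappa>) / 4 + \<eta> * K * h)"
  proof (intro add_mono sum_mono order_refl)
    fix i
    \<comment> \<open>Arithmetic-geometric mean inequality with weight \<kappa>: after summation the
      two parts are at most \<kappa> V / 4 and \<kappa>^2 / (4 \<kappa>), both of order
      \<kappa>.\<close>
    have "0 \<le> (\<kappa> * \<bar>\<delta> i\<bar> - norm (\<xi> i))\<^sup>2 / \<kappa>" using \<kappa> by simp
    also have "\<dots> = \<kappa> * (\<delta> i)\<^sup>2 + (norm (\<xi> i))\<^sup>2 / \<kappa> - 2 * (norm (\<xi> i) * \<bar>\<delta> i\<bar>)"
      using \<kappa> by (simp add: power2_diff power_mult_distrib field_simps) (simp add: power2_eq_square field_simps)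
    finally show "norm (\<xi> i) * \<bar>\<delta> i\<bar> / 2 \<le> (\<kappa> * (\<delta> i)\<^sup>2 + (norm (\<xi> i))\<^sup>2 / \<kappa>) / 4"
      by (simp add: mult.commute[of "norm (\<xi> i)"])
  qed
  also have "\<dots> = \<kappa> + (K * \<eta> + \<kappa> / 4) * (\<Sum>i<n. (\<delta> i)\<^sup>2) + (\<Sum>i<n. (norm (\<xi> i))\<^sup>2) / (4 * \<kappa>)
      + (3 / 2) * (\<eta> * K * t)"
    using n by (simp add: sum.distrib h_def sum_distrib_left[symmetric] sum_divide_distrib[symmetric] add_divide_distrib algebra_simps)
  also have "\<dots> \<le> \<kappa> + (K * \<eta> + \<kappa> / 4) * V + \<kappa>\<^sup>2 / (4 * \<kappa>) + 2 * (\<eta> * K * t)"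
    using V sq K eta0 \<kappa> t unfolding \<delta>_def \<xi>_def T_def
    by (intro add_mono mult_left_mono divide_right_mono mult_right_mono order_refl) auto
  also have "\<dots> = \<kappa> * (1 + (V + 1) / 4) + \<eta> * (K * V + 2 * K * t)"
    using \<kappa> by (simp add: field_simps power2_eq_square)
  finally show ?thesis unfolding \<delta>_def T_def .
qed

section \<open>Solution of the rotation equation\<close>

context brownian_space
begin

text \<open>Left Riemann sums on [0, t] only use times up to t, so their limit is measurable for
  \<open>F t\<close>. It equals the integral only on the almost sure event where the path is
  continuous.\<close>

lemma adapted_integral:
  fixes f :: "real \<Rightarrow> 'w \<Rightarrow> complex"
  assumes f: "\<And>s. 0 \<le> s \<Longrightarrow> f s \<in> borel_measurable (F s)"
    and c: "AE \<omega> in P. continuous_on {0..} (\<lambda>s. f s \<omega>)" and t: "0 \<le> t"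
  shows "\<exists>A\<in>borel_measurable (F t). AE \<omega> in P. integral {0..t} (\<lambda>s. f s \<omega>) = A \<omega>"
proof
  define R where "R n \<omega> = (\<Sum>i<n. (t / n) *\<^sub>R f (grid 0 t n i) \<omega>)" for n \<omega>
  have "R n \<in> borel_measurable (F t)" for n
    unfolding R_def[abs_def]
  proof (intro borel_measurable_sum borel_measurable_scaleR borel_measurable_const)
    fix i assume "i \<in> {..<n}"
    then show "f (grid 0 t n i) \<in> borel_measurable (F t)"
      using t by (intro F_mono[OF f]) (auto simp: grid_ge grid_le)
  qed
  then show "(\<lambda>\<omega>. lim (\<lambda>n. R n \<omega>)) \<in> borel_measurable (F t)"
    by (rule borel_measurable_lim_metric)
  show "AE \<omega> in P. integral {0..t} (\<lambda>s. f s \<omega>) = lim (\<lambda>n. R n \<omega>)"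
    using c
  proof eventually_elim
    case (elim \<omega>)
    have "continuous_on {0..t} (\<lambda>s. f s \<omega>)" by (rule continuous_on_subset[OF elim]) auto
    from riemann_sum_tendsto[OF this t] show ?case
      unfolding R_def by (rule limI[symmetric])
  qed
qed

text \<open>The pathwise estimate \<open>discretization_error\<close> applies outside six small
  events and yields the recursion that \<open>linear_equation_unique\<close> needs for the
  difference \<open>y\<close>.\<close>

lemma rotation_equation_solution:
  fixes w a :: "real \<Rightarrow> 'w \<Rightarrow> complex"
  assumes wm: "\<And>s. 0 \<le> s \<Longrightarrow> w s \<in> borel_measurable (F s)"
    and wc: "AE \<omega> in P. continuous_on {0..} (\<lambda>s. w s \<omega>)"
    and am: "\<And>s. 0 \<le> s \<Longrightarrow> a s \<in> borel_measurable (F s)"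
    and ac: "AE \<omega> in P. continuous_on {0..} (\<lambda>s. a s \<omega>)"
    and w0: "AE \<omega> in P. w 0 \<omega> = c"
    and germ: "null_germ (\<lambda>s t \<omega>. trapezoidal_germ (\<lambda>u. w u \<omega>) (\<lambda>u. a u \<omega>) (\<lambda>u. \<beta> * W u \<omega>) s t)"
  shows "AE \<omega> in P. \<forall>t\<ge>0. w t \<omega>
    = cis (\<beta> * W t \<omega>) * (c + integral {0..t} (\<lambda>u. cis (- (\<beta> * W u \<omega>)) * a u \<omega>))"
proof -
  let ?\<theta> = "\<lambda>u \<omega>. \<beta> * W u \<omega>"
  let ?f = "\<lambda>u \<omega>. cis (- ?\<theta> u \<omega>) * a u \<omega>"
  let ?\<xi> = "\<lambda>t n i \<omega>. trapezoidal_germ (\<lambda>u. w u \<omega>) (\<lambda>u. a u \<omega>) (\<lambda>u. \<beta> * W u \<omega>) (grid 0 t n i) (grid 0 t n (Suc i))"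
  define y where "y t \<omega> = w t \<omega> - cis (?\<theta> t \<omega>) * (c + integral {0..t} (\<lambda>u. ?f u \<omega>))" for t \<omega>
  have \<theta>m: "(\<lambda>\<omega>. ?\<theta> s \<omega>) \<in> borel_measurable (F s)" if "0 \<le> s" for s
    using W_adapted[OF that] by measurable
  have \<theta>c: "AE \<omega> in P. continuous_on {0..} (\<lambda>s. ?\<theta> s \<omega>)"
    using W_continuous by eventually_elim (intro continuous_intros)
  have wP: "w s \<in> borel_measurable P" and aP: "a s \<in> borel_measurable P"
    and \<theta>P: "(\<lambda>\<omega>. ?\<theta> s \<omega>) \<in> borel_measurable P" if "0 \<le> s" for s
    using F_measurable wm[OF that] am[OF that] \<theta>m[OF that] by auto
  have fm: "?f s \<in> borel_measurable (F s)" if "0 \<le> s" for s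
    using \<theta>m[OF that] am[OF that] unfolding cis_conv_exp by measurable
  have fc: "AE \<omega> in P. continuous_on {0..} (\<lambda>s. ?f s \<omega>)"
    using W_continuous ac by eventually_elim (intro continuous_intros)
  have yc: "AE \<omega> in P. continuous_on {0..} (\<lambda>t. y t \<omega>)"
    using wc W_continuous fc
  proof eventually_elim
    case (elim \<omega>)
    have "continuous_on {0..} (\<lambda>t. integral {0..t} (\<lambda>u. ?f u \<omega>))"
      by (intro continuous_on_ray indefinite_integral_continuous_1 integrable_continuous_real
          continuous_on_subset[OF elim(3)]) auto
    with elim(1,2) show ?case unfolding y_def by (intro continuous_intros)
  qed
  have y0: "AE \<omega> in P. y 0 \<omega> = 0"
    using w0 W_0 by eventually_elim (simp add: y_def)
  have "\<exists>Y. \<forall>t\<ge>0. Y t \<in> borel_measurable (F t) \<and> (AE \<omega> in P. y t \<omega> = Y t \<omega>)"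
  proof -
    have "\<exists>Y. 0 \<le> t \<longrightarrow> Y \<in> borel_measurable (F t) \<and> (AE \<omega> in P. y t \<omega> = Y \<omega>)" for t
    proof (cases "0 \<le> t")
      case True
      obtain A where A[measurable]: "A \<in> borel_measurable (F t)"
        and eq: "AE \<omega> in P. integral {0..t} (\<lambda>u. ?f u \<omega>) = A \<omega>"
        using adapted_integral[OF fm fc True] by blast
      note [measurable] = wm[OF True] \<theta>m[OF True]
      have "(\<lambda>\<omega>. w t \<omega> - cis (?\<theta> t \<omega>) * (c + A \<omega>)) \<in> borel_measurable (F t)"
        unfolding cis_conv_exp by measurable
      moreover have "AE \<omega> in P. y t \<omega> = w t \<omega> - cis (?\<theta> t \<omega>) * (c + A \<omega>)"
        using eq by eventually_elim (simp add: y_def)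
      ultimately show ?thesis by blast
    qed simp
    then show ?thesis by metis
  qed
  then obtain Y where Y: "\<And>t. 0 \<le> t \<Longrightarrow> Y t \<in> borel_measurable (F t)"
    "\<And>t. 0 \<le> t \<Longrightarrow> AE \<omega> in P. y t \<omega> = Y t \<omega>"
    by blast
  have diag: "trapezoidal_germ (\<lambda>u. w u \<omega>) (\<lambda>u. a u \<omega>) (\<lambda>u. \<beta> * W u \<omega>) s s = 0" for s \<omega>
    by (simp add: trapezoidal_germ_def)
  have step: "\<exists>n>0. likely \<epsilon> (\<lambda>\<omega>. norm (y t \<omega> -
      (\<Sum>i<n. y (grid 0 t n i) \<omega> * (cis (\<beta> * (W (grid 0 t n (Suc i)) \<omega> - W (grid 0 t n i) \<omega>)) - 1))) \<le> \<epsilon>)"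
    if t: "0 < t" and \<epsilon>: "0 < \<epsilon>" for t \<epsilon>
  proof -
    \<comment> \<open>Six exceptional events: bounds on \<open>w\<close> and on \<open>a\<close>,
      the modulus of continuity, the sum of the residuals, the sum of their squares, and the
      quadratic variation.\<close>
    define e where "e = \<epsilon> / 6"
    have e: "e > 0" using \<epsilon> by (simp add: e_def)
    obtain K1 where K1: "K1 > 0" "likely e (\<lambda>\<omega>. \<forall>s\<in>{0..t}. norm (w s \<omega>) \<le> K1)"
      using likely_bounded[where X = w, OF wP wc t e] by blast
    obtain K2 where K2: "K2 > 0" "likely e (\<lambda>\<omega>. \<forall>s\<in>{0..t}. norm (a s \<omega>) \<le> K2)"
      using likely_bounded[where X = a, OF aP ac t e] by blast
    define K where "K = max K1 K2"
    define V where "V = \<beta>\<^sup>2 * (t / e)"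
    have K: "K > 0" and V: "V \<ge> 0" using K1 t e by (auto simp: K_def V_def)
    \<comment> \<open>With these choices the two summands in the bound of
      \<open>discretization_error\<close> are at most \<epsilon> / 2 each. The constraints on
      \<kappa> also keep \<kappa> and \<kappa>^2, used as probabilities, below e.\<close>
    define \<eta> where "\<eta> = min 1 (\<epsilon> / 2 / (K * V + 2 * K * t))"
    define \<kappa> where "\<kappa> = min (min e 1) (\<epsilon> / 2 / (1 + (V + 1) / 4))"
    have d1: "K * V + 2 * K * t > 0" and d2: "1 + (V + 1) / 4 > 0"
      using K V t by (auto intro!: add_nonneg_pos)
    have \<eta>: "\<eta> > 0" "\<eta> \<le> 1" and "\<eta> \<le> \<epsilon> / 2 / (K * V + 2 * K * t)"
      using \<epsilon> d1 by (auto simp: \<eta>_def)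
    then have \<eta>3: "\<eta> * (K * V + 2 * K * t) \<le> \<epsilon> / 2" using d1 by (simp only: pos_le_divide_eq)
    have \<kappa>: "\<kappa> > 0" "\<kappa> \<le> e" "\<kappa> \<le> 1" and "\<kappa> \<le> \<epsilon> / 2 / (1 + (V + 1) / 4)"
      using \<epsilon> e divide_pos_pos[OF _ d2, of "\<epsilon> / 2"] unfolding \<kappa>_def by auto
    then have \<kappa>3: "\<kappa> * (1 + (V + 1) / 4) \<le> \<epsilon> / 2" using d2 by (simp only: pos_le_divide_eq)
    have \<kappa>sq: "\<kappa>\<^sup>2 > 0" "\<kappa>\<^sup>2 \<le> e"
      using \<kappa> by (auto simp: power2_eq_square intro: order_trans[OF mult_left_le])
    obtain \<delta> where \<delta>: "\<delta> > 0"
      "likely e (\<lambda>\<omega>. \<forall>s\<in>{0..t}. \<forall>s'\<in>{0..t}. \<bar>s - s'\<bar> < \<delta> \<longrightarrow> \<bar>?\<theta> s \<omega> - ?\<theta> s' \<omega>\<bar> \<le> \<eta>)"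
      using likely_modulus[where X = ?\<theta>, OF \<theta>P \<theta>c t e \<eta>(1)] by blast
    have "\<forall>\<^sub>F n in sequentially. t / real n < \<delta>"
      using \<delta>(1) by (intro order_tendstoD[OF lim_const_over_n]) auto
    then have "\<forall>\<^sub>F n in sequentially. 0 < n \<and> t / real n < \<delta> \<and>
        likely \<kappa> (\<lambda>\<omega>. norm (\<Sum>i<n. ?\<xi> t n i \<omega>) \<le> \<kappa>) \<and>
        likely (\<kappa>\<^sup>2) (\<lambda>\<omega>. (\<Sum>i<n. (norm (?\<xi> t n i \<omega>))\<^sup>2) \<le> \<kappa>\<^sup>2)"
      using t null_germ_grid[OF germ order_refl less_imp_le[OF t] \<kappa>(1)]
        null_germ_sum_squares[OF germ diag less_imp_le[OF t] \<kappa>sq(1)]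
      by (intro eventually_conj eventually_gt_at_top) auto
    from eventually_happens'[OF sequentially_bot this] obtain n where n: "0 < n" "t / real n < \<delta>"
      and g1: "likely \<kappa> (\<lambda>\<omega>. norm (\<Sum>i<n. ?\<xi> t n i \<omega>) \<le> \<kappa>)"
      and g2: "likely (\<kappa>\<^sup>2) (\<lambda>\<omega>. (\<Sum>i<n. (norm (?\<xi> t n i \<omega>))\<^sup>2) \<le> \<kappa>\<^sup>2)"
      by blast
    note qv = likely_quadratic_variation[OF t e n(1)]
    note all = likely_conj[OF K1(2) likely_conj[OF K2(2) likely_conj[OF \<delta>(2) likely_conj[OF g1 likely_conj[OF g2 qv]]]]]
    have "likely \<epsilon> (\<lambda>\<omega>. norm (y t \<omega> -
      (\<Sum>i<n. y (grid 0 t n i) \<omega> * (cis (\<beta> * (W (grid 0 t n (Suc i)) \<omega> - W (grid 0 t n i) \<omega>)) - 1))) \<le> \<epsilon>)"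
    proof (rule likely_mono_AE[OF all])
      show "e + (e + (e + (\<kappa> + (\<kappa>\<^sup>2 + e)))) \<le> \<epsilon>" using \<kappa>(2) \<kappa>sq(2) by (simp add: e_def)
    next
      show "AE \<omega> in P. (\<forall>s\<in>{0..t}. norm (w s \<omega>) \<le> K1) \<and> (\<forall>s\<in>{0..t}. norm (a s \<omega>) \<le> K2) \<and>
          (\<forall>s\<in>{0..t}. \<forall>s'\<in>{0..t}. \<bar>s - s'\<bar> < \<delta> \<longrightarrow> \<bar>?\<theta> s \<omega> - ?\<theta> s' \<omega>\<bar> \<le> \<eta>) \<and>
          norm (\<Sum>i<n. ?\<xi> t n i \<omega>) \<le> \<kappa> \<and> (\<Sum>i<n. (norm (?\<xi> t n i \<omega>))\<^sup>2) \<le> \<kappa>\<^sup>2 \<and>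
          (\<Sum>i<n. (W (grid 0 t n (Suc i)) \<omega> - W (grid 0 t n i) \<omega>)\<^sup>2) \<le> t / e \<longrightarrow>
          norm (y t \<omega> - (\<Sum>i<n. y (grid 0 t n i) \<omega> *
            (cis (\<beta> * (W (grid 0 t n (Suc i)) \<omega> - W (grid 0 t n i) \<omega>)) - 1))) \<le> \<epsilon>"
        using ac \<theta>c y0
      proof eventually_elim
        case (elim \<omega>)
        show ?case
        proof (intro impI, elim conjE)
          assume b1: "\<forall>s\<in>{0..t}. norm (w s \<omega>) \<le> K1" and b2: "\<forall>s\<in>{0..t}. norm (a s \<omega>) \<le> K2"
            and m: "\<forall>s\<in>{0..t}. \<forall>s'\<in>{0..t}. \<bar>s - s'\<bar> < \<delta> \<longrightarrow> \<bar>?\<theta> s \<omega> - ?\<theta> s' \<omega>\<bar> \<le> \<eta>"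
            and s1: "norm (\<Sum>i<n. ?\<xi> t n i \<omega>) \<le> \<kappa>" and s2: "(\<Sum>i<n. (norm (?\<xi> t n i \<omega>))\<^sup>2) \<le> \<kappa>\<^sup>2"
            and v: "(\<Sum>i<n. (W (grid 0 t n (Suc i)) \<omega> - W (grid 0 t n i) \<omega>)\<^sup>2) \<le> t / e"
          have "norm (y t \<omega> - (\<Sum>i<n. y (grid 0 t n i) \<omega> *
              (cis (?\<theta> (grid 0 t n (Suc i)) \<omega> - ?\<theta> (grid 0 t n i) \<omega>) - 1)))
              \<le> \<kappa> * (1 + (V + 1) / 4) + \<eta> * (K * V + 2 * K * t)"
          proof (rule discretization_error[where y = "\<lambda>s. y s \<omega>" and w = "\<lambda>s. w s \<omega>" and a = "\<lambda>s. a s \<omega>"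
                and \<theta> = "\<lambda>s. ?\<theta> s \<omega>" and c = c and K = K and V = V and n = n and t = t, OF t n(1) _ _ _ _ _ \<eta>(2) \<kappa>(1) _ s1 s2 _ elim(3)])
            show "continuous_on {0..t} (\<lambda>s. a s \<omega>)" "continuous_on {0..t} (\<lambda>s. ?\<theta> s \<omega>)"
              using elim(1,2) by (auto intro: continuous_on_subset)
            show "norm (w s \<omega>) \<le> K" "norm (a s \<omega>) \<le> K" if "s \<in> {0..t}" for s
              using b1 b2 that by (auto simp: K_def le_max_iff_disj)
            show "\<bar>?\<theta> s \<omega> - ?\<theta> s' \<omega>\<bar> \<le> \<eta>" if "s \<in> {0..t}" "s' \<in> {0..t}" "\<bar>s - s'\<bar> \<le> t / real n" for s s'
              using m that n(2) by auto
            have "(\<Sum>i<n. (?\<theta> (grid 0 t n (Suc i)) \<omega> - ?\<theta> (grid 0 t n i) \<omega>)\<^sup>2)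
                = \<beta>\<^sup>2 * (\<Sum>i<n. (W (grid 0 t n (Suc i)) \<omega> - W (grid 0 t n i) \<omega>)\<^sup>2)"
              by (simp add: sum_distrib_left power_mult_distrib[symmetric] right_diff_distrib)
            also have "\<dots> \<le> V" unfolding V_def using v by (intro mult_left_mono) auto
            finally show "(\<Sum>i<n. (?\<theta> (grid 0 t n (Suc i)) \<omega> - ?\<theta> (grid 0 t n i) \<omega>)\<^sup>2) \<le> V" .
            show "y s \<omega> = w s \<omega> - cis (?\<theta> s \<omega>) * (c + integral {0..s} (\<lambda>u. ?f u \<omega>))" for s
              by (rule y_def)
          qed
          also have "\<dots> \<le> \<epsilon>" using \<eta>3 \<kappa>3 by simp
          finally show "norm (y t \<omega> - (\<Sum>i<n. y (grid 0 t n i) \<omega> *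
              (cis (\<beta> * (W (grid 0 t n (Suc i)) \<omega> - W (grid 0 t n i) \<omega>)) - 1))) \<le> \<epsilon>"
            by (simp only: right_diff_distrib)
        qed
      qed
    qed
    with n(1) show ?thesis by blast
  qed
  have "AE \<omega> in P. y q \<omega> = 0" if "0 < q" for q
    by (rule linear_equation_unique[where y = y and Y = Y and \<beta> = \<beta>, OF Y(1) Y(2) yc y0 step that])
  moreover have "countable (\<rat> \<inter> {0::real<..})" using countable_rat by blast
  ultimately have "AE \<omega> in P. \<forall>q\<in>\<rat> \<inter> {0<..}. y q \<omega> = 0"
    by (subst AE_ball_countable) auto
  then have "AE \<omega> in P. \<forall>t\<ge>0. y t \<omega> = 0"
    using yc y0
  proof eventually_elim
    case (elim \<omega>)
    show ?case
    proof (intro allI impI)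
      fix t :: real assume t: "0 \<le> t"
      have "norm (y t \<omega> - 0) \<le> 0"
      \<comment> \<open>\<open>dense_bound\<close> asks for an interval of positive length, hence t
        + 1, since t may be 0; the open set merely has to contain the interval.\<close>
      proof (rule dense_bound[of "t + 1" "\<lambda>t. y t \<omega>" "{-1<..}"])
        show "continuous_on {0..t + 1} (\<lambda>t. y t \<omega>)" by (rule continuous_on_subset[OF elim(2)]) auto
        fix q assume "q \<in> \<rat>" "q \<in> {0..t + 1}"
        then have "q = 0 \<or> q \<in> \<rat> \<inter> {0<..}" by auto
        then show "norm (y q \<omega> - 0) \<le> 0" using elim(1,3) by auto
      qed (use t in auto)
      then show "y t \<omega> = 0" by simp
    qed
  qed
  then show ?thesis by eventually_elim (simp add: y_def)
qed

end

section \<open>The stochastic Lorenz system\<close>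

lemma has_derivative_vecI:
  fixes f :: "real^'m \<Rightarrow> real^'n"
  assumes "\<And>i. ((\<lambda>x. f x $ i) has_derivative (\<lambda>h. f' h $ i)) (at x)"
  shows "(f has_derivative f') (at x)"
  unfolding has_derivative_componentwise_within[of f]
  using assms by (auto simp: Basis_vec_def inner_axis)

lemma jacobian_mult_nth:
  fixes f :: "real^'n \<Rightarrow> real^'n"
  assumes "(f has_derivative f') (at x)"
  shows "(jacobian f (at x) ** V) $ i $ j = f' (\<chi> k. V $ k $ j) $ i"
proof -
  have "frechet_derivative f (at x) = f'"
    using frechet_derivative_at[OF assms] by simp
  moreover have "matrix f' *v (\<chi> k. V $ k $ j) = f' (\<chi> k. V $ k $ j)"
    using has_derivative_linear[OF assms] by (simp add: matrix_works linear_matrix_vector_mul_eq)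
  ultimately show ?thesis
    by (simp add: jacobian_def matrix_matrix_mult_def matrix_vector_mult_def vec_eq_iff)
qed

lemma has_derivative_nth [derivative_intros]: "((\<lambda>x. x $ i) has_derivative (\<lambda>h. h $ i)) F"
  by (rule bounded_linear_imp_has_derivative[OF bounded_linear_vec_nth])

lemma lorenz_drift_has_derivative:
  "(lorenz_drift \<sigma> r b has_derivative (\<lambda>h. vector
     [\<sigma> * (h $ 2 - h $ 1), r * h $ 1 - (x $ 1 * h $ 3 + h $ 1 * x $ 3) - h $ 2, x $ 1 * h $ 2 + h $ 1 * x $ 2 - b * h $ 3]))
   (at x)"
proof (rule has_derivative_vecI)
  fix i :: 3
  show "((\<lambda>x. lorenz_drift \<sigma> r b x $ i) has_derivative (\<lambda>h. vector
     [\<sigma> * (h $ 2 - h $ 1), r * h $ 1 - (x $ 1 * h $ 3 + h $ 1 * x $ 3) - h $ 2, x $ 1 * h $ 2 + h $ 1 * x $ 2 - b * h $ 3] $ i)) (at x)"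
    using exhaust_3[of i] unfolding lorenz_drift_def
    by (auto intro!: derivative_eq_intros simp: vector_3)
qed

lemma salt_noise_has_derivative: "(salt_noise \<beta> has_derivative salt_noise \<beta>) (at x)"
proof (rule has_derivative_vecI)
  fix i :: 3
  show "((\<lambda>x. salt_noise \<beta> x $ i) has_derivative (\<lambda>h. salt_noise \<beta> h $ i)) (at x)"
    using exhaust_3[of i] unfolding salt_noise_def
    by (auto intro!: derivative_eq_intros simp: vector_3)
qed

text \<open>In this complex notation the Jacobian of the noise acts on a column as multiplication by
  i \<beta>.\<close>

definition lower_pair :: "3 \<Rightarrow> real^3^3 \<Rightarrow> complex" where
  "lower_pair j V = Complex (V $ 2 $ j) (V $ 3 $ j)"

text \<open>Complex valued so that the first row falls under the same result as the other two, with
  angular speed 0.\<close>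

definition upper_entry :: "3 \<Rightarrow> real^3^3 \<Rightarrow> complex" where
  "upper_entry j V = complex_of_real (V $ 1 $ j)"

lemma bounded_linear_lower_pair: "bounded_linear (lower_pair j)"
  by (intro linear_conv_bounded_linear[THEN iffD1] linearI)
    (simp_all add: lower_pair_def complex_eq_iff)

lemma bounded_linear_upper_entry: "bounded_linear (upper_entry j)"
  by (intro linear_conv_bounded_linear[THEN iffD1] linearI)
    (simp_all add: upper_entry_def complex_eq_iff)

lemma lower_pair_jacobian_salt_noise:
  "lower_pair j (jacobian (salt_noise \<beta>) (at x) ** V) = \<i> * \<beta> * lower_pair j V"
  by (simp add: lower_pair_def jacobian_mult_nth[OF salt_noise_has_derivative] salt_noise_def vector_3
      complex_eq_iff)

lemma upper_entry_jacobian_salt_noise: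
  "upper_entry j (jacobian (salt_noise \<beta>) (at x) ** V) = 0"
  by (simp add: upper_entry_def jacobian_mult_nth[OF salt_noise_has_derivative] salt_noise_def vector_3)

lemma jacobian_lorenz_drift_mult:
  shows "(jacobian (lorenz_drift \<sigma> r b) (at x) ** V) $ 1 $ j = \<sigma> * (V $ 2 $ j - V $ 1 $ j)"
    and "(jacobian (lorenz_drift \<sigma> r b) (at x) ** V) $ 2 $ j
      = r * V $ 1 $ j - (x $ 1 * V $ 3 $ j + V $ 1 $ j * x $ 3) - V $ 2 $ j"
    and "(jacobian (lorenz_drift \<sigma> r b) (at x) ** V) $ 3 $ j
      = x $ 1 * V $ 2 $ j + V $ 1 $ j * x $ 2 - b * V $ 3 $ j"
  by (simp_all add: jacobian_mult_nth[OF lorenz_drift_has_derivative] vector_3)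

lemma continuous_on_matrixI:
  fixes f :: "real \<Rightarrow> real^'m^'n"
  assumes "\<And>i j. continuous_on S (\<lambda>s. f s $ i $ j)"
  shows "continuous_on S f"
proof -
  have "continuous_on S (\<lambda>s. \<chi> i. \<chi> j. f s $ i $ j)"
    by (intro continuous_on_vec_lambda assms)
  then show ?thesis by (simp add: vec_nth_inverse)
qed

lemma continuous_on_jacobian_lorenz_drift:
  fixes x :: "real \<Rightarrow> real^3" and V :: "real \<Rightarrow> real^3^3"
  assumes "continuous_on S x" "continuous_on S V"
  shows "continuous_on S (\<lambda>s. jacobian (lorenz_drift \<sigma> r b) (at (x s)) ** V s)"
proof (rule continuous_on_matrixI)
  fix i j :: 3
  show "continuous_on S (\<lambda>s. (jacobian (lorenz_drift \<sigma> r b) (at (x s)) ** V s) $ i $ j)"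
    using exhaust_3[of i]
  proof (elim disjE)
    assume i: "i = 1"
    show ?thesis unfolding i jacobian_lorenz_drift_mult by (intro continuous_intros assms)
  next
    assume i: "i = 2"
    show ?thesis unfolding i jacobian_lorenz_drift_mult by (intro continuous_intros assms)
  next
    assume i: "i = 3"
    show ?thesis unfolding i jacobian_lorenz_drift_mult by (intro continuous_intros assms)
  qed
qed

section \<open>Liouville's formula in the rotated frame\<close>

lemma det_linear_ode_3:
  fixes f p q :: "3 \<Rightarrow> real \<Rightarrow> real"
  assumes f: "\<And>j. (f j has_real_derivative (m11 * f j t + m12 * p j t + m13 * q j t)) (at t within S)"
    and p: "\<And>j. (p j has_real_derivative (m21 * f j t + m22 * p j t + m23 * q j t)) (at t within S)"
    and q: "\<And>j. (q j has_real_derivative (m31 * f j t + m32 * p j t + m33 * q j t)) (at t within S)"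
  shows "((\<lambda>t. det (vector [\<chi> j. f j t, \<chi> j. p j t, \<chi> j. q j t] :: real^3^3)) has_real_derivative
    (m11 + m22 + m33) * det (vector [\<chi> j. f j t, \<chi> j. p j t, \<chi> j. q j t] :: real^3^3)) (at t within S)"
  unfolding det_3 vector_3 vec_lambda_beta
  by (rule DERIV_cong, (rule DERIV_diff DERIV_add DERIV_mult f p q)+, simp add: algebra_simps)

lemma det_rotated_rows:
  fixes f p q :: "3 \<Rightarrow> real"
  shows "det (vector [\<chi> j. f j, \<chi> j. c * p j - s * q j, \<chi> j. s * p j + c * q j] :: real^3^3)
    = (c\<^sup>2 + s\<^sup>2) * det (vector [\<chi> j. f j, \<chi> j. p j, \<chi> j. q j] :: real^3^3)"
  unfolding det_3 vector_3 vec_lambda_beta by (simp add: algebra_simps power2_eq_square)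

lemma has_derivative_Re_Im:
  assumes "(f has_vector_derivative f') F"
  shows "((\<lambda>t. Re (f t)) has_real_derivative Re f') F" "((\<lambda>t. Im (f t)) has_real_derivative Im f') F"
  using has_derivative_Re[OF assms[unfolded has_vector_derivative_def]]
    has_derivative_Im[OF assms[unfolded has_vector_derivative_def]]
  by (simp_all add: has_real_derivative_iff_has_vector_derivative has_vector_derivative_def)

text \<open>\<open>V\<close> is only known to be continuous, but \<open>u\<close> and
  \<open>z\<close> are integrals of continuous functions and hence differentiable. Their coefficient
  matrix is the Jacobian of the drift conjugated by the rotation, so its trace is that of the
  Jacobian.\<close>

lemma det_lorenz_variation:
  fixes V :: "real \<Rightarrow> real^3^3" and x :: "real \<Rightarrow> real^3" and \<theta> :: "real \<Rightarrow> real"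
    and \<sigma> r b :: real
  defines "A \<equiv> \<lambda>s. jacobian (lorenz_drift \<sigma> r b) (at (x s)) ** V s"
  assumes Vc: "continuous_on {0..} V" and xc: "continuous_on {0..} x"
    and \<theta>c: "continuous_on {0..} \<theta>"
    and upper: "\<And>j t. 0 \<le> t \<Longrightarrow> upper_entry j (V t)
      = upper_entry j (mat 1) + integral {0..t} (\<lambda>s. upper_entry j (A s))"
    and lower: "\<And>j t. 0 \<le> t \<Longrightarrow> lower_pair j (V t)
      = cis (\<theta> t) * (lower_pair j (mat 1) + integral {0..t} (\<lambda>s. cis (- \<theta> s) * lower_pair j (A s)))"
    and T: "0 \<le> T"
  shows "det (V T) = exp ((- \<sigma> - 1 - b) * T)"
proof -
  define u where "u j t = upper_entry j (mat 1) + integral {0..t} (\<lambda>s. upper_entry j (A s))" for j t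
  define z where "z j t = lower_pair j (mat 1) + integral {0..t} (\<lambda>s. cis (- \<theta> s) * lower_pair j (A s))" for j t
  define D where "D t = det (vector [\<chi> j. Re (u j t), \<chi> j. Re (z j t), \<chi> j. Im (z j t)] :: real^3^3)" for t
  have Ac: "continuous_on {0..} A"
    unfolding A_def by (rule continuous_on_jacobian_lorenz_drift[OF xc Vc])
  have f: "Re (u j t) = V t $ 1 $ j" if "0 \<le> t" for j t
  proof -
    have "upper_entry j (V t) = u j t" using upper[OF that, of j] by (simp add: u_def)
    from arg_cong[OF this, of Re] show ?thesis by (simp add: upper_entry_def)
  qed
  have z: "lower_pair j (V t) = cis (\<theta> t) * z j t" if "0 \<le> t" for j t
    using lower[OF that, of j] by (simp add: z_def)
  have V2: "V t $ 2 $ j = cos (\<theta> t) * Re (z j t) - sin (\<theta> t) * Im (z j t)"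
    and V3: "V t $ 3 $ j = sin (\<theta> t) * Re (z j t) + cos (\<theta> t) * Im (z j t)" if "0 \<le> t" for j t
    using arg_cong[OF z[OF that], of Re] arg_cong[OF z[OF that], of Im] by (simp_all add: lower_pair_def)
  have detV: "det (V t) = D t" if t: "0 \<le> t" for t
  proof -
    let ?c = "cos (\<theta> t)" and ?s = "sin (\<theta> t)"
    have "det (V t) = det (vector [\<chi> j. Re (u j t), \<chi> j. ?c * Re (z j t) - ?s * Im (z j t),
        \<chi> j. ?s * Re (z j t) + ?c * Im (z j t)] :: real^3^3)"
      unfolding det_3 vector_3 vec_lambda_beta V2[OF t] V3[OF t] f[OF t] ..
    then have "det (V t) = (?c\<^sup>2 + ?s\<^sup>2) * D t"
      unfolding D_def by (simp only: det_rotated_rows)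
    then show ?thesis by simp
  qed
  have D': "(D has_real_derivative (- \<sigma> - 1 - b) * D t) (at t within {0..T})" if t: "t \<in> {0..T}" for t
  proof -
    define c s where "c = cos (\<theta> t)" and "s = sin (\<theta> t)"
    have t0: "0 \<le> t" using t by simp
    have cs: "s\<^sup>2 + c\<^sup>2 = 1" by (simp add: c_def s_def)
    note V2t = V2[OF t0, folded c_def s_def] and V3t = V3[OF t0, folded c_def s_def]
    have "((u j) has_vector_derivative upper_entry j (A t)) (at t within {0..T})" for j
    proof -
      have "continuous_on {0..T} (\<lambda>s. upper_entry j (A s))"
        by (intro linear_continuous_on_compose[OF _ bounded_linear.linear[OF bounded_linear_upper_entry]]
            continuous_on_subset[OF Ac]) auto
      from integral_has_vector_derivative[OF this t] show ?thesis
        unfolding u_def by (auto intro!: derivative_eq_intros)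
    qed
    from has_derivative_Re_Im(1)[OF this]
    have 1: "((\<lambda>t. Re (u j t)) has_real_derivative
        (- \<sigma>) * Re (u j t) + (\<sigma> * c) * Re (z j t) + (- \<sigma> * s) * Im (z j t)) (at t within {0..T})" for j
      by (rule DERIV_cong)
        (simp add: upper_entry_def A_def jacobian_lorenz_drift_mult f[OF t0] V2t algebra_simps)
    have dz: "((z j) has_vector_derivative cis (- \<theta> t) * lower_pair j (A t)) (at t within {0..T})" for j
    proof -
      have "continuous_on {0..T} (\<lambda>s. lower_pair j (A s))"
        by (intro linear_continuous_on_compose[OF _ bounded_linear.linear[OF bounded_linear_lower_pair]]
            continuous_on_subset[OF Ac]) auto
      then have "continuous_on {0..T} (\<lambda>s. cis (- \<theta> s) * lower_pair j (A s))"
        by (intro continuous_intros continuous_on_subset[OF \<theta>c]) auto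
      from integral_has_vector_derivative[OF this t] show ?thesis
        unfolding z_def by (auto intro!: derivative_eq_intros)
    qed
    \<comment> \<open>The lower block with rows (-1, -x1) and (x1, -b) conjugated by the rotation.
      The entries x1 form an antisymmetric block, which commutes with rotations and contributes
      nothing to the diagonal.\<close>
    have 2: "((\<lambda>t. Re (z j t)) has_real_derivative
        (c * (r - x t $ 3) + s * x t $ 2) * Re (u j t) + (- c\<^sup>2 - b * s\<^sup>2) * Re (z j t)
          + (s * c * (1 - b) - x t $ 1 * (s\<^sup>2 + c\<^sup>2)) * Im (z j t)) (at t within {0..T})" for j
      by (rule DERIV_cong[OF has_derivative_Re_Im(1)[OF dz]])
        (simp only: lower_pair_def A_def jacobian_lorenz_drift_mult f[OF t0] V2t V3t
          times_complex.sel cis.sel complex.sel cos_minus sin_minus c_def[symmetric] s_def[symmetric],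
          simp add: algebra_simps power2_eq_square)
    have 3: "((\<lambda>t. Im (z j t)) has_real_derivative
        (- s * (r - x t $ 3) + c * x t $ 2) * Re (u j t) + (s * c * (1 - b) + x t $ 1 * (s\<^sup>2 + c\<^sup>2)) * Re (z j t)
          + (- s\<^sup>2 - b * c\<^sup>2) * Im (z j t)) (at t within {0..T})" for j
      by (rule DERIV_cong[OF has_derivative_Re_Im(2)[OF dz]])
        (simp only: lower_pair_def A_def jacobian_lorenz_drift_mult f[OF t0] V2t V3t
          times_complex.sel cis.sel complex.sel cos_minus sin_minus c_def[symmetric] s_def[symmetric],
          simp add: algebra_simps power2_eq_square)
    have "- \<sigma> + (- c\<^sup>2 - b * s\<^sup>2) + (- s\<^sup>2 - b * c\<^sup>2) = - \<sigma> - (1 + b) * (s\<^sup>2 + c\<^sup>2)"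
      by (simp only: algebra_simps)
    also have "\<dots> = - \<sigma> - 1 - b" by (simp add: cs)
    finally have "- \<sigma> + (- c\<^sup>2 - b * s\<^sup>2) + (- s\<^sup>2 - b * c\<^sup>2) = - \<sigma> - 1 - b" .
    then show ?thesis
      using det_linear_ode_3[where f = "\<lambda>j t. Re (u j t)" and p = "\<lambda>j t. Re (z j t)"
          and q = "\<lambda>j t. Im (z j t)", OF 1 2 3]
      unfolding D_def by (simp only:)
  qed
  have "((\<lambda>t. D t * exp ((\<sigma> + 1 + b) * t)) has_real_derivative 0) (at t within {0..T})" if "t \<in> {0..T}" for t
  proof -
    have "((\<lambda>t. exp ((\<sigma> + 1 + b) * t)) has_real_derivative exp ((\<sigma> + 1 + b) * t) * (\<sigma> + 1 + b)) (at t within {0..T})"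
      by (auto intro!: derivative_eq_intros)
    from DERIV_mult[OF D'[OF that] this] show ?thesis
      by (rule DERIV_cong) (simp add: algebra_simps)
  qed
  then obtain k where k: "\<And>t. t \<in> {0..T} \<Longrightarrow> D t * exp ((\<sigma> + 1 + b) * t) = k"
    using has_field_derivative_zero_constant[of "{0..T}" "\<lambda>t. D t * exp ((\<sigma> + 1 + b) * t)"] by auto
  have "D 0 = 1"
    unfolding D_def u_def z_def det_3 by (simp add: vector_3 upper_entry_def lower_pair_def mat_def)
  then have "D T * exp ((\<sigma> + 1 + b) * T) = 1"
    using k[of 0] k[of T] T by simp
  then have "D T = exp (- ((\<sigma> + 1 + b) * T))"
    by (simp add: exp_minus inverse_eq_divide eq_divide_eq)
  also have "- ((\<sigma> + 1 + b) * T) = (- \<sigma> - 1 - b) * T" by (simp add: algebra_simps)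
  finally show ?thesis using detV[OF T] by simp
qed

section \<open>From the Stratonovich equation to the determinant\<close>

context brownian_space
begin

lemma semimartingale_component:
  assumes "continuous_semimartingale P F X" "e \<in> Basis"
  shows "0 \<le> t \<Longrightarrow> (\<lambda>\<omega>. X t \<omega> \<bullet> e) \<in> borel_measurable (F t)"
    and "AE \<omega> in P. continuous_on {0..} (\<lambda>t. X t \<omega> \<bullet> e)"
proof -
  have "real_continuous_semimartingale P F (\<lambda>t \<omega>. X t \<omega> \<bullet> e)"
    using assms unfolding continuous_semimartingale_def by blast
  then have "adapted_process F (\<lambda>t \<omega>. X t \<omega> \<bullet> e)" "continuous_process P (\<lambda>t \<omega>. X t \<omega> \<bullet> e)"
    unfolding real_continuous_semimartingale_def by blast+
  then show "0 \<le> t \<Longrightarrow> (\<lambda>\<omega>. X t \<omega> \<bullet> e) \<in> borel_measurable (F t)"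
    and "AE \<omega> in P. continuous_on {0..} (\<lambda>t. X t \<omega> \<bullet> e)"
    by (simp_all add: adapted_process_def continuous_process_def)
qed

lemma semimartingale_measurable:
  assumes "continuous_semimartingale P F X" "0 \<le> t"
  shows "X t \<in> borel_measurable (F t)"
  by (subst borel_measurable_euclidean_space) (intro ballI semimartingale_component(1)[OF assms(1) _ assms(2)])

lemma semimartingale_continuous:
  assumes "continuous_semimartingale P F X"
  shows "AE \<omega> in P. continuous_on {0..} (\<lambda>t. X t \<omega>)"
proof -
  have "AE \<omega> in P. \<forall>e\<in>Basis. continuous_on {0..} (\<lambda>t. X t \<omega> \<bullet> e)"
    using semimartingale_component(2)[OF assms] by (intro AE_finite_allI) auto
  then show ?thesis by eventually_elim (subst continuous_on_componentwise)
qed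

lemma stratonovich_sum_measurable:
  assumes H: "continuous_semimartingale P F H" and p: "is_partition t n p"
  shows "stratonovich_sum H W n p \<in> borel_measurable P"
proof -
  have p0: "0 \<le> p i" if "i \<le> n" for i
    using that
  proof (induction i)
    case (Suc i)
    then have "0 \<le> p i" "p i \<le> p (Suc i)" using p by (auto simp: is_partition_def)
    then show ?case by simp
  qed (use p in \<open>simp add: is_partition_def\<close>)
  have m: "W (p i) \<in> borel_measurable P" "H (p i) \<in> borel_measurable P" if "i \<le> n" for i
    using F_measurable[OF W_adapted[OF p0[OF that]]] F_measurable[OF semimartingale_measurable[OF H p0[OF that]]]
    by auto
  show ?thesis
    unfolding stratonovich_sum_def[abs_def]
    by (intro borel_measurable_sum borel_measurable_scaleR borel_measurable_diff borel_measurable_add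
        borel_measurable_const m) auto
qed

text \<open>Over a partition of [0, t] the increments and the drift integrals telescope, leaving
  \<open>L\<close> of the Stratonovich integral minus its trapezoidal sum. That this is small in
  probability is the definition of the integral.\<close>

lemma stratonovich_equation_null_germ:
  fixes X a h :: "real \<Rightarrow> 'w \<Rightarrow> 'e::euclidean_space" and L :: "'e \<Rightarrow> 'f::banach"
  assumes eq: "stratonovich_equation P F W X a h" and L: "bounded_linear L"
    and ac: "AE \<omega> in P. continuous_on {0..} (\<lambda>t. a t \<omega>)"
  shows "null_germ (\<lambda>s t \<omega>. L (X t \<omega>) - L (X s \<omega>) - integral {s..t} (\<lambda>u. L (a u \<omega>))
    - (W t \<omega> - W s \<omega>) *\<^sub>R ((1 / 2) *\<^sub>R (L (h s \<omega>) + L (h t \<omega>))))"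
  unfolding null_germ_def
proof (intro allI impI)
  fix t \<epsilon> :: real assume t: "0 \<le> t" and \<epsilon>: "0 < \<epsilon>"
  interpret L: bounded_linear L by (rule L)
  obtain B where B: "B > 0" "\<And>x. norm (L x) \<le> norm x * B" using L.pos_bounded by blast
  obtain I where I: "has_stratonovich_integral P F W h t I"
    and X: "AE \<omega> in P. X t \<omega> = X 0 \<omega> + integral {0..t} (\<lambda>s. a s \<omega>) + I \<omega>"
    using eq t unfolding stratonovich_equation_def by blast
  have h: "continuous_semimartingale P F h" and Im[measurable]: "I \<in> borel_measurable P"
    using I by (auto simp: has_stratonovich_integral_def)
  \<comment> \<open>The first bound serves the probability, the second the size after
    \<open>L\<close> with operator bound \<open>B\<close>.\<close>
  define e where "e = min \<epsilon> (\<epsilon> / B)"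
  have e: "0 < e" "e \<le> \<epsilon>" "e * B \<le> \<epsilon>"
    using \<epsilon> B(1) by (auto simp: e_def min_def field_simps)
  obtain \<delta> where \<delta>: "\<delta> > 0" "\<And>n p. is_partition t n p \<and> (\<forall>i<n. p (Suc i) - p i < \<delta>) \<Longrightarrow>
      measure P {\<omega> \<in> space P. norm (stratonovich_sum h W n p \<omega> - I \<omega>) > e} < e"
    using I e(1) unfolding has_stratonovich_integral_def by blast
  show "\<exists>\<delta>>0. \<forall>n p. is_partition t n p \<and> (\<forall>i<n. p (Suc i) - p i < \<delta>) \<longrightarrow>
      likely \<epsilon> (\<lambda>\<omega>. norm (\<Sum>i<n. L (X (p (Suc i)) \<omega>) - L (X (p i) \<omega>)
        - integral {p i..p (Suc i)} (\<lambda>u. L (a u \<omega>))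
        - (W (p (Suc i)) \<omega> - W (p i) \<omega>) *\<^sub>R ((1 / 2) *\<^sub>R (L (h (p i) \<omega>) + L (h (p (Suc i)) \<omega>)))) \<le> \<epsilon>)"
  proof (intro exI[of _ \<delta>] conjI allI impI \<delta>(1))
    fix n p assume p: "is_partition t n p \<and> (\<forall>i<n. p (Suc i) - p i < \<delta>)"
    let ?E = "{\<omega> \<in> space P. norm (stratonovich_sum h W n p \<omega> - I \<omega>) > e}"
    have [measurable]: "stratonovich_sum h W n p \<in> borel_measurable P"
      using stratonovich_sum_measurable[OF h] p by blast
    have E: "?E \<in> events" by measurable
    have "AE \<omega> in P. \<omega> \<notin> ?E \<longrightarrow> norm (\<Sum>i<n. L (X (p (Suc i)) \<omega>) - L (X (p i) \<omega>)
        - integral {p i..p (Suc i)} (\<lambda>u. L (a u \<omega>))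
        - (W (p (Suc i)) \<omega> - W (p i) \<omega>) *\<^sub>R ((1 / 2) *\<^sub>R (L (h (p i) \<omega>) + L (h (p (Suc i)) \<omega>)))) \<le> \<epsilon>"
      using X ac AE_space
    proof eventually_elim
      case (elim \<omega>)
      have ca: "continuous_on {0..t} (\<lambda>s. a s \<omega>)" by (rule continuous_on_subset[OF elim(2)]) auto
      have cL: "continuous_on {0..t} (\<lambda>s. L (a s \<omega>))"
        by (rule linear_continuous_on_compose[OF ca L.linear])
      have "(\<Sum>i<n. L (X (p (Suc i)) \<omega>) - L (X (p i) \<omega>)) = L (X (p n) \<omega>) - L (X (p 0) \<omega>)"
        by (rule sum_lessThan_telescope)
      moreover have "(\<Sum>i<n. integral {p i..p (Suc i)} (\<lambda>u. L (a u \<omega>))) = integral {0..t} (\<lambda>u. L (a u \<omega>))"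
        using sum_integral_partition[OF cL] p by blast
      moreover have "integral {0..t} (\<lambda>u. L (a u \<omega>)) = L (integral {0..t} (\<lambda>u. a u \<omega>))"
        using integral_linear[OF integrable_continuous_real[OF ca] L] by (simp add: o_def)
      moreover have "(\<Sum>i<n. (W (p (Suc i)) \<omega> - W (p i) \<omega>) *\<^sub>R ((1 / 2) *\<^sub>R (L (h (p i) \<omega>) + L (h (p (Suc i)) \<omega>))))
          = L (stratonovich_sum h W n p \<omega>)"
        unfolding stratonovich_sum_def by (simp add: L.sum L.scaleR L.add)
      ultimately have "(\<Sum>i<n. L (X (p (Suc i)) \<omega>) - L (X (p i) \<omega>)
        - integral {p i..p (Suc i)} (\<lambda>u. L (a u \<omega>))
        - (W (p (Suc i)) \<omega> - W (p i) \<omega>) *\<^sub>R ((1 / 2) *\<^sub>R (L (h (p i) \<omega>) + L (h (p (Suc i)) \<omega>))))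
        = L (X (p n) \<omega>) - L (X (p 0) \<omega>) - L (integral {0..t} (\<lambda>u. a u \<omega>)) - L (stratonovich_sum h W n p \<omega>)"
        by (simp only: sum_subtractf)
      also have "\<dots> = L (X t \<omega> - X 0 \<omega> - integral {0..t} (\<lambda>u. a u \<omega>) - stratonovich_sum h W n p \<omega>)"
        using p by (simp add: is_partition_def L.diff)
      also have "\<dots> = L (I \<omega> - stratonovich_sum h W n p \<omega>)"
        unfolding elim(1) by (simp add: algebra_simps)
      finally have S: "(\<Sum>i<n. L (X (p (Suc i)) \<omega>) - L (X (p i) \<omega>)
        - integral {p i..p (Suc i)} (\<lambda>u. L (a u \<omega>))
        - (W (p (Suc i)) \<omega> - W (p i) \<omega>) *\<^sub>R ((1 / 2) *\<^sub>R (L (h (p i) \<omega>) + L (h (p (Suc i)) \<omega>))))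
        = L (I \<omega> - stratonovich_sum h W n p \<omega>)" .
      show ?case
      proof
        assume "\<omega> \<notin> ?E"
        then have "norm (I \<omega> - stratonovich_sum h W n p \<omega>) \<le> e"
          using elim(3) by (simp add: norm_minus_commute not_less)
        then have "norm (I \<omega> - stratonovich_sum h W n p \<omega>) * B \<le> e * B"
          using B(1) by (intro mult_right_mono) auto
        then show "norm (\<Sum>i<n. L (X (p (Suc i)) \<omega>) - L (X (p i) \<omega>)
          - integral {p i..p (Suc i)} (\<lambda>u. L (a u \<omega>))
          - (W (p (Suc i)) \<omega> - W (p i) \<omega>) *\<^sub>R ((1 / 2) *\<^sub>R (L (h (p i) \<omega>) + L (h (p (Suc i)) \<omega>)))) \<le> \<epsilon>"
          unfolding S using B(2)[of "I \<omega> - stratonovich_sum h W n p \<omega>"] e(3) by linarith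
      qed
    qed
    moreover have "prob ?E \<le> \<epsilon>" using \<delta>(2)[OF p] e(2) by simp
    ultimately show "likely \<epsilon> (\<lambda>\<omega>. norm (\<Sum>i<n. L (X (p (Suc i)) \<omega>) - L (X (p i) \<omega>)
        - integral {p i..p (Suc i)} (\<lambda>u. L (a u \<omega>))
        - (W (p (Suc i)) \<omega> - W (p i) \<omega>) *\<^sub>R ((1 / 2) *\<^sub>R (L (h (p i) \<omega>) + L (h (p (Suc i)) \<omega>)))) \<le> \<epsilon>)"
      unfolding likely_def using E by blast
  qed
qed

text \<open>Under \<open>rot\<close> the averaged noise coefficient becomes the trapezoidal value of
  i \<beta> w, so the germ of the equation is literally \<open>trapezoidal_germ\<close> for the
  angle \<beta> W. The speed \<beta> is arbitrary, and 0 covers components without noise.\<close>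

lemma stratonovich_rotation_component:
  fixes X a h :: "real \<Rightarrow> 'w \<Rightarrow> 'e::euclidean_space" and L :: "'e \<Rightarrow> complex"
  assumes eq: "stratonovich_equation P F W X a h" and L: "bounded_linear L"
    and am: "\<And>t. 0 \<le> t \<Longrightarrow> a t \<in> borel_measurable (F t)"
    and ac: "AE \<omega> in P. continuous_on {0..} (\<lambda>t. a t \<omega>)"
    and X0: "AE \<omega> in P. X 0 \<omega> = c"
    and rot: "\<And>t \<omega>. L (h t \<omega>) = \<i> * \<beta> * L (X t \<omega>)"
  shows "AE \<omega> in P. \<forall>t\<ge>0. L (X t \<omega>)
    = cis (\<beta> * W t \<omega>) * (L c + integral {0..t} (\<lambda>u. cis (- (\<beta> * W u \<omega>)) * L (a u \<omega>)))"
proof (rule rotation_equation_solution)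
  have X: "continuous_semimartingale P F X" using eq by (simp add: stratonovich_equation_def)
  have Lc: "continuous_on UNIV L" by (rule linear_continuous_on[OF L])
  show "(\<lambda>\<omega>. L (X s \<omega>)) \<in> borel_measurable (F s)" if "0 \<le> s" for s
    using borel_measurable_continuous_on[OF Lc semimartingale_measurable[OF X that]] .
  show "(\<lambda>\<omega>. L (a s \<omega>)) \<in> borel_measurable (F s)" if "0 \<le> s" for s
    using borel_measurable_continuous_on[OF Lc am[OF that]] .
  show "AE \<omega> in P. continuous_on {0..} (\<lambda>s. L (X s \<omega>))"
    using semimartingale_continuous[OF X]
    by eventually_elim (rule linear_continuous_on_compose[OF _ bounded_linear.linear[OF L]])
  show "AE \<omega> in P. continuous_on {0..} (\<lambda>s. L (a s \<omega>))"
    using ac by eventually_elim (rule linear_continuous_on_compose[OF _ bounded_linear.linear[OF L]])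
  show "AE \<omega> in P. L (X 0 \<omega>) = L c" using X0 by eventually_elim simp
  have "(W t \<omega> - W s \<omega>) *\<^sub>R ((1 / 2) *\<^sub>R (L (h s \<omega>) + L (h t \<omega>)))
      = (L (X s \<omega>) + L (X t \<omega>)) / 2 * (\<i> * complex_of_real (\<beta> * W t \<omega> - \<beta> * W s \<omega>))" for s t \<omega>
    by (simp add: rot scaleR_conv_of_real field_simps)
  then have "trapezoidal_germ (\<lambda>u. L (X u \<omega>)) (\<lambda>u. L (a u \<omega>)) (\<lambda>u. \<beta> * W u \<omega>) s t
      = L (X t \<omega>) - L (X s \<omega>) - integral {s..t} (\<lambda>u. L (a u \<omega>))
        - (W t \<omega> - W s \<omega>) *\<^sub>R ((1 / 2) *\<^sub>R (L (h s \<omega>) + L (h t \<omega>)))" for s t \<omega>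
    by (simp only: trapezoidal_germ_def)
  then show "null_germ (\<lambda>s t \<omega>. trapezoidal_germ (\<lambda>u. L (X u \<omega>)) (\<lambda>u. L (a u \<omega>)) (\<lambda>u. \<beta> * W u \<omega>) s t)"
    using stratonovich_equation_null_germ[OF eq L ac] by simp
qed

lemma salt_lorenz_det:
  assumes flow: "salt_lorenz_flow P F W \<sigma> r b \<beta> x0 x v"
  shows "AE \<omega> in P. \<forall>t\<ge>0. det (v t \<omega>) = exp ((- \<sigma> - 1 - b) * t)"
proof -
  let ?A = "\<lambda>t \<omega>. jacobian (lorenz_drift \<sigma> r b) (at (x t \<omega>)) ** v t \<omega>"
  have x: "continuous_semimartingale P F x" and v0: "AE \<omega> in P. v 0 \<omega> = mat 1"
    and veq: "stratonovich_equation P F W v ?A (\<lambda>t \<omega>. jacobian (salt_noise \<beta>) (at (x t \<omega>)) ** v t \<omega>)"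
    using flow by (auto simp: salt_lorenz_flow_def stratonovich_solution_def variational_solution_def
        stratonovich_equation_def)
  have v: "continuous_semimartingale P F v" using veq by (simp add: stratonovich_equation_def)
  have xm: "(\<lambda>\<omega>. x t \<omega> $ i) \<in> borel_measurable (F t)" if "0 \<le> t" for t i
    using semimartingale_component(1)[OF x _ that, of "axis i 1"] by (simp add: axis_in_Basis_iff inner_axis)
  have vm: "(\<lambda>\<omega>. v t \<omega> $ i $ j) \<in> borel_measurable (F t)" if "0 \<le> t" for t i j
    using semimartingale_component(1)[OF v _ that, of "axis i (axis j 1)"]
    by (simp add: axis_in_Basis_iff inner_axis)
  have Am: "?A t \<in> borel_measurable (F t)" if "0 \<le> t" for t
  proof -
    note [measurable] = xm[OF that] vm[OF that]
    have "(\<lambda>\<omega>. ?A t \<omega> $ i $ j) \<in> borel_measurable (F t)" for i j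
      using exhaust_3[of i] by (auto simp: jacobian_lorenz_drift_mult)
    then show ?thesis
      by (subst borel_measurable_euclidean_space) (auto simp: Basis_vec_def inner_axis)
  qed
  have Ac: "AE \<omega> in P. continuous_on {0..} (\<lambda>t. ?A t \<omega>)"
    using semimartingale_continuous[OF x] semimartingale_continuous[OF v]
    by eventually_elim (rule continuous_on_jacobian_lorenz_drift)
  have "AE \<omega> in P. \<forall>t\<ge>0. lower_pair j (v t \<omega>)
      = cis (\<beta> * W t \<omega>) * (lower_pair j (mat 1) + integral {0..t} (\<lambda>u. cis (- (\<beta> * W u \<omega>)) * lower_pair j (?A u \<omega>)))" for j
    by (rule stratonovich_rotation_component[where X = v and a = ?A and L = "lower_pair j" and c = "mat 1" and \<beta> = \<beta>,
          OF veq bounded_linear_lower_pair Am Ac v0 lower_pair_jacobian_salt_noise])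
  then have lower: "AE \<omega> in P. \<forall>j\<in>UNIV. \<forall>t\<ge>0. lower_pair j (v t \<omega>)
      = cis (\<beta> * W t \<omega>) * (lower_pair j (mat 1) + integral {0..t} (\<lambda>u. cis (- (\<beta> * W u \<omega>)) * lower_pair j (?A u \<omega>)))"
    by (intro AE_finite_allI) auto
  \<comment> \<open>Instance with angular speed 0, where the rotation is the identity and the
    formula is the integrated equation for all times at once, outside one null set.\<close>
  have "AE \<omega> in P. \<forall>t\<ge>0. upper_entry j (v t \<omega>)
      = cis (0 * W t \<omega>) * (upper_entry j (mat 1) + integral {0..t} (\<lambda>u. cis (- (0 * W u \<omega>)) * upper_entry j (?A u \<omega>)))" for j
    by (rule stratonovich_rotation_component[where X = v and a = ?A and L = "upper_entry j" and c = "mat 1" and \<beta> = 0,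
          OF veq bounded_linear_upper_entry Am Ac v0]) (simp_all add: upper_entry_jacobian_salt_noise)
  then have upper: "AE \<omega> in P. \<forall>j\<in>UNIV. \<forall>t\<ge>0. upper_entry j (v t \<omega>)
      = upper_entry j (mat 1) + integral {0..t} (\<lambda>u. upper_entry j (?A u \<omega>))"
    by (intro AE_finite_allI) auto
  show ?thesis
    using semimartingale_continuous[OF x] semimartingale_continuous[OF v] W_continuous lower upper
  proof eventually_elim
    case (elim \<omega>)
    show ?case
    proof (intro allI impI)
      fix t :: real assume t: "0 \<le> t"
      show "det (v t \<omega>) = exp ((- \<sigma> - 1 - b) * t)"
      proof (rule det_lorenz_variation[where V = "\<lambda>t. v t \<omega>" and x = "\<lambda>t. x t \<omega>" and \<theta> = "\<lambda>t. \<beta> * W t \<omega>" and r = r])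
        show "continuous_on {0..} (\<lambda>t. \<beta> * W t \<omega>)" using elim(3) by (intro continuous_intros)
      qed (use elim t in auto)
    qed
  qed
qed

lemma salt_lorenz_sum_lyapunov_exponents:
  assumes flow: "salt_lorenz_flow P F W \<sigma> r b \<beta> x0 x v"
    and osel: "AE \<omega> in P. oseledets_convergent (\<lambda>t. v t \<omega>)"
  shows "AE \<omega> in P. (\<Sum>i=1..3. lyapunov_exponent (\<lambda>t. v t \<omega>) i) = - \<sigma> - 1 - b"
  using osel salt_lorenz_det[OF flow]
proof eventually_elim
  case (elim \<omega>)
  then show ?case using sum_lyapunov_exponents[of "\<lambda>t. v t \<omega>" "- \<sigma> - 1 - b"] by simp
qed

end

text \<open>The second conjunct renders the comparison with the deterministic system, realised on
  the same probability space and with an initial point of its own.\<close>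

theorem mainTheorem2:
  fixes P :: "'w measure" and F :: "real \<Rightarrow> 'w measure" and W :: "real \<Rightarrow> 'w \<Rightarrow> real"
    and \<sigma> r b \<beta> :: real and x0 :: "real^3"
    and x :: "real \<Rightarrow> 'w \<Rightarrow> real^3" and v :: "real \<Rightarrow> 'w \<Rightarrow> real^3^3"
  assumes "\<sigma> > 0" and "r > 0" and "b > 0"
    and "filtered_prob_space P F" and "brownian_motion P F W"
    and "salt_lorenz_flow P F W \<sigma> r b \<beta> x0 x v"
    and "AE \<omega> in P. oseledets_convergent (\<lambda>t. v t \<omega>)"
  shows "(AE \<omega> in P. (\<Sum>i=1..3. lyapunov_exponent (\<lambda>t. v t \<omega>) i) = - \<sigma> - 1 - b) \<and>
    (\<forall>y0 y u. salt_lorenz_flow P F W \<sigma> r b 0 y0 y u \<longrightarrow>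
       (AE \<omega> in P. oseledets_convergent (\<lambda>t. u t \<omega>)) \<longrightarrow>
       (AE \<omega> in P. (\<Sum>i=1..3. lyapunov_exponent (\<lambda>t. v t \<omega>) i) =
                    (\<Sum>i=1..3. lyapunov_exponent (\<lambda>t. u t \<omega>) i)))"
proof -
  interpret brownian_space P F W
    by (rule brownian_space.intro[OF assms(4,5)])
  have v: "AE \<omega> in P. (\<Sum>i=1..3. lyapunov_exponent (\<lambda>t. v t \<omega>) i) = - \<sigma> - 1 - b"
    by (rule salt_lorenz_sum_lyapunov_exponents[OF assms(6,7)])
  show ?thesis
  proof (intro conjI v allI impI)
    fix y0 y u
    assume "salt_lorenz_flow P F W \<sigma> r b 0 y0 y u" "AE \<omega> in P. oseledets_convergent (\<lambda>t. u t \<omega>)"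
    from v salt_lorenz_sum_lyapunov_exponents[OF this]
    show "AE \<omega> in P. (\<Sum>i=1..3. lyapunov_exponent (\<lambda>t. v t \<omega>) i)
        = (\<Sum>i=1..3. lyapunov_exponent (\<lambda>t. u t \<omega>) i)"
      by eventually_elim simp
  qed
qed

end
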